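(* Let $\mathcal D=\{a_1,a_2,a_3\}\subset\mathbb{CP}^1$ be three distinct points and let $\chi:\pi_1(\mathbb{CP}^1\setminus\mathcal D)\to GL(2,\mathbb C)$ be a diagonal representation, i.e. one for which the monodromy matrices $G_1,G_2,G_3$ can be simultaneously reduced to the form $G_i=\mathrm{diag}(\alpha_i,\beta_i)$, $i=1,2,3$. Then $\chi$ can be realized by the monodromy of a Riemann equation with singular points $\mathcal D$ if and only if at least one of the matrices $G_1,G_2,G_3$ is scalar.
   Context: A Riemann equation with singular points $\mathcal D=\{a_1,a_2,a_3\}$ is a second order linear differential equation $y''+b_1(z)y'+b_2(z)y=0$ on the Riemann sphere whose coefficients are holomorphic outside $\mathcal D$ (with every point of $\mathbb{CP}^1\setminus\mathcal D$, including $\infty$ in the local coordinate $1/z$ if $\infty\notin\mathcal D$, being an ordinary point) and which is Fuchsian at each $a_i$: in a local coordinate $t$ centred at $a_i$, the coefficient of the $(2-j)$-th derivative has a pole of order at most $j$, $j=1,2$. Monodromy: continuing a basis (row) $Y$ of the two-dimensional solution space near a base point along a loop $\gamma$ in $\mathbb{CP}^1\setminus\mathcal D$ gives another basis $Y^*$ with $Y=Y^*G_\gamma$, $G_\gamma\in GL(2,\mathbb C)$. The matrix depends only on the homotopy class of $\gamma$, and $[\gamma]\mapsto G_\gamma$ is the monodromy representation, defined up to simultaneous conjugation (choice of basis). An equation realizes $\chi$ if $\chi$ is its monodromy representation in some basis of solutions. The group $\pi_1(\mathbb{CP}^1\setminus\mathcal D)$ is generated by loops around $a_1,a_2,a_3$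 whose product is trivial; $G_i$ denotes the matrix corresponding to the loop around $a_i$. *)

theory Defs
  imports "HOL-Complex_Analysis.Complex_Analysis" "HOL-Algebra.Generated_Groups"
begin

section \<open>The Riemann sphere\<close>

datatype cp1 = Fin complex | Infty

text \<open>The inverse of the standard local coordinate \<open>t\<close> centred at a point:
  \<open>t = z - c\<close> at a finite point \<open>c\<close>, and \<open>t = 1 / z\<close> at infinity.\<close>

fun chart :: "cp1 \<Rightarrow> complex \<Rightarrow> cp1" where
  "chart (Fin c) t = Fin (c + t)"
| "chart Infty t = (if t = 0 then Infty else Fin (1 / t))"

text \<open>The topology glued from the coordinates \<open>z\<close> and \<open>1 / z\<close>.\<close>

instantiation cp1 :: topological_space
begin

definition open_cp1 :: "cp1 set \<Rightarrow> bool" where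
  "open_cp1 U \<longleftrightarrow> open (Fin -` U) \<and> open (chart Infty -` U)"

instance
  by standard (auto simp: open_cp1_def vimage_Union)

end

section \<open>The fundamental group\<close>

definition is_loop :: "'a::topological_space set \<Rightarrow> 'a \<Rightarrow> (real \<Rightarrow> 'a) \<Rightarrow> bool" where
  "is_loop S x g \<longleftrightarrow> path g \<and> path_image g \<subseteq> S \<and> pathstart g = x \<and> pathfinish g = x"

definition path_class :: "'a::topological_space set \<Rightarrow> (real \<Rightarrow> 'a) \<Rightarrow> (real \<Rightarrow> 'a) set" where
  "path_class S g = {h. homotopic_paths S g h}"

text \<open>In the product \<open>A \<otimes> B\<close> the loop in \<open>A\<close> is traversed first.\<close>

definition fundamental_group ::
  "'a::topological_space set \<Rightarrow> 'a \<Rightarrow> (real \<Rightarrow> 'a) set monoid" where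
  "fundamental_group S x =
     \<lparr>carrier = {path_class S g | g. is_loop S x g},
      mult = (\<lambda>A B. {k. \<exists>g\<in>A. \<exists>h\<in>B. homotopic_paths S (g +++ h) k}),
      one = path_class S (\<lambda>_. x)\<rparr>"

lemma homotopic_paths_const_left:
  assumes "is_loop S x p"
  shows "homotopic_paths S ((\<lambda>_. x) +++ p) p"
proof (rule homotopic_paths_sym, rule homotopic_paths_reparametrize)
  show "path p" "path_image p \<subseteq> S"
    using assms by (auto simp: is_loop_def)
  show "continuous_on {0..1} (\<lambda>t::real. max 0 (2 * t - 1))"
    by (intro continuous_intros)
  show "((\<lambda>_. x) +++ p) t = p (max 0 (2 * t - 1))" if "t \<in> {0..1}" for t
  proof -
    have "t = 1/2" if "1 \<le> 2 * t" "t \<le> 1/2"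
      using that by simp
    then show ?thesis
      using assms by (fastforce simp: joinpaths_def is_loop_def pathstart_def max_def)
  qed
qed auto

lemma homotopic_paths_reversepath_left:
  assumes "is_loop S x p"
  shows "homotopic_paths S (reversepath p +++ p) (\<lambda>_. x)"
proof -
  let ?m = "\<lambda>u::real. max (1 - 2 * u) (2 * u - 1)"
  let ?k = "\<lambda>y::real \<times> real. max (fst y) (?m (snd y))"
  have p: "continuous_on {0..1} p" "p ` {0..1} \<subseteq> S" "p 0 = x" "p 1 = x"
    using assms by (auto simp: is_loop_def path_def path_image_def pathstart_def pathfinish_def)
  have k: "?k ` ({0..1} \<times> {0..1}) \<subseteq> {0..1}"
    by auto
  have "continuous_on ({0..1} \<times> {0..1}) (p \<circ> ?k)"
    by (rule continuous_on_compose)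
       (intro continuous_intros, rule continuous_on_subset[OF p(1) k])
  moreover have "p \<circ> ?k \<in> ({0..1} \<times> {0..1}) \<rightarrow> S"
    using p(2) k by fastforce
  moreover have "(p \<circ> ?k) (0, u) = (reversepath p +++ p) u" if "u \<in> {0..1}" for u
  proof (cases "u \<le> 1/2")
    case True
    then have "?k (0, u) = 1 - 2 * u" by auto
    then show ?thesis using True by (simp only: o_def) (simp add: joinpaths_def reversepath_def)
  next
    case False
    then have "?k (0, u) = 2 * u - 1" by auto
    then show ?thesis using False by (simp only: o_def) (simp add: joinpaths_def)
  qed
  moreover have "(p \<circ> ?k) (1, u) = x" if "u \<in> {0..1}" for u
  proof -
    have "?k (1, u) = 1" using that by auto
    then show ?thesis using p by (simp only: o_def)
  qed
  ultimately show ?thesis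
    unfolding homotopic_paths
    by (intro exI[of _ "p \<circ> ?k"])
       (use p in \<open>auto simp: pathstart_def pathfinish_def joinpaths_def reversepath_def max_def\<close>)
qed

lemma mult_path_class:
  assumes "is_loop S x g" "is_loop S x h"
  shows "path_class S g \<otimes>\<^bsub>fundamental_group S x\<^esub> path_class S h = path_class S (g +++ h)"
proof -
  have "homotopic_paths S (g +++ h) k"
    if "homotopic_paths S g g'" "homotopic_paths S h h'" "homotopic_paths S (g' +++ h') k" for g' h' k
    using homotopic_paths_join[OF that(1,2)] that(3) assms
    by (auto simp: is_loop_def intro: homotopic_paths_trans)
  moreover have "homotopic_paths S g g" "homotopic_paths S h h"
    using assms by (auto simp: is_loop_def)
  ultimately show ?thesis
    unfolding fundamental_group_def path_class_def by (auto simp del: homotopic_paths_refl)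
qed

lemma path_class_eqI: "homotopic_paths S g h \<Longrightarrow> path_class S g = path_class S h"
  unfolding path_class_def by (auto intro: homotopic_paths_trans homotopic_paths_sym)

lemma is_loop_join: "is_loop S x g \<Longrightarrow> is_loop S x h \<Longrightarrow> is_loop S x (g +++ h)"
  by (auto simp: is_loop_def path_image_join)

lemma is_loop_reversepath: "is_loop S x g \<Longrightarrow> is_loop S x (reversepath g)"
  by (auto simp: is_loop_def)

lemma is_loop_const: "x \<in> S \<Longrightarrow> is_loop S x (\<lambda>_. x)"
  by (auto simp: is_loop_def path_def path_image_def pathstart_def pathfinish_def)

lemma carrier_fundamental_group:
  "carrier (fundamental_group S x) = {path_class S g | g. is_loop S x g}"
  by (simp add: fundamental_group_def)

lemma one_fundamental_group: "\<one>\<^bsub>fundamental_group S x\<^esub> = path_class S (\<lambda>_. x)"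
  by (simp add: fundamental_group_def)

lemma group_fundamental_group:
  assumes "x \<in> S"
  shows "group (fundamental_group S x)"
proof (rule groupI)
  let ?P = "fundamental_group S x"
  note simps = carrier_fundamental_group one_fundamental_group
  show "A \<otimes>\<^bsub>?P\<^esub> B \<in> carrier ?P" if "A \<in> carrier ?P" "B \<in> carrier ?P" for A B
    using that by (auto simp: simps mult_path_class intro: is_loop_join)
  show "\<one>\<^bsub>?P\<^esub> \<in> carrier ?P"
    using is_loop_const[OF assms] by (auto simp: simps)
  show "A \<otimes>\<^bsub>?P\<^esub> B \<otimes>\<^bsub>?P\<^esub> C = A \<otimes>\<^bsub>?P\<^esub> (B \<otimes>\<^bsub>?P\<^esub> C)"
    if abc: "A \<in> carrier ?P" "B \<in> carrier ?P" "C \<in> carrier ?P" for A B C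
  proof -
    obtain f g h where "A = path_class S f" "B = path_class S g" "C = path_class S h"
      and l: "is_loop S x f" "is_loop S x g" "is_loop S x h"
      using abc by (auto simp: simps)
    moreover have "homotopic_paths S (f +++ (g +++ h)) ((f +++ g) +++ h)"
      using l by (intro homotopic_paths_assoc) (auto simp: is_loop_def)
    ultimately show ?thesis
      by (simp add: mult_path_class is_loop_join path_class_eqI)
  qed
  show "\<one>\<^bsub>?P\<^esub> \<otimes>\<^bsub>?P\<^esub> A = A" if "A \<in> carrier ?P" for A
    using that is_loop_const[OF assms] path_class_eqI[OF homotopic_paths_const_left]
    by (fastforce simp: simps mult_path_class)
  show "\<exists>B\<in>carrier ?P. B \<otimes>\<^bsub>?P\<^esub> A = \<one>\<^bsub>?P\<^esub>" if A: "A \<in> carrier ?P" for A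
  proof -
    obtain g where g: "A = path_class S g" "is_loop S x g"
      using A by (auto simp: simps)
    then have "path_class S (reversepath g) \<otimes>\<^bsub>?P\<^esub> A = \<one>\<^bsub>?P\<^esub>"
      by (simp add: simps mult_path_class is_loop_reversepath path_class_eqI
          homotopic_paths_reversepath_left)
    then show ?thesis
      using g by (auto simp: simps intro: is_loop_reversepath)
  qed
qed

definition GL2 :: "(complex^2^2) monoid" where
  "GL2 = \<lparr>carrier = {A. invertible A}, mult = (**), one = mat 1\<rparr>"

lemma group_GL2: "group GL2"
proof (rule groupI)
  show "\<exists>B\<in>carrier GL2. B \<otimes>\<^bsub>GL2\<^esub> A = \<one>\<^bsub>GL2\<^esub>" if "A \<in> carrier GL2" for A
    using that unfolding GL2_def invertible_def by auto
  show "\<one>\<^bsub>GL2\<^esub> \<in> carrier GL2"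
    unfolding GL2_def invertible_def by (auto intro: exI[of _ "mat 1"])
qed (auto simp: GL2_def invertible_mult matrix_mul_assoc)

section \<open>Generators of the fundamental group of the punctured sphere\<close>

text \<open>A loop around \<open>p\<close>: up to homotopy it runs from the base point \<open>x\<close> along a path \<open>d\<close> to a
  point near \<open>p\<close>, once along a small circle that is positively oriented in the local coordinate at
  \<open>p\<close>, and back along \<open>d\<close>.\<close>

definition loop_around :: "cp1 set \<Rightarrow> cp1 \<Rightarrow> cp1 \<Rightarrow> (real \<Rightarrow> cp1) \<Rightarrow> bool" where
  "loop_around D x p g \<longleftrightarrow>
     (\<exists>d r. 0 < r \<and> chart p ` (cball 0 r - {0}) \<inter> D = {} \<and>
        path d \<and> path_image d \<subseteq> - D \<and> pathstart d = x \<and> pathfinish d = chart p (of_real r) \<and>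
        homotopic_paths (- D) g (d +++ (chart p \<circ> circlepath 0 r) +++ reversepath d))"

definition standard_loops :: "(3 \<Rightarrow> cp1) \<Rightarrow> cp1 \<Rightarrow> (3 \<Rightarrow> real \<Rightarrow> cp1) \<Rightarrow> bool" where
  "standard_loops a x \<gamma> \<longleftrightarrow>
     (let S = - range a; P = fundamental_group S x; c = (\<lambda>i. path_class S (\<gamma> i)) in
        (\<forall>i. loop_around (range a) x (a i) (\<gamma> i)) \<and>
        c 1 \<otimes>\<^bsub>P\<^esub> c 2 \<otimes>\<^bsub>P\<^esub> c 3 = \<one>\<^bsub>P\<^esub> \<and>
        generate P (range c) = carrier P)"

section \<open>Riemann equations\<close>

text \<open>The coefficients of the equation \<open>y'' + b1 y' + b2 y = 0\<close> rewritten in the local coordinate at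
  a point. At infinity \<open>dy/dz = - t\<^sup>2 dy/dt\<close> and
  \<open>d\<^sup>2y/dz\<^sup>2 = t\<^sup>4 d\<^sup>2y/dt\<^sup>2 + 2 t\<^sup>3 dy/dt\<close> where \<open>t = 1 / z\<close>.\<close>

fun coeff1 :: "(complex \<Rightarrow> complex) \<Rightarrow> cp1 \<Rightarrow> complex \<Rightarrow> complex" where
  "coeff1 b1 (Fin c) t = b1 (c + t)"
| "coeff1 b1 Infty t = 2 / t - b1 (1 / t) / t ^ 2"

fun coeff2 :: "(complex \<Rightarrow> complex) \<Rightarrow> cp1 \<Rightarrow> complex \<Rightarrow> complex" where
  "coeff2 b2 (Fin c) t = b2 (c + t)"
| "coeff2 b2 Infty t = b2 (1 / t) / t ^ 4"

text \<open>For \<open>k = 0\<close> this says that \<open>f\<close> extends holomorphically to the origin.\<close>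

definition pole_order_at_most :: "nat \<Rightarrow> (complex \<Rightarrow> complex) \<Rightarrow> bool" where
  "pole_order_at_most k f \<longleftrightarrow>
     (\<exists>g. g analytic_on {0} \<and> (\<forall>\<^sub>F t in at 0. f t = g t / t ^ k))"

definition riemann_equation ::
  "cp1 set \<Rightarrow> (complex \<Rightarrow> complex) \<Rightarrow> (complex \<Rightarrow> complex) \<Rightarrow> bool" where
  "riemann_equation D b1 b2 \<longleftrightarrow>
     b1 holomorphic_on {z. Fin z \<notin> D} \<and> b2 holomorphic_on {z. Fin z \<notin> D} \<and>
     (Infty \<notin> D \<longrightarrow> pole_order_at_most 0 (coeff1 b1 Infty) \<and> pole_order_at_most 0 (coeff2 b2 Infty)) \<and>
     (\<forall>p\<in>D. pole_order_at_most 1 (coeff1 b1 p) \<and> pole_order_at_most 2 (coeff2 b2 p))"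

section \<open>Monodromy\<close>

definition analytic_at_cp1 :: "(cp1 \<Rightarrow> complex) \<Rightarrow> cp1 \<Rightarrow> bool" where
  "analytic_at_cp1 f p \<longleftrightarrow> (f \<circ> chart p) analytic_on {0}"

text \<open>Here \<open>p\<close> is meant to be an ordinary point. The centre \<open>t = 0\<close> is left out because
  at infinity the value of a coefficient there is not the one of its holomorphic extension;
  the equation at \<open>t = 0\<close> follows by continuity.\<close>

definition solution_near ::
  "(complex \<Rightarrow> complex) \<Rightarrow> (complex \<Rightarrow> complex) \<Rightarrow> cp1 \<Rightarrow> (cp1 \<Rightarrow> complex) \<Rightarrow> bool" where
  "solution_near b1 b2 p y \<longleftrightarrow>
     analytic_at_cp1 y p \<and>
     (let u = y \<circ> chart p in
        \<forall>\<^sub>F t in at 0. deriv (deriv u) t + coeff1 b1 p t * deriv u t + coeff2 b2 p t * u t = 0)"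

text \<open>Bases of the space of germs of solutions at \<open>p\<close>, as row vectors of functions.\<close>

definition solution_basis ::
  "(complex \<Rightarrow> complex) \<Rightarrow> (complex \<Rightarrow> complex) \<Rightarrow> cp1 \<Rightarrow> (cp1 \<Rightarrow> complex^2) \<Rightarrow> bool" where
  "solution_basis b1 b2 p Y \<longleftrightarrow>
     (\<forall>j. solution_near b1 b2 p (\<lambda>q. Y q $ j)) \<and>
     (\<forall>c :: complex^2. (\<forall>\<^sub>F q in nhds p. (\<Sum>j\<in>UNIV. c $ j * Y q $ j) = 0) \<longrightarrow> c = 0) \<and>
     (\<forall>y. solution_near b1 b2 p y \<longrightarrow>
        (\<exists>c :: complex^2. \<forall>\<^sub>F q in nhds p. y q = (\<Sum>j\<in>UNIV. c $ j * Y q $ j)))"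

text \<open>Analytic continuation along \<open>\<gamma>\<close>: a family \<open>F\<close> of germs at the points \<open>\<gamma> s\<close> that is
  locally induced by a single function.\<close>

definition continuation_along ::
  "(real \<Rightarrow> cp1) \<Rightarrow> (cp1 \<Rightarrow> complex^2) \<Rightarrow> (cp1 \<Rightarrow> complex^2) \<Rightarrow> bool" where
  "continuation_along \<gamma> Y Y' \<longleftrightarrow>
     (\<exists>F :: real \<Rightarrow> cp1 \<Rightarrow> complex^2.
        (\<forall>s\<in>{0..1}. (\<forall>j. analytic_at_cp1 (\<lambda>q. F s q $ j) (\<gamma> s)) \<and>
           (\<forall>\<^sub>F u in at s within {0..1}. \<forall>\<^sub>F q in nhds (\<gamma> u). F u q = F s q)) \<and>
        (\<forall>\<^sub>F q in nhds (\<gamma> 0). F 0 q = Y q) \<and>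
        (\<forall>\<^sub>F q in nhds (\<gamma> 1). F 1 q = Y' q))"

definition realizes ::
  "cp1 set \<Rightarrow> cp1 \<Rightarrow> (complex \<Rightarrow> complex) \<Rightarrow> (complex \<Rightarrow> complex) \<Rightarrow>
   ((real \<Rightarrow> cp1) set \<Rightarrow> complex^2^2) \<Rightarrow> bool" where
  "realizes D x b1 b2 \<rho> \<longleftrightarrow>
     (\<exists>Y. solution_basis b1 b2 x Y \<and>
        (\<forall>\<gamma>. is_loop (- D) x \<gamma> \<longrightarrow>
           (\<exists>Y'. continuation_along \<gamma> Y Y' \<and>
              (\<forall>\<^sub>F q in nhds x. Y q = Y' q v* \<rho> (path_class (- D) \<gamma>)))))"

definition diag2 :: "complex \<Rightarrow> complex \<Rightarrow> complex^2^2" where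
  "diag2 \<alpha> \<beta> = vector [vector [\<alpha>, 0], vector [0, \<beta>]]"

definition scalar_matrix :: "complex^2^2 \<Rightarrow> bool" where
  "scalar_matrix A \<longleftrightarrow> (\<exists>c. A = mat c)"

end

theory Submission
  imports Defs
begin

text \<open>
  Suppose that an equation has diagonal monodromy in a basis of solutions \<open>y1, y2\<close> with Wronskian
  \<open>W\<close>. Then \<open>A = y1 y2 / W\<close> is single valued, and \<open>A d/dz\<close> is a holomorphic vector field on the
  sphere minus the singular points, because \<open>W\<close> has no zeros there. Together with \<open>(y1 y2)' / W\<close> and
  \<open>y1' y2' / W\<close> it solves a Fuchsian linear system, so it has moderate growth and is meromorphic at
  the singular points. Since \<open>(log (y2 / y1))' = 1 / A\<close>, at a singular point where the field does not
  vanish \<open>1 / A\<close> is holomorphic, and \<open>y2 / y1\<close> is single valued near that point: the local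
  monodromy is scalar. A holomorphic vector field on the sphere with three zeros vanishes identically,
  hence some local monodromy is scalar.

  Conversely, if the monodromy at the third point is scalar, powers of ratios of linear forms
  \<open>y1 = (e1 / e3) powr l * (e2 / e3) powr m\<close> and \<open>y2 = y1 * (e1 / e2) powr \<nu>\<close> with \<open>\<nu> \<noteq> 0\<close> are solutions of a
  Riemann equation, and their monodromy is computed by winding numbers.
\<close>

no_notation fps_nth (infixl "$" 75)

section \<open>Coordinates on the Riemann sphere\<close>

fun affine_coord :: "cp1 \<Rightarrow> complex \<Rightarrow> complex" where
  "affine_coord (Fin c) t = c + t"
| "affine_coord Infty t = 1 / t"

fun local_coord :: "cp1 \<Rightarrow> complex \<Rightarrow> complex" where
  "local_coord (Fin c) w = w - c"
| "local_coord Infty w = 1 / w"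

lemma chart_0 [simp]: "chart p 0 = p"
  by (cases p) auto

lemma chart_Fin_0: "chart (Fin 0) = Fin"
  by (simp add: fun_eq_iff)

lemma chart_eq_Fin: "t \<noteq> 0 \<Longrightarrow> chart p t = Fin (affine_coord p t)"
  by (cases p) auto

lemma local_coord_affine_coord: "t \<noteq> 0 \<Longrightarrow> local_coord p (affine_coord p t) = t"
  by (cases p) auto

lemma inj_chart: "inj (chart p)"
  by (cases p) (auto simp: inj_def split: if_splits)

lemma analytic_on_affine_coord:
  assumes "t \<noteq> 0"
  shows "affine_coord p analytic_on {t}"
proof (cases p)
  case (Fin c)
  then have "affine_coord p = (\<lambda>t. c + t)" by (simp add: fun_eq_iff)
  then show ?thesis by (simp add: analytic_intros)
next
  case Infty
  then have "affine_coord p = (\<lambda>t. 1 / t)" by (simp add: fun_eq_iff)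
  moreover have "(\<lambda>t. 1 / t) analytic_on {t}" by (intro analytic_intros) (use assms in auto)
  ultimately show ?thesis by simp
qed

lemma chart_transition:
  assumes "chart p t = chart q s"
  obtains h where "h analytic_on {s}" "h s = t" "\<forall>\<^sub>F r in nhds s. chart q r = chart p (h r)"
proof (cases p; cases q)
  fix c d assume pq: "p = Fin c" "q = Fin d"
  show ?thesis
    by (rule that[of "\<lambda>r. d + r - c"])
      (use assms pq in \<open>auto intro!: analytic_intros simp: diff_eq_eq add.commute\<close>)
next
  fix c assume pq: "p = Fin c" "q = Infty"
  then have "s \<noteq> 0" using assms by auto
  show ?thesis
  proof (rule that[of "\<lambda>r. 1 / r - c"])
    show "\<forall>\<^sub>F r in nhds s. chart q r = chart p (1 / r - c)"
      using t1_space_nhds[OF \<open>s \<noteq> 0\<close>] by eventually_elim (simp add: pq)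
  qed (use assms pq \<open>s \<noteq> 0\<close> in \<open>auto intro!: analytic_intros simp: diff_eq_eq add.commute\<close>)
next
  fix d assume pq: "p = Infty" "q = Fin d"
  then have t: "t \<noteq> 0" "d + s = 1 / t" using assms by (auto split: if_splits)
  then have "s \<noteq> - d" by (auto simp: add_eq_0_iff)
  show ?thesis
  proof (rule that[of "\<lambda>r. 1 / (d + r)"])
    show "\<forall>\<^sub>F r in nhds s. chart q r = chart p (1 / (d + r))"
      using t1_space_nhds[OF \<open>s \<noteq> - d\<close>] by eventually_elim (auto simp: pq add_eq_0_iff)
    show "(\<lambda>r. 1 / (d + r)) analytic_on {s}"
      using \<open>s \<noteq> - d\<close> by (intro analytic_intros) (simp add: add_eq_0_iff)
  qed (simp add: t)
next
  assume pq: "p = Infty" "q = Infty"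
  then have "s = t" using injD[OF inj_chart, of Infty t s] assms by simp
  then show ?thesis by (intro that[of "\<lambda>r. r"]) (simp_all add: pq)
qed

lemma open_chart_vimage: "open U \<Longrightarrow> open (chart p -` U)"
proof (cases p)
  case (Fin c)
  assume "open U"
  then have "open (Fin -` U)" by (simp add: open_cp1_def)
  then have "open ((+) c -` (Fin -` U))" by (rule open_vimage) (intro continuous_intros)
  then show ?thesis using Fin by (simp add: vimage_def)
qed (simp add: open_cp1_def)

lemma open_chart_image:
  assumes "open S"
  shows "open (chart p ` S)"
proof -
  have "open (chart q -` (chart p ` S))" for q
    unfolding open_subopen[of "chart q -` (chart p ` S)"]
  proof
    fix s assume "s \<in> chart q -` (chart p ` S)"
    then obtain t where t: "t \<in> S" "chart p t = chart q s" by force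
    obtain h where h: "h analytic_on {s}" "h s = t" "\<forall>\<^sub>F r in nhds s. chart q r = chart p (h r)"
      using chart_transition[OF t(2)] .
    have "(h \<longlongrightarrow> h s) (nhds s)"
      using analytic_at_imp_isCont[OF h(1)] by (simp add: isCont_def tendsto_at_iff_tendsto_nhds)
    then have "\<forall>\<^sub>F r in nhds s. h r \<in> S"
      using assms t(1) h(2) by (intro topological_tendstoD) auto
    with h(3) have "\<forall>\<^sub>F r in nhds s. chart q r \<in> chart p ` S" by eventually_elim simp
    then show "\<exists>T. open T \<and> s \<in> T \<and> T \<subseteq> chart q -` (chart p ` S)"
      unfolding eventually_nhds by blast
  qed
  from this[of "Fin 0"] this[of Infty] show ?thesis
    by (simp only: open_cp1_def chart_Fin_0)
qed

lemma continuous_on_chart: "continuous_on A (chart p)"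
  by (rule continuous_on_subset[of UNIV]) (auto simp: continuous_on_open_vimage open_chart_vimage)

lemma path_chart_compose: "path g \<Longrightarrow> path (chart p \<circ> g)"
  by (intro path_continuous_image continuous_on_chart)

lemma nhds_chart: "nhds (chart p t) = filtermap (chart p) (nhds t)"
proof (rule antisym)
  have "(chart p \<longlongrightarrow> chart p t) (nhds t)"
    using continuous_on_chart[of UNIV p] by (simp add: continuous_on_def tendsto_at_iff_tendsto_nhds)
  then show "filtermap (chart p) (nhds t) \<le> nhds (chart p t)" by (simp add: filterlim_def)
  show "nhds (chart p t) \<le> filtermap (chart p) (nhds t)"
  proof (rule filter_leI)
    fix Q assume "eventually Q (filtermap (chart p) (nhds t))"
    then obtain V where "open V" "t \<in> V" "\<forall>s\<in>V. Q (chart p s)"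
      unfolding eventually_filtermap eventually_nhds by blast
    then show "eventually Q (nhds (chart p t))"
      unfolding eventually_nhds by (intro exI[of _ "chart p ` V"]) (auto simp: open_chart_image)
  qed
qed

lemma nhds_cp1: "nhds p = filtermap (chart p) (nhds 0)"
  using nhds_chart[of p 0] by simp

lemma nhds_Fin: "nhds (Fin z) = filtermap Fin (nhds z)"
  using nhds_chart[of "Fin 0" z] by (simp add: chart_Fin_0)

lemma eventually_nhds_chart_ball:
  assumes "e > 0" "\<And>t. t \<in> ball 0 e \<Longrightarrow> Q (chart p t)"
  shows "\<forall>\<^sub>F q in nhds p. Q q"
  unfolding nhds_cp1 eventually_filtermap
  by (rule eventually_mono[OF eventually_nhds_in_open[of "ball 0 e"]]) (use assms in auto)

instance cp1 :: t1_space
proof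
  fix p q :: cp1 assume "p \<noteq> q"
  have "open (chart r -` (- {q}))" for r
    using finite_vimageI[of "{q}" "chart r"] inj_chart
    by (auto simp: vimage_Compl intro: finite_imp_closed)
  from this[of "Fin 0"] this[of Infty] have "open (- {q})"
    by (simp only: open_cp1_def chart_Fin_0)
  then show "\<exists>U. open U \<and> p \<in> U \<and> q \<notin> U" using \<open>p \<noteq> q\<close> by blast
qed

lemma open_vimage_Fin: "open U \<Longrightarrow> open (Fin -` U)"
  using open_chart_vimage[of U "Fin 0"] by (simp add: chart_Fin_0)

lemma finite_vimage_Fin: "finite D \<Longrightarrow> finite (Fin -` D)"
  by (intro finite_vimageI) (auto simp: inj_def)

lemma open_affine_part: "finite D \<Longrightarrow> open {w. Fin w \<notin> D}"
  using open_vimage_Fin[of "- D"] by (simp add: finite_imp_closed open_Compl vimage_def)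

lemma punctured_chart_ball:
  assumes "finite D"
  obtains e where "e > 0" "\<And>t. t \<in> ball 0 e - {0} \<Longrightarrow> chart p t \<notin> D"
proof -
  have "open (chart p -` (- (D - {p})))"
    using assms by (intro open_chart_vimage open_Compl finite_imp_closed) auto
  then obtain e where e: "e > 0" "ball 0 e \<subseteq> chart p -` (- (D - {p}))"
    using open_contains_ball[of "chart p -` (- (D - {p}))"] by force
  show ?thesis
  proof (rule that[OF e(1)])
    fix t :: complex assume t: "t \<in> ball 0 e - {0}"
    then have "chart p t \<noteq> p" using injD[OF inj_chart, of p t 0] by auto
    then show "chart p t \<notin> D" using t e(2) by auto
  qed
qed

lemma chart_ball:
  assumes "finite D" "p \<notin> D"
  obtains e where "e > 0" "\<And>t. t \<in> ball 0 e \<Longrightarrow> chart p t \<notin> D"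
proof -
  obtain e where e: "e > 0" "\<And>t. t \<in> ball 0 e - {0} \<Longrightarrow> chart p t \<notin> D"
    using punctured_chart_ball[OF assms(1), of p] by blast
  have "chart p t \<notin> D" if "t \<in> ball 0 e" for t
    using e(2)[of t] that assms(2) by (cases "t = 0") auto
  then show ?thesis using that e(1) by blast
qed

lemma path_to_affine_part:
  assumes "finite D" "p \<notin> D"
  obtains z g where "Fin z \<notin> D" "path g" "path_image g \<subseteq> - D" "pathstart g = p" "pathfinish g = Fin z"
proof -
  obtain e where e: "e > 0" "\<And>t. t \<in> ball 0 e \<Longrightarrow> chart p t \<notin> D"
    using chart_ball[OF assms] by blast
  define t :: complex where "t = of_real (e / 2)"
  have t: "t \<noteq> 0" "t \<in> ball 0 e" using e(1) by (auto simp: t_def)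
  have "closed_segment 0 t \<subseteq> ball 0 e" using t e(1) by (intro closed_segment_subset) auto
  then have "path_image (chart p \<circ> linepath 0 t) \<subseteq> - D"
    using e(2) by (auto simp: path_image_compose)
  then show ?thesis
    using that[of "affine_coord p t" "chart p \<circ> linepath 0 t"] e(2)[OF t(2)] chart_eq_Fin[OF t(1), of p]
    by (simp add: path_chart_compose pathstart_compose pathfinish_compose)
qed

lemma path_connected_complement_finite_cp1:
  assumes "finite D"
  shows "path_connected (- D :: cp1 set)"
  unfolding path_connected_def
proof (intro ballI)
  fix p q assume "p \<in> - D" "q \<in> - D"
  then have pq: "p \<notin> D" "q \<notin> D" by auto
  obtain v g where g: "Fin v \<notin> D" "path g" "path_image g \<subseteq> - D" "pathstart g = p" "pathfinish g = Fin v"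
    using path_to_affine_part[OF assms pq(1)] .
  obtain w h where h: "Fin w \<notin> D" "path h" "path_image h \<subseteq> - D" "pathstart h = q" "pathfinish h = Fin w"
    using path_to_affine_part[OF assms pq(2)] .
  have "path_connected (- (Fin -` D))"
    using finite_vimage_Fin[OF assms] by (intro path_connected_complement_countable) (auto simp: countable_finite)
  then obtain m where m: "path m" "path_image m \<subseteq> - (Fin -` D)" "pathstart m = v" "pathfinish m = w"
    unfolding path_connected_def using g(1) h(1) by (metis ComplI vimageD)
  have "path (Fin \<circ> m)" using path_chart_compose[OF m(1), of "Fin 0"] by (simp add: chart_Fin_0)
  then have "path (g +++ (Fin \<circ> m) +++ reversepath h)"
    using g h m by (simp add: pathstart_compose pathfinish_compose)
  moreover have "path_image (g +++ (Fin \<circ> m) +++ reversepath h) \<subseteq> - D"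
    using g h m by (intro subset_path_image_join) (auto simp: path_image_compose)
  ultimately show "\<exists>k. path k \<and> path_image k \<subseteq> - D \<and> pathstart k = p \<and> pathfinish k = q"
    using g h by (intro exI[of _ "g +++ (Fin \<circ> m) +++ reversepath h"]) auto
qed

section \<open>Germs of analytic functions on the sphere\<close>

lemma analytic_at_chart: "analytic_at_cp1 f (chart p t) \<longleftrightarrow> (f \<circ> chart p) analytic_on {t}"
proof -
  have transfer: "(f \<circ> chart q) analytic_on {s}"
    if analytic: "(f \<circ> chart p) analytic_on {t}" and eq: "chart p t = chart q s" for p q t s
  proof -
    obtain h where h: "h analytic_on {s}" "h s = t" "\<forall>\<^sub>F r in nhds s. chart q r = chart p (h r)"
      using chart_transition[OF eq] .
    have "(f \<circ> chart p \<circ> h) analytic_on {s}"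
      by (rule analytic_on_compose) (use h analytic in simp_all)
    moreover have "\<forall>\<^sub>F r in nhds s. (f \<circ> chart q) r = (f \<circ> chart p \<circ> h) r"
      using h(3) by eventually_elim simp
    ultimately show ?thesis using analytic_at_cong by blast
  qed
  show ?thesis
    unfolding analytic_at_cp1_def
    using transfer[of "chart p t" 0 p t] transfer[of p t "chart p t" 0] by auto
qed

lemma analytic_at_Fin: "analytic_at_cp1 f (Fin z) \<longleftrightarrow> (\<lambda>w. f (Fin w)) analytic_on {z}"
  using analytic_at_chart[of f "Fin 0" z] by (simp add: o_def)

lemma analytic_at_cp1_cong:
  assumes "\<forall>\<^sub>F q in nhds p. f q = g q"
  shows "analytic_at_cp1 f p = analytic_at_cp1 g p"
  unfolding analytic_at_cp1_def using assms
  by (intro analytic_at_cong) (auto simp: nhds_cp1 eventually_filtermap)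

lemma analytic_at_cp1_add:
  "analytic_at_cp1 f p \<Longrightarrow> analytic_at_cp1 g p \<Longrightarrow> analytic_at_cp1 (\<lambda>q. f q + g q) p"
  unfolding analytic_at_cp1_def o_def by (rule analytic_on_add)

lemma analytic_at_cp1_diff:
  "analytic_at_cp1 f p \<Longrightarrow> analytic_at_cp1 g p \<Longrightarrow> analytic_at_cp1 (\<lambda>q. f q - g q) p"
  unfolding analytic_at_cp1_def o_def by (rule analytic_on_diff)

lemma analytic_at_cp1_mult:
  "analytic_at_cp1 f p \<Longrightarrow> analytic_at_cp1 g p \<Longrightarrow> analytic_at_cp1 (\<lambda>q. f q * g q) p"
  unfolding analytic_at_cp1_def o_def by (rule analytic_on_mult)

lemma analytic_at_cp1_const: "analytic_at_cp1 (\<lambda>q. c) p"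
  unfolding analytic_at_cp1_def o_def by simp

lemmas analytic_at_cp1_intros =
  analytic_at_cp1_add analytic_at_cp1_diff analytic_at_cp1_mult analytic_at_cp1_const

lemma analytic_at_cp1_tendsto:
  assumes "analytic_at_cp1 f p"
  shows "(f \<longlongrightarrow> f p) (nhds p)"
proof -
  have "isCont (f \<circ> chart p) 0"
    using assms unfolding analytic_at_cp1_def by (rule analytic_at_imp_isCont)
  then have "((\<lambda>t. f (chart p t)) \<longlongrightarrow> f p) (nhds 0)"
    using tendsto_at_iff_tendsto_nhds[of "f \<circ> chart p" 0] by (simp add: isCont_def o_def)
  then show ?thesis unfolding nhds_cp1 filterlim_filtermap .
qed

lemma analytic_at_cp1_ball:
  assumes "\<And>j::'n::finite. analytic_at_cp1 (f j) p"
  obtains e where "e > 0" "\<And>j. (f j \<circ> chart p) holomorphic_on ball 0 e"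
proof -
  have "\<forall>j. \<exists>e>0. (f j \<circ> chart p) holomorphic_on ball 0 e"
    using assms unfolding analytic_at_cp1_def analytic_at_ball by blast
  then obtain e where e: "\<And>j. e j > 0" "\<And>j. (f j \<circ> chart p) holomorphic_on ball 0 (e j)"
    by metis
  show ?thesis
  proof (rule that[of "Min (range e)"])
    show "(f j \<circ> chart p) holomorphic_on ball 0 (Min (range e))" for j
      using e(2) by (rule holomorphic_on_subset) (auto intro: less_le_trans)
  qed (use e(1) in auto)
qed

lemma eventually_analytic_at_cp1:
  assumes "analytic_at_cp1 f p"
  shows "\<forall>\<^sub>F q in nhds p. analytic_at_cp1 f q"
proof -
  obtain e where e: "e > 0" "(f \<circ> chart p) holomorphic_on ball 0 e"
    using assms unfolding analytic_at_cp1_def analytic_at_ball by blast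
  then have "(f \<circ> chart p) analytic_on ball 0 e" by (simp add: analytic_on_open)
  then show ?thesis
    by (intro eventually_nhds_chart_ball[OF e(1)]) (auto simp: analytic_at_chart intro: analytic_on_subset)
qed

lemma identity_theorem_at:
  assumes "f holomorphic_on S" "open S" "connected S" "t islimpt S" "\<forall>\<^sub>F s in at t. f s = 0" "z \<in> S"
  shows "f z = 0"
proof -
  obtain V where V: "open V" "t \<in> V" "\<And>s. s \<in> V \<Longrightarrow> s \<noteq> t \<Longrightarrow> f s = 0"
    using assms(5) unfolding eventually_at_topological by blast
  let ?U = "V \<inter> S - {t}"
  have "open ?U" "?U \<noteq> {}" "?U \<subseteq> S"
    using V(1) assms(2) islimptE[OF assms(4) V(2,1)] by blast+
  moreover have "f s = 0" if "s \<in> ?U" for s using V(3) that by blast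
  ultimately show ?thesis
    using analytic_continuation_open[of ?U S f "\<lambda>_. 0"] assms(1-3,6) by simp
qed

lemma vanishing_near_chart_iff:
  assumes "(f \<circ> chart p) holomorphic_on ball 0 e" "t \<in> ball 0 e"
  shows "(\<forall>\<^sub>F q in nhds (chart p t). f q = 0) \<longleftrightarrow> (\<forall>s\<in>ball 0 e. f (chart p s) = 0)"
proof
  assume "\<forall>\<^sub>F q in nhds (chart p t). f q = 0"
  then have "\<forall>\<^sub>F s in at t. (f \<circ> chart p) s = 0"
    unfolding nhds_chart eventually_filtermap by (simp add: eventually_at_filter eventually_mono)
  moreover have "t islimpt ball 0 e" using assms(2) by (simp add: open_imp_islimpt)
  ultimately show "\<forall>s\<in>ball 0 e. f (chart p s) = 0"
    using identity_theorem_at[OF assms(1) open_ball connected_ball] by simp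
next
  assume "\<forall>s\<in>ball 0 e. f (chart p s) = 0"
  then show "\<forall>\<^sub>F q in nhds (chart p t). f q = 0"
    unfolding nhds_chart eventually_filtermap
    using assms(2) by (intro eventually_mono[OF eventually_nhds_in_open[of "ball 0 e"]]) auto
qed

lemma vanishing_near_transfer:
  assumes "(f \<circ> chart p) holomorphic_on ball 0 e" "t \<in> ball 0 e"
  shows "(\<forall>\<^sub>F q in nhds (chart p t). f q = 0) \<longleftrightarrow> (\<forall>\<^sub>F q in nhds p. f q = 0)"
proof -
  have "0 < e" using assms(2) norm_ge_zero[of t] by (simp del: norm_ge_zero)
  then show ?thesis
    using vanishing_near_chart_iff[OF assms] vanishing_near_chart_iff[OF assms(1), of 0] by simp
qed

lemma eventually_vanishing_iff:
  assumes "analytic_at_cp1 f p"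
  shows "\<forall>\<^sub>F q in nhds p. (\<forall>\<^sub>F r in nhds q. f r = 0) = (\<forall>\<^sub>F r in nhds p. f r = 0)"
proof -
  obtain e where e: "e > 0" "(f \<circ> chart p) holomorphic_on ball 0 e"
    using assms unfolding analytic_at_cp1_def analytic_at_ball by blast
  show ?thesis
    by (rule eventually_nhds_chart_ball[OF e(1)]) (rule vanishing_near_transfer[OF e(2)])
qed

section \<open>Analytic continuation along paths\<close>

lemma vector_matrix_mult_2:
  "((y::complex^2) v* M) $ j = M $ 1 $ j * y $ 1 + M $ 2 $ j * y $ 2"
  by (simp add: vector_matrix_mult_def sum_2)

definition germ_family :: "(real \<Rightarrow> cp1) \<Rightarrow> (real \<Rightarrow> cp1 \<Rightarrow> complex^2) \<Rightarrow> bool" where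
  "germ_family \<gamma> F \<longleftrightarrow>
     (\<forall>s\<in>{0..1}. (\<forall>j. analytic_at_cp1 (\<lambda>q. F s q $ j) (\<gamma> s)) \<and>
        (\<forall>\<^sub>F u in at s within {0..1}. \<forall>\<^sub>F q in nhds (\<gamma> u). F u q = F s q))"

lemma germ_familyD:
  assumes "germ_family \<gamma> F" "s \<in> {0..1}"
  shows "analytic_at_cp1 (\<lambda>q. F s q $ j) (\<gamma> s)"
    and "\<forall>\<^sub>F u in at s within {0..1}. \<forall>\<^sub>F q in nhds (\<gamma> u). F u q = F s q"
  using assms by (auto simp: germ_family_def)

lemma continuation_along_iff:
  "continuation_along \<gamma> f g \<longleftrightarrow>
     (\<exists>F. germ_family \<gamma> F \<and> (\<forall>\<^sub>F q in nhds (pathstart \<gamma>). F 0 q = f q) \<and>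
        (\<forall>\<^sub>F q in nhds (pathfinish \<gamma>). F 1 q = g q))"
  unfolding continuation_along_def germ_family_def pathstart_def pathfinish_def by simp

lemma eventually_path_at:
  assumes "path \<gamma>" "s \<in> {0..1}" "\<forall>\<^sub>F q in nhds (\<gamma> s). Q q"
  shows "\<forall>\<^sub>F u in at s within {0..1}. Q (\<gamma> u)"
proof -
  have "(\<gamma> \<longlongrightarrow> \<gamma> s) (at s within {0..1})"
    using assms by (simp add: path_def continuous_on_def)
  then show ?thesis using assms(3) by (simp add: filterlim_iff)
qed

lemma germ_family_compose:
  assumes F: "germ_family \<gamma> F" and \<phi>: "continuous_on {0..1} \<phi>" "\<phi> ` {0..1} \<subseteq> {0..1}"
    and \<delta>: "\<And>s. s \<in> {0..1} \<Longrightarrow> \<delta> s = \<gamma> (\<phi> s)"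
  shows "germ_family \<delta> (F \<circ> \<phi>)"
  unfolding germ_family_def
proof (intro ballI conjI allI)
  fix s :: real assume s: "s \<in> {0..1}"
  then have \<phi>s: "\<phi> s \<in> {0..1}" using \<phi>(2) by blast
  show "analytic_at_cp1 (\<lambda>q. (F \<circ> \<phi>) s q $ j) (\<delta> s)" for j
    using germ_familyD(1)[OF F \<phi>s] \<delta>[OF s] by simp
  obtain V where V: "open V" "\<phi> s \<in> V"
    "\<And>u. u \<in> V \<Longrightarrow> u \<noteq> \<phi> s \<Longrightarrow> u \<in> {0..1} \<Longrightarrow> \<forall>\<^sub>F q in nhds (\<gamma> u). F u q = F (\<phi> s) q"
    using germ_familyD(2)[OF F \<phi>s] unfolding eventually_at_topological by blast
  have "(\<phi> \<longlongrightarrow> \<phi> s) (at s within {0..1})"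
    using \<phi> s by (simp add: continuous_on_def)
  then have "\<forall>\<^sub>F u in at s within {0..1}. \<phi> u \<in> V"
    using V by (simp add: topological_tendstoD)
  moreover have "\<forall>\<^sub>F u in at s within {0..1}. u \<in> {0..1}"
    by (simp add: eventually_at_filter)
  ultimately show "\<forall>\<^sub>F u in at s within {0..1}. \<forall>\<^sub>F q in nhds (\<delta> u). (F \<circ> \<phi>) u q = (F \<circ> \<phi>) s q"
  proof eventually_elim
    case (elim u)
    then have "\<phi> u \<in> {0..1}" using \<phi>(2) by blast
    then show ?case using V(3)[of "\<phi> u"] elim \<delta> by (cases "\<phi> u = \<phi> s") auto
  qed
qed

lemma continuation_along_cong:
  assumes "continuation_along \<gamma> f g"
    and "\<forall>\<^sub>F q in nhds (pathstart \<gamma>). f q = f' q" "\<forall>\<^sub>F q in nhds (pathfinish \<gamma>). g q = g' q"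
  shows "continuation_along \<gamma> f' g'"
proof -
  obtain F where F: "germ_family \<gamma> F" "\<forall>\<^sub>F q in nhds (pathstart \<gamma>). F 0 q = f q"
    "\<forall>\<^sub>F q in nhds (pathfinish \<gamma>). F 1 q = g q"
    using assms(1) unfolding continuation_along_iff by blast
  have "\<forall>\<^sub>F q in nhds (pathstart \<gamma>). F 0 q = f' q" using F(2) assms(2) by eventually_elim simp
  moreover have "\<forall>\<^sub>F q in nhds (pathfinish \<gamma>). F 1 q = g' q" using F(3) assms(3) by eventually_elim simp
  ultimately show ?thesis unfolding continuation_along_iff using F(1) by blast
qed

lemma continuation_along_imp_analytic:
  assumes "continuation_along \<gamma> f g"
  shows "analytic_at_cp1 (\<lambda>q. g q $ j) (pathfinish \<gamma>)"
proof -
  obtain F where F: "germ_family \<gamma> F" "\<forall>\<^sub>F q in nhds (pathfinish \<gamma>). F 1 q = g q"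
    using assms unfolding continuation_along_iff by blast
  have "\<forall>\<^sub>F q in nhds (pathfinish \<gamma>). F 1 q $ j = g q $ j" using F(2) by eventually_elim simp
  from analytic_at_cp1_cong[OF this] show ?thesis
    using germ_familyD(1)[OF F(1), of 1] by (simp add: pathfinish_def)
qed

lemma continuation_along_const:
  assumes "\<And>q j. q \<in> path_image \<gamma> \<Longrightarrow> analytic_at_cp1 (\<lambda>q. f q $ j) q"
  shows "continuation_along \<gamma> f f"
  unfolding continuation_along_iff germ_family_def
  using assms by (intro exI[of _ "\<lambda>_. f"]) (auto simp: path_image_def)

lemma continuation_along_const_in_chart:
  assumes "\<And>j. ((\<lambda>q. f q $ j) \<circ> chart p) holomorphic_on S" "open S" "path_image g \<subseteq> chart p ` S"
  shows "continuation_along g f f"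
proof (rule continuation_along_const)
  fix q j assume "q \<in> path_image g"
  then obtain s where s: "s \<in> S" "q = chart p s" using assms(3) by blast
  have "((\<lambda>q. f q $ j) \<circ> chart p) analytic_on S" using assms(1,2) by (simp add: analytic_on_open)
  then show "analytic_at_cp1 (\<lambda>q. f q $ j) q"
    using s(1) unfolding s(2) analytic_at_chart by (auto intro: analytic_on_subset)
qed

lemma continuation_along_diff:
  assumes "continuation_along \<gamma> f g" "continuation_along \<gamma> f' g'"
  shows "continuation_along \<gamma> (\<lambda>q. f q - f' q) (\<lambda>q. g q - g' q)"
proof -
  obtain F where F: "germ_family \<gamma> F" "\<forall>\<^sub>F q in nhds (pathstart \<gamma>). F 0 q = f q"
    "\<forall>\<^sub>F q in nhds (pathfinish \<gamma>). F 1 q = g q"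
    using assms(1) unfolding continuation_along_iff by blast
  obtain G where G: "germ_family \<gamma> G" "\<forall>\<^sub>F q in nhds (pathstart \<gamma>). G 0 q = f' q"
    "\<forall>\<^sub>F q in nhds (pathfinish \<gamma>). G 1 q = g' q"
    using assms(2) unfolding continuation_along_iff by blast
  have "germ_family \<gamma> (\<lambda>s q. F s q - G s q)"
    unfolding germ_family_def
  proof (intro ballI conjI allI)
    fix s :: real assume s: "s \<in> {0..1}"
    show "analytic_at_cp1 (\<lambda>q. (F s q - G s q) $ j) (\<gamma> s)" for j
      using germ_familyD(1)[OF F(1) s] germ_familyD(1)[OF G(1) s] by (simp add: analytic_at_cp1_diff)
    show "\<forall>\<^sub>F u in at s within {0..1}. \<forall>\<^sub>F q in nhds (\<gamma> u). F u q - G u q = F s q - G s q"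
      using germ_familyD(2)[OF F(1) s] germ_familyD(2)[OF G(1) s]
    proof eventually_elim
      case (elim u) then show ?case by eventually_elim simp
    qed
  qed
  moreover have "\<forall>\<^sub>F q in nhds (pathstart \<gamma>). F 0 q - G 0 q = f q - f' q"
    using F(2) G(2) by eventually_elim simp
  moreover have "\<forall>\<^sub>F q in nhds (pathfinish \<gamma>). F 1 q - G 1 q = g q - g' q"
    using F(3) G(3) by eventually_elim simp
  ultimately show ?thesis unfolding continuation_along_iff by blast
qed

lemma continuation_along_matrix:
  assumes "continuation_along \<gamma> f g"
  shows "continuation_along \<gamma> (\<lambda>q. f q v* M) (\<lambda>q. g q v* M)"
proof -
  obtain F where F: "germ_family \<gamma> F" "\<forall>\<^sub>F q in nhds (pathstart \<gamma>). F 0 q = f q"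
    "\<forall>\<^sub>F q in nhds (pathfinish \<gamma>). F 1 q = g q"
    using assms unfolding continuation_along_iff by blast
  have "germ_family \<gamma> (\<lambda>s q. F s q v* M)"
    unfolding germ_family_def
  proof (intro ballI conjI allI)
    fix s :: real assume s: "s \<in> {0..1}"
    show "analytic_at_cp1 (\<lambda>q. (F s q v* M) $ j) (\<gamma> s)" for j
      unfolding vector_matrix_mult_2
      using germ_familyD(1)[OF F(1) s] by (intro analytic_at_cp1_intros) auto
    show "\<forall>\<^sub>F u in at s within {0..1}. \<forall>\<^sub>F q in nhds (\<gamma> u). F u q v* M = F s q v* M"
      using germ_familyD(2)[OF F(1) s] by (auto elim!: eventually_mono)
  qed
  moreover have "\<forall>\<^sub>F q in nhds (pathstart \<gamma>). F 0 q v* M = f q v* M"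
    using F(2) by eventually_elim simp
  moreover have "\<forall>\<^sub>F q in nhds (pathfinish \<gamma>). F 1 q v* M = g q v* M"
    using F(3) by eventually_elim simp
  ultimately show ?thesis unfolding continuation_along_iff by blast
qed

lemma continuation_along_reversepath:
  assumes "continuation_along \<gamma> f g"
  shows "continuation_along (reversepath \<gamma>) g f"
proof -
  obtain F where F: "germ_family \<gamma> F" "\<forall>\<^sub>F q in nhds (pathstart \<gamma>). F 0 q = f q"
    "\<forall>\<^sub>F q in nhds (pathfinish \<gamma>). F 1 q = g q"
    using assms unfolding continuation_along_iff by blast
  have "germ_family (reversepath \<gamma>) (F \<circ> (\<lambda>s. 1 - s))"
    by (rule germ_family_compose[OF F(1)]) (auto simp: reversepath_def intro!: continuous_intros)
  then show ?thesis
    unfolding continuation_along_iff using F(2,3) by (intro exI[of _ "F \<circ> (\<lambda>s. 1 - s)"]) simp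
qed

lemma continuation_along_join_split:
  assumes "continuation_along (\<gamma> +++ \<delta>) f h" and meet: "pathfinish \<gamma> = pathstart \<delta>"
  obtains g where "continuation_along \<gamma> f g" "continuation_along \<delta> g h"
proof -
  obtain F where F: "germ_family (\<gamma> +++ \<delta>) F" "\<forall>\<^sub>F q in nhds (pathstart \<gamma>). F 0 q = f q"
    "\<forall>\<^sub>F q in nhds (pathfinish \<delta>). F 1 q = h q"
    using assms unfolding continuation_along_iff by auto
  have "germ_family \<gamma> (F \<circ> (\<lambda>s. s / 2))"
    by (rule germ_family_compose[OF F(1)]) (auto simp: joinpaths_def intro!: continuous_intros)
  then have "continuation_along \<gamma> f (F (1 / 2))"
    unfolding continuation_along_iff using F(2) by (intro exI[of _ "F \<circ> (\<lambda>s. s / 2)"]) simp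
  moreover have "germ_family \<delta> (F \<circ> (\<lambda>s. (1 + s) / 2))"
  proof (rule germ_family_compose[OF F(1)])
    show "\<delta> s = (\<gamma> +++ \<delta>) ((1 + s) / 2)" if "s \<in> {0..1}" for s
      using that meet
      by (cases "s = 0") (auto simp: joinpaths_def pathstart_def pathfinish_def add_divide_distrib)
  qed (auto intro!: continuous_intros)
  then have "continuation_along \<delta> (F (1 / 2)) h"
    unfolding continuation_along_iff using F(3) by (intro exI[of _ "F \<circ> (\<lambda>s. (1 + s) / 2)"]) simp
  ultimately show ?thesis by (rule that)
qed

text \<open>A property of germs that depends on the germ only and is locally constant along germs of
  analytic functions is preserved by analytic continuation.\<close>

definition locally_constant_property :: "cp1 set \<Rightarrow> (cp1 \<Rightarrow> (cp1 \<Rightarrow> complex^2) \<Rightarrow> bool) \<Rightarrow> bool" where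
  "locally_constant_property S P \<longleftrightarrow>
     (\<forall>p f g. (\<forall>\<^sub>F q in nhds p. f q = g q) \<longrightarrow> P p f \<longrightarrow> P p g) \<and>
     (\<forall>p\<in>S. \<forall>f. (\<forall>j. analytic_at_cp1 (\<lambda>q. f q $ j) p) \<longrightarrow> (\<forall>\<^sub>F q in nhds p. P q f = P p f))"

lemma locally_constant_property_cong:
  assumes "locally_constant_property S P" "\<forall>\<^sub>F q in nhds p. f q = g q"
  shows "P p f \<longleftrightarrow> P p g"
proof -
  have "\<forall>\<^sub>F q in nhds p. g q = f q" using assms(2) by eventually_elim simp
  then show ?thesis using assms unfolding locally_constant_property_def by blast
qed

lemma continuation_along_preserves:
  assumes "continuation_along \<gamma> f g" "path \<gamma>" "path_image \<gamma> \<subseteq> S" "locally_constant_property S P"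
  shows "P (pathstart \<gamma>) f \<longleftrightarrow> P (pathfinish \<gamma>) g"
proof -
  obtain F where F: "germ_family \<gamma> F" "\<forall>\<^sub>F q in nhds (pathstart \<gamma>). F 0 q = f q"
    "\<forall>\<^sub>F q in nhds (pathfinish \<gamma>). F 1 q = g q"
    using assms(1) unfolding continuation_along_iff by blast
  note cong = locally_constant_property_cong[OF assms(4)]
  have "\<forall>\<^sub>F u in at s within {0..1}. P (\<gamma> s) (F s) = P (\<gamma> u) (F u)" if s: "s \<in> {0..1}" for s
  proof -
    have "\<gamma> s \<in> S" using assms(3) s by (auto simp: path_image_def)
    then have "\<forall>\<^sub>F q in nhds (\<gamma> s). P q (F s) = P (\<gamma> s) (F s)"
      using assms(4) germ_familyD(1)[OF F(1) s] unfolding locally_constant_property_def by blast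
    from eventually_path_at[OF assms(2) s this] germ_familyD(2)[OF F(1) s] show ?thesis
    proof eventually_elim
      case (elim u)
      then show ?case using cong[OF elim(2)] by simp
    qed
  qed
  then have "P (\<gamma> 0) (F 0) = P (\<gamma> 1) (F 1)"
    by (intro connected_local_const[of "{0..1::real}" 0 1 "\<lambda>s. P (\<gamma> s) (F s)"]) auto
  then show ?thesis
    using cong[OF F(2)] cong[OF F(3)] by (simp add: pathstart_def pathfinish_def)
qed

lemma locally_constant_property_vanishing:
  assumes "\<And>p f. p \<in> S \<Longrightarrow> (\<And>j. analytic_at_cp1 (\<lambda>q. f q $ j) p) \<Longrightarrow> analytic_at_cp1 (\<lambda>q. \<Phi> q (f q)) p"
  shows "locally_constant_property S (\<lambda>p f. \<forall>\<^sub>F q in nhds p. \<Phi> q (f q) = 0)"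
  unfolding locally_constant_property_def
proof (intro conjI allI ballI impI)
  show "\<forall>\<^sub>F q in nhds p. \<Phi> q (g q) = 0"
    if "\<forall>\<^sub>F q in nhds p. f q = g q" "\<forall>\<^sub>F q in nhds p. \<Phi> q (f q) = 0" for p f g
    using that by eventually_elim simp
  show "\<forall>\<^sub>F q in nhds p. (\<forall>\<^sub>F r in nhds q. \<Phi> r (f r) = 0) = (\<forall>\<^sub>F r in nhds p. \<Phi> r (f r) = 0)"
    if "p \<in> S" "\<forall>j. analytic_at_cp1 (\<lambda>q. f q $ j) p" for p f
    using assms that by (intro eventually_vanishing_iff) blast
qed

lemma continuation_along_unique:
  assumes "continuation_along \<gamma> f g" "continuation_along \<gamma> f g'" "path \<gamma>"
  shows "\<forall>\<^sub>F q in nhds (pathfinish \<gamma>). g q = g' q"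
proof -
  have "\<forall>\<^sub>F q in nhds (pathfinish \<gamma>). (g q - g' q) $ j = 0" for j
  proof -
    have "locally_constant_property UNIV (\<lambda>p (h :: cp1 \<Rightarrow> complex^2). \<forall>\<^sub>F q in nhds p. h q $ j = 0)"
      by (rule locally_constant_property_vanishing) simp
    from continuation_along_preserves[OF continuation_along_diff[OF assms(1,2)] assms(3) _ this]
    show ?thesis by simp
  qed
  then have "\<forall>\<^sub>F q in nhds (pathfinish \<gamma>). \<forall>j. (g q - g' q) $ j = 0" by (intro eventually_all_finite)
  then show ?thesis by eventually_elim (simp add: vec_eq_iff)
qed

definition independent_near :: "cp1 \<Rightarrow> (cp1 \<Rightarrow> complex^2) \<Rightarrow> bool" where
  "independent_near p f \<longleftrightarrow>
     (\<forall>c :: complex^2. (\<forall>\<^sub>F q in nhds p. (\<Sum>j\<in>UNIV. c $ j * f q $ j) = 0) \<longrightarrow> c = 0)"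

lemma independent_near_cong:
  assumes "\<forall>\<^sub>F q in nhds p. f q = g q"
  shows "independent_near p f \<longleftrightarrow> independent_near p g"
proof -
  have "(\<forall>\<^sub>F q in nhds p. (\<Sum>j\<in>UNIV. c $ j * f q $ j) = 0) =
      (\<forall>\<^sub>F q in nhds p. (\<Sum>j\<in>UNIV. c $ j * g q $ j) = 0)" for c :: "complex^2"
    using assms by (rule eventually_cong) simp
  then show ?thesis by (simp add: independent_near_def)
qed

lemma locally_constant_property_independent_near: "locally_constant_property S independent_near"
  unfolding locally_constant_property_def
proof (intro conjI allI ballI impI)
  show "independent_near p g" if "\<forall>\<^sub>F q in nhds p. f q = g q" "independent_near p f" for p f g
    using independent_near_cong[OF that(1)] that(2) by simp
  show "\<forall>\<^sub>F q in nhds p. independent_near q f = independent_near p f"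
    if f: "\<forall>j. analytic_at_cp1 (\<lambda>q. f q $ j) p" for p f
  proof -
    obtain e where e: "e > 0" "\<And>j. ((\<lambda>q. f q $ j) \<circ> chart p) holomorphic_on ball 0 e"
      using analytic_at_cp1_ball[of "\<lambda>j q. f q $ j" p] f by blast
    have "(\<forall>\<^sub>F r in nhds (chart p t). (\<Sum>j\<in>UNIV. c $ j * f r $ j) = 0) =
        (\<forall>\<^sub>F r in nhds p. (\<Sum>j\<in>UNIV. c $ j * f r $ j) = 0)" if "t \<in> ball 0 e" for t and c :: "complex^2"
      using e(2) that by (intro vanishing_near_transfer) (auto simp: o_def intro!: holomorphic_intros)
    then show ?thesis
      by (intro eventually_nhds_chart_ball[OF e(1)]) (simp add: independent_near_def)
  qed
qed

section \<open>Moderate growth and isolated singularities\<close>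

lemma gronwall_backward:
  fixes X :: "real \<Rightarrow> 'a::real_inner"
  assumes "\<tau> \<le> r"
    and X_deriv: "\<And>s. \<tau> \<le> s \<Longrightarrow> s \<le> r \<Longrightarrow> (X has_vector_derivative X' s) (at s)"
    and X'_bound: "\<And>s. \<tau> \<le> s \<Longrightarrow> s \<le> r \<Longrightarrow> norm (X' s) \<le> k s * norm (X s)"
    and \<Phi>: "\<And>s. \<tau> \<le> s \<Longrightarrow> s \<le> r \<Longrightarrow> (\<Phi> has_real_derivative k s) (at s)"
  shows "norm (X \<tau>) \<le> exp (\<Phi> r - \<Phi> \<tau>) * norm (X r)"
proof -
  let ?g = "\<lambda>s. (X s \<bullet> X s) * exp (2 * \<Phi> s)"
  have "?g \<tau> \<le> ?g r"
  proof (rule DERIV_nonneg_imp_nondecreasing[OF \<open>\<tau> \<le> r\<close>])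
    fix s assume s: "\<tau> \<le> s" "s \<le> r"
    have "((\<lambda>s. X s \<bullet> X s) has_vector_derivative (X s \<bullet> X' s + X' s \<bullet> X s)) (at s)"
      by (rule bounded_bilinear.has_vector_derivative[OF bounded_bilinear_inner X_deriv[OF s] X_deriv[OF s]])
    then have "((\<lambda>s. X s \<bullet> X s) has_real_derivative 2 * (X s \<bullet> X' s)) (at s)"
      by (simp add: has_real_derivative_iff_has_vector_derivative inner_commute)
    then have deriv: "(?g has_real_derivative
        2 * (X s \<bullet> X' s) * exp (2 * \<Phi> s) + exp (2 * \<Phi> s) * (2 * k s) * (X s \<bullet> X s)) (at s)"
      by (rule DERIV_mult) (auto intro!: derivative_eq_intros \<Phi>[OF s])
    have "- (X s \<bullet> X' s) \<le> norm (X s) * norm (X' s)"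
      using Cauchy_Schwarz_ineq2[of "X s" "X' s"] by linarith
    also have "\<dots> \<le> norm (X s) * (k s * norm (X s))"
      by (intro mult_left_mono X'_bound s) auto
    finally have "0 \<le> (X s \<bullet> X' s) + k s * (X s \<bullet> X s)"
      by (simp add: dot_square_norm power2_eq_square mult_ac)
    then have "0 \<le> 2 * exp (2 * \<Phi> s) * ((X s \<bullet> X' s) + k s * (X s \<bullet> X s))" by simp
    also have "\<dots> = 2 * (X s \<bullet> X' s) * exp (2 * \<Phi> s) + exp (2 * \<Phi> s) * (2 * k s) * (X s \<bullet> X s)"
      by (simp add: algebra_simps)
    finally show "\<exists>y. (?g has_real_derivative y) (at s) \<and> 0 \<le> y" using deriv by blast
  qed
  then have "(norm (X \<tau>) * exp (\<Phi> \<tau>))\<^sup>2 \<le> (norm (X r) * exp (\<Phi> r))\<^sup>2"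
    by (simp add: dot_square_norm power_mult_distrib exp_double)
  then have "norm (X \<tau>) * exp (\<Phi> \<tau>) \<le> norm (X r) * exp (\<Phi> r)"
    by (rule power2_le_imp_le) simp
  then show ?thesis by (simp add: exp_diff field_simps)
qed

lemma gronwall_radial:
  fixes X :: "'a::euclidean_space \<Rightarrow> 'b::real_inner"
  assumes "r > 0"
    and X_deriv: "\<And>x. x \<noteq> 0 \<Longrightarrow> norm x \<le> r \<Longrightarrow> (X has_derivative X' x) (at x)"
    and X'_bound: "\<And>x. x \<noteq> 0 \<Longrightarrow> norm x \<le> r \<Longrightarrow> norm (X' x (sgn x)) \<le> k (norm x) * norm (X x)"
    and \<Phi>: "\<And>s. 0 < s \<Longrightarrow> s \<le> r \<Longrightarrow> (\<Phi> has_real_derivative k s) (at s)"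
  obtains M where "\<And>x. x \<noteq> 0 \<Longrightarrow> norm x \<le> r \<Longrightarrow> norm (X x) \<le> M * exp (\<Phi> r - \<Phi> (norm x))"
proof -
  have "isCont X x" if "x \<in> sphere 0 r" for x
    using X_deriv[of x] that \<open>r > 0\<close> by (auto intro: has_derivative_continuous)
  then have "bounded (X ` sphere 0 r)"
    by (intro compact_imp_bounded compact_continuous_image continuous_at_imp_continuous_on) auto
  then obtain M where M: "\<And>x. x \<in> sphere 0 r \<Longrightarrow> norm (X x) \<le> M"
    unfolding bounded_iff by blast
  show ?thesis
  proof (rule that[of M])
    fix x :: 'a assume x: "x \<noteq> 0" "norm x \<le> r"
    define w where "w = sgn x"
    have w_unit: "norm w = 1" "norm x *\<^sub>R w = x"
      using x by (simp_all add: w_def norm_sgn sgn_div_norm)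
    have "norm (X (norm x *\<^sub>R w)) \<le> exp (\<Phi> r - \<Phi> (norm x)) * norm (X (r *\<^sub>R w))"
    proof (rule gronwall_backward[where X = "\<lambda>s. X (s *\<^sub>R w)" and k = k, OF x(2)])
      fix s assume s: "norm x \<le> s" "s \<le> r"
      then have s_pos: "s > 0" using x by (meson zero_less_norm_iff less_le_trans)
      have s_w: "s *\<^sub>R w \<noteq> 0" "norm (s *\<^sub>R w) = s" "sgn (s *\<^sub>R w) = w"
        using s_pos w_unit(1) by (auto simp: sgn_div_norm)
      have "((\<lambda>s. s *\<^sub>R w) has_vector_derivative w) (at s)"
        by (auto intro!: derivative_eq_intros)
      then have "((X \<circ> (\<lambda>s. s *\<^sub>R w)) has_vector_derivative X' (s *\<^sub>R w) w) (at s)"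
        by (rule vector_derivative_diff_chain_within) (use X_deriv s_w s in \<open>auto intro: has_derivative_at_withinI\<close>)
      then show "((\<lambda>s. X (s *\<^sub>R w)) has_vector_derivative X' (s *\<^sub>R w) w) (at s)" by (simp add: o_def)
      show "norm (X' (s *\<^sub>R w) w) \<le> k s * norm (X (s *\<^sub>R w))" using X'_bound[of "s *\<^sub>R w"] s_w s by simp
      show "(\<Phi> has_real_derivative k s) (at s)" by (rule \<Phi>[OF s_pos s(2)])
    qed
    also have "\<dots> \<le> exp (\<Phi> r - \<Phi> (norm x)) * M"
      using w_unit(1) \<open>r > 0\<close> by (intro mult_left_mono M) auto
    finally show "norm (X x) \<le> M * exp (\<Phi> r - \<Phi> (norm x))" by (simp add: w_unit(2) mult.commute)
  qed
qed

lemma pole_order_at_most_bound: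
  assumes "pole_order_at_most k f"
  obtains e M where "e > 0" "M \<ge> 0" "\<And>t. t \<noteq> 0 \<Longrightarrow> norm t < e \<Longrightarrow> norm (t ^ k * f t) \<le> M"
proof -
  obtain g where g: "g analytic_on {0}" and f: "\<forall>\<^sub>F t in at 0. f t = g t / t ^ k"
    using assms unfolding pole_order_at_most_def by blast
  have "(g \<longlongrightarrow> g 0) (at 0)" using analytic_at_imp_isCont[OF g] by (simp add: isCont_def)
  then have "\<forall>\<^sub>F t in at 0. dist (g t) (g 0) < 1" by (rule tendstoD) simp
  moreover have "\<forall>\<^sub>F t::complex in at 0. t \<noteq> 0" by (simp add: eventually_at_filter)
  ultimately have "\<forall>\<^sub>F t in at 0. norm (t ^ k * f t) \<le> norm (g 0) + 1"
    using f
  proof eventually_elim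
    case (elim t)
    then have "t ^ k * f t = g t" by simp
    then show ?case using elim(1) norm_triangle_sub[of "g t" "g 0"] by (simp add: dist_norm)
  qed
  then obtain e where "e > 0" "\<And>t. t \<noteq> 0 \<Longrightarrow> norm t < e \<Longrightarrow> norm (t ^ k * f t) \<le> norm (g 0) + 1"
    unfolding eventually_at by auto
  then show ?thesis using that[of e "norm (g 0) + 1"] by auto
qed

lemma not_essential_moderate_growth:
  assumes "f holomorphic_on S - {z}" "open S" "z \<in> S"
    and "\<forall>\<^sub>F w in at z. norm ((w - z) ^ n * f w) \<le> M"
  shows "not_essential f z"
proof -
  have "(\<lambda>w. (w - z) ^ n * f w) holomorphic_on S - {z}" using assms(1) by (intro holomorphic_intros)
  moreover have "z \<in> interior S" using assms(2,3) by (simp add: interior_open)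
  ultimately obtain g where g: "g holomorphic_on S" "\<And>w. w \<in> S - {z} \<Longrightarrow> g w = (w - z) ^ n * f w"
    using holomorphic_on_extend_bounded[of "\<lambda>w. (w - z) ^ n * f w" S z] assms(4) by blast
  have powers: "(\<lambda>w. (w - z) ^ n) holomorphic_on S" by (intro holomorphic_intros)
  have "not_essential (\<lambda>w. g w / (w - z) ^ n) z"
    using g(1) powers assms(2,3)
    by (intro not_essential_divide not_essential_holomorphic isolated_singularity_at_holomorphic)
      (auto intro: holomorphic_on_subset)
  moreover have "\<forall>\<^sub>F w in at z. g w / (w - z) ^ n = f w"
    using eventually_at_in_open[OF assms(2,3)] by eventually_elim (simp add: g(2))
  ultimately show ?thesis by (rule not_essential_transform)
qed

lemma not_essential_zero_or_inverse_extends: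
  assumes "isolated_singularity_at f z" "not_essential f z"
  obtains (zero) "(f \<longlongrightarrow> 0) (at z)"
    | (inverse) e h where "e > 0" "h holomorphic_on ball z e"
        "\<And>w. w \<in> ball z e - {z} \<Longrightarrow> f w \<noteq> 0 \<and> h w = 1 / f w"
proof (cases "(f \<longlongrightarrow> 0) (at z)")
  case False
  then consider L where "(f \<longlongrightarrow> L) (at z)" "L \<noteq> 0" | "is_pole f z"
    using assms(2) unfolding not_essential_def by blast
  then obtain c where c: "((\<lambda>w. 1 / f w) \<longlongrightarrow> c) (at z)"
  proof cases
    case (1 L)
    then show ?thesis by (intro that[of "1 / L"] tendsto_intros)
  next
    case 2
    then have "((\<lambda>w. inverse (f w)) \<longlongrightarrow> 0) (at z)"
      unfolding is_pole_def by (rule filterlim_compose[OF tendsto_inverse_0])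
    then show ?thesis by (intro that[of 0]) (simp add: inverse_eq_divide)
  qed
  have "\<forall>\<^sub>F w in at z. f w \<noteq> 0"
    using not_essential_frequently_0_imp_tendsto_0[OF assms] False by (auto simp: frequently_def)
  then obtain e1 where e1: "e1 > 0" "\<And>w. w \<in> ball z e1 - {z} \<Longrightarrow> f w \<noteq> 0"
    unfolding eventually_at by (auto simp: dist_commute)
  obtain e2 where e2: "e2 > 0" "f analytic_on ball z e2 - {z}"
    using assms(1) unfolding isolated_singularity_at_def by blast
  define e where "e = min e1 e2"
  have "f holomorphic_on ball z e - {z}"
    by (rule holomorphic_on_subset[OF analytic_imp_holomorphic[OF e2(2)]]) (auto simp: e_def)
  then have "(\<lambda>w. 1 / f w) holomorphic_on ball z e - {z}"
    using e1(2) by (intro holomorphic_intros) (auto simp: e_def)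
  from removable_singularity[OF this open_ball c] show ?thesis
    using e1 e2(1) by (intro inverse[of e "\<lambda>w. if w = z then c else 1 / f w"]) (auto simp: e_def)
qed

section \<open>The symmetric square of a second order equation\<close>

text \<open>For solutions \<open>f, g\<close> with Wronskian \<open>w = f g' - g f'\<close>, the functions \<open>A = f g / w\<close>,
  \<open>B = (f g)' / w\<close> and \<open>C = f' g' / w\<close> satisfy this system.\<close>

definition symmetric_square_system ::
  "complex set \<Rightarrow> (complex \<Rightarrow> complex) \<Rightarrow> (complex \<Rightarrow> complex) \<Rightarrow>
   (complex \<Rightarrow> complex) \<Rightarrow> (complex \<Rightarrow> complex) \<Rightarrow> (complex \<Rightarrow> complex) \<Rightarrow> bool" where
  "symmetric_square_system S p q A B C \<longleftrightarrow> (\<forall>t\<in>S.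
     (A has_field_derivative B t + p t * A t) (at t) \<and>
     (B has_field_derivative 2 * C t - 2 * q t * A t) (at t) \<and>
     (C has_field_derivative - p t * C t - q t * B t) (at t))"

lemma symmetric_square_system_imp_holomorphic:
  "symmetric_square_system S p q A B C \<Longrightarrow> A holomorphic_on S"
  unfolding symmetric_square_system_def holomorphic_on_def field_differentiable_def
  by (blast intro: has_field_derivative_at_within)

lemma symmetric_square_system_subset:
  "symmetric_square_system S p q A B C \<Longrightarrow> T \<subseteq> S \<Longrightarrow> symmetric_square_system T p q A B C"
  by (auto simp: symmetric_square_system_def)

text \<open>The powers of \<open>t\<close> turn the system into one whose matrix is \<open>O(t\<^sup>-\<^sup>k)\<close>.\<close>

lemma symmetric_square_system_scaled:
  assumes sys: "symmetric_square_system S p q A B C" and "t \<in> S" "t \<noteq> 0" "k \<le> 1"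
  defines "b \<equiv> \<lambda>t. t ^ k * B t" and "c \<equiv> \<lambda>t. t ^ (2 * k) * C t"
    and "\<alpha> \<equiv> t ^ k * p t" and "\<beta> \<equiv> t ^ (2 * k) * q t"
  shows "(A has_field_derivative (b t + \<alpha> * A t) / t ^ k) (at t)"
    and "(b has_field_derivative (of_nat k * b t + 2 * c t - 2 * \<beta> * A t) / t ^ k) (at t)"
    and "(c has_field_derivative (2 * of_nat k * c t - \<alpha> * c t - \<beta> * b t) / t ^ k) (at t)"
proof -
  have A_deriv: "(A has_field_derivative B t + p t * A t) (at t)"
    and B_deriv: "(B has_field_derivative 2 * C t - 2 * q t * A t) (at t)"
    and C_deriv: "(C has_field_derivative - p t * C t - q t * B t) (at t)"
    using sys \<open>t \<in> S\<close> unfolding symmetric_square_system_def by blast+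
  have k_cases: "k = 0 \<or> k = 1" using \<open>k \<le> 1\<close> by auto
  show "(A has_field_derivative (b t + \<alpha> * A t) / t ^ k) (at t)"
    by (rule DERIV_cong[OF A_deriv]) (use \<open>t \<noteq> 0\<close> in \<open>simp add: b_def \<alpha>_def field_simps\<close>)
  show "(b has_field_derivative (of_nat k * b t + 2 * c t - 2 * \<beta> * A t) / t ^ k) (at t)"
    unfolding b_def
    by (rule DERIV_cong[OF DERIV_mult[OF DERIV_power[OF DERIV_ident] B_deriv]])
      (use k_cases \<open>t \<noteq> 0\<close> in \<open>auto simp: c_def \<beta>_def field_simps power2_eq_square\<close>)
  show "(c has_field_derivative (2 * of_nat k * c t - \<alpha> * c t - \<beta> * b t) / t ^ k) (at t)"
    unfolding c_def
    by (rule DERIV_cong[OF DERIV_mult[OF DERIV_power[OF DERIV_ident] C_deriv]])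
      (use k_cases \<open>t \<noteq> 0\<close> in \<open>auto simp: b_def \<alpha>_def \<beta>_def field_simps power2_eq_square\<close>)
qed

lemma norm_triple_ge:
  fixes a :: "'a::real_normed_vector" and b :: "'b::real_normed_vector" and c :: "'c::real_normed_vector"
  shows "norm a \<le> norm (a, b, c)" "norm b \<le> norm (a, b, c)" "norm c \<le> norm (a, b, c)"
  using norm_fst_le[of a "(b, c)"] norm_snd_le[of "(b, c)" a] norm_fst_le[of b c] norm_snd_le[of c b]
  by auto

lemma norm_triple_le: "norm (a, b, c) \<le> norm a + norm b + norm c"
  using norm_Pair_le[of a "(b, c)"] norm_Pair_le[of b c] by simp

lemma norm_mult_triple:
  fixes a b c u :: "'a::real_normed_div_algebra"
  shows "norm (u * a, u * b, u * c) = norm u * norm (a, b, c)"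
proof -
  have pair: "sqrt ((norm (u * x))\<^sup>2 + (norm u * y)\<^sup>2) = norm u * sqrt ((norm x)\<^sup>2 + y\<^sup>2)" for x y
    by (simp add: norm_mult power_mult_distrib real_sqrt_mult flip: distrib_left)
  show ?thesis unfolding norm_Pair pair[of b "norm c", folded norm_mult] by (rule pair)
qed

lemma symmetric_square_matrix_bound:
  fixes a b c \<alpha> \<beta> :: complex
  assumes "norm \<alpha> \<le> P" "norm \<beta> \<le> Q" "k \<le> 1" "6 + 2 * P + 3 * Q \<le> K"
  shows "norm (b + \<alpha> * a, of_nat k * b + 2 * c - 2 * \<beta> * a, 2 * of_nat k * c - \<alpha> * c - \<beta> * b)
    \<le> K * norm (a, b, c)"
proof -
  let ?N = "norm (a, b, c)"
  note components_le = norm_triple_ge[where a = a and b = b and c = c]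
  have nonneg: "0 \<le> P" "0 \<le> Q" using assms(1,2) norm_ge_zero order_trans by blast+
  have product: "norm (x * y) \<le> u * ?N" if "norm x \<le> u" "norm y \<le> ?N" "0 \<le> u" for x y :: complex and u
    unfolding norm_mult using that by (intro mult_mono) auto
  have products: "norm (\<alpha> * a) \<le> P * ?N" "norm (\<beta> * a) \<le> Q * ?N"
    "norm (\<alpha> * c) \<le> P * ?N" "norm (\<beta> * b) \<le> Q * ?N"
    by (intro product assms(1,2) components_le nonneg)+
  have "norm (of_nat k * b) \<le> 1 * ?N" "norm (of_nat k * c) \<le> 1 * ?N"
    unfolding norm_mult norm_of_nat using \<open>k \<le> 1\<close> by (intro mult_mono components_le; simp)+
  moreover have "norm (b + \<alpha> * a) \<le> norm b + norm (\<alpha> * a)" by (rule norm_triangle_ineq)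
  moreover have "norm (of_nat k * b + 2 * c - 2 * \<beta> * a)
      \<le> norm (of_nat k * b) + norm (2 * c) + norm (2 * (\<beta> * a))"
    using norm_triangle_ineq4[of "of_nat k * b + 2 * c" "2 * (\<beta> * a)"]
      norm_triangle_ineq[of "of_nat k * b" "2 * c"] by (simp add: mult.assoc)
  moreover have "norm (2 * of_nat k * c - \<alpha> * c - \<beta> * b)
      \<le> norm (2 * (of_nat k * c)) + norm (\<alpha> * c) + norm (\<beta> * b)"
    using norm_triangle_ineq4[of "2 * (of_nat k * c) - \<alpha> * c" "\<beta> * b"]
      norm_triangle_ineq4[of "2 * (of_nat k * c)" "\<alpha> * c"] by (simp add: mult.assoc)
  moreover have "norm (2 * c) = 2 * norm c" "norm (2 * (\<beta> * a)) = 2 * norm (\<beta> * a)"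
    "norm (2 * (of_nat k * c)) = 2 * norm (of_nat k * c)"
    by (simp_all add: norm_mult)
  ultimately have "norm (b + \<alpha> * a, of_nat k * b + 2 * c - 2 * \<beta> * a, 2 * of_nat k * c - \<alpha> * c - \<beta> * b)
      \<le> (6 + 2 * P + 3 * Q) * ?N"
    using norm_triple_le[of "b + \<alpha> * a" "of_nat k * b + 2 * c - 2 * \<beta> * a" "2 * of_nat k * c - \<alpha> * c - \<beta> * b"]
      components_le products unfolding distrib_right by linarith
  also have "\<dots> \<le> K * ?N" by (intro mult_right_mono assms(4)) simp
  finally show ?thesis .
qed

lemma symmetric_square_direction_bound:
  fixes a b c \<alpha> \<beta> t :: complex
  assumes "t \<noteq> 0" "norm \<alpha> \<le> P" "norm \<beta> \<le> Q" "k \<le> 1" "6 + 2 * P + 3 * Q \<le> K"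
  shows "norm ((b + \<alpha> * a) / t ^ k * sgn t, (of_nat k * b + 2 * c - 2 * \<beta> * a) / t ^ k * sgn t,
      (2 * of_nat k * c - \<alpha> * c - \<beta> * b) / t ^ k * sgn t) \<le> K / norm t ^ k * norm (a, b, c)"
    (is "norm (?u / _ * _, ?v / _ * _, ?w / _ * _) \<le> _")
proof -
  have "norm (?u / t ^ k * sgn t, ?v / t ^ k * sgn t, ?w / t ^ k * sgn t)
      = norm (sgn t / t ^ k * ?u, sgn t / t ^ k * ?v, sgn t / t ^ k * ?w)"
    by (simp add: mult.commute)
  also have "\<dots> = norm (?u, ?v, ?w) / norm t ^ k"
    using assms(1) unfolding norm_mult_triple by (simp add: norm_divide norm_power norm_sgn)
  also have "\<dots> \<le> K * norm (a, b, c) / norm t ^ k"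
    by (intro divide_right_mono symmetric_square_matrix_bound[OF assms(2-5)]) simp
  finally show ?thesis by simp
qed

lemma symmetric_square_growth:
  fixes \<Phi> :: "nat \<Rightarrow> real \<Rightarrow> real"
  assumes system: "symmetric_square_system (ball 0 R - {0}) p q A B C" and "R > 0" and "k \<le> 1"
    and p_pole: "pole_order_at_most k p" and q_pole: "pole_order_at_most (2 * k) q"
    and \<Phi>: "\<And>K s. 0 < s \<Longrightarrow> (\<Phi> K has_real_derivative K / s ^ k) (at s)"
  obtains r M K where "r > 0"
    "\<And>t. t \<noteq> 0 \<Longrightarrow> norm t \<le> r \<Longrightarrow> norm (A t) \<le> M * exp (\<Phi> K r - \<Phi> K (norm t))"
proof -
  obtain e1 P where P: "e1 > 0" "P \<ge> 0" "\<And>t. t \<noteq> 0 \<Longrightarrow> norm t < e1 \<Longrightarrow> norm (t ^ k * p t) \<le> P"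
    using pole_order_at_most_bound[OF p_pole] by blast
  obtain e2 Q where Q: "e2 > 0" "Q \<ge> 0" "\<And>t. t \<noteq> 0 \<Longrightarrow> norm t < e2 \<Longrightarrow> norm (t ^ (2 * k) * q t) \<le> Q"
    using pole_order_at_most_bound[OF q_pole] by blast
  define r where "r = Min {R, e1, e2} / 2"
  have r: "r > 0" "r < R" "r < e1" "r < e2"
    using \<open>R > 0\<close> P(1) Q(1) by (auto simp: r_def min_def)
  obtain K :: nat where K: "6 + 2 * P + 3 * Q \<le> real K"
    using real_arch_simple by blast
  let ?b = "\<lambda>t. t ^ k * B t" and ?c = "\<lambda>t. t ^ (2 * k) * C t"
  let ?dA = "\<lambda>t. ?b t + t ^ k * p t * A t"
    and ?db = "\<lambda>t. of_nat k * ?b t + 2 * ?c t - 2 * (t ^ (2 * k) * q t) * A t"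
    and ?dc = "\<lambda>t. 2 * of_nat k * ?c t - t ^ k * p t * ?c t - t ^ (2 * k) * q t * ?b t"
  obtain M where M: "\<And>t. t \<noteq> 0 \<Longrightarrow> norm t \<le> r \<Longrightarrow>
      norm (A t, ?b t, ?c t) \<le> M * exp (\<Phi> K r - \<Phi> K (norm t))"
  proof (rule gronwall_radial[where X = "\<lambda>t. (A t, ?b t, ?c t)" and \<Phi> = "\<Phi> K", OF r(1) _ _ \<Phi>])
    fix t :: complex assume t: "t \<noteq> 0" "norm t \<le> r"
    then have "t \<in> ball 0 R - {0}" using r by auto
    from symmetric_square_system_scaled[OF system this t(1) \<open>k \<le> 1\<close>]
    show "((\<lambda>t. (A t, ?b t, ?c t)) has_derivative
        (\<lambda>h. (?dA t / t ^ k * h, ?db t / t ^ k * h, ?dc t / t ^ k * h))) (at t)"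
      unfolding has_field_derivative_def by (intro has_derivative_Pair)
    show "norm (?dA t / t ^ k * sgn t, ?db t / t ^ k * sgn t, ?dc t / t ^ k * sgn t)
        \<le> K / norm t ^ k * norm (A t, ?b t, ?c t)"
      using P(3)[of t] Q(3)[of t] t r \<open>k \<le> 1\<close> K
      by (intro symmetric_square_direction_bound[where P = P and Q = Q]) auto
  qed auto
  show ?thesis
  proof (rule that[OF r(1)])
    show "norm (A t) \<le> M * exp (\<Phi> K r - \<Phi> K (norm t))" if "t \<noteq> 0" "norm t \<le> r" for t
      using M[OF that] norm_triple_ge(1)[of "A t" "?b t" "?c t"] by linarith
  qed
qed

lemma symmetric_square_bounded:
  assumes "symmetric_square_system (ball 0 R - {0}) p q A B C" "R > 0"
    and "pole_order_at_most 0 p" "pole_order_at_most 0 q"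
  obtains e M where "e > 0" "\<And>t. t \<noteq> 0 \<Longrightarrow> norm t \<le> e \<Longrightarrow> norm (A t) \<le> M"
proof -
  have "pole_order_at_most (2 * 0) q" using assms(4) by simp
  moreover have "((\<lambda>s. real K * s) has_real_derivative K / s ^ 0) (at s)" for K s
    by (auto intro!: derivative_eq_intros)
  ultimately obtain r :: real and M and K :: nat where r: "r > 0" and
    M: "\<And>t. t \<noteq> 0 \<Longrightarrow> norm t \<le> r \<Longrightarrow> norm (A t) \<le> M * exp (K * r - K * norm t)"
    using symmetric_square_growth[OF assms(1,2) zero_le_one assms(3), of "\<lambda>K s. K * s"] by blast
  show ?thesis
  proof (rule that[OF r])
    fix t :: complex assume t: "t \<noteq> 0" "norm t \<le> r"
    have "norm (A t) \<le> \<bar>M\<bar> * exp (K * r - K * norm t)"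
      by (rule order_trans[OF M[OF t]]) (intro mult_right_mono, auto)
    also have "\<dots> \<le> \<bar>M\<bar> * exp (K * r)" by (intro mult_left_mono) auto
    finally show "norm (A t) \<le> \<bar>M\<bar> * exp (K * r)" .
  qed
qed

lemma symmetric_square_moderate_growth:
  assumes "symmetric_square_system (ball 0 R - {0}) p q A B C" "R > 0"
    and "pole_order_at_most 1 p" "pole_order_at_most 2 q"
  obtains n M where "\<forall>\<^sub>F t in at 0. norm (t ^ n * A t) \<le> M"
proof -
  have "pole_order_at_most (2 * 1) q" using assms(4) by simp
  moreover have "((\<lambda>s. real K * ln s) has_real_derivative K / s ^ 1) (at s)" if "0 < s" for K s
    using that by (auto intro!: derivative_eq_intros simp: divide_inverse)
  ultimately obtain r M and n :: nat where r: "r > 0" and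
    M: "\<And>t. t \<noteq> 0 \<Longrightarrow> norm t \<le> r \<Longrightarrow> norm (A t) \<le> M * exp (n * ln r - n * ln (norm t))"
    using symmetric_square_growth[OF assms(1,2) order_refl assms(3), of "\<lambda>K s. K * ln s"] by blast
  have "norm (t ^ n * A t) \<le> M * r ^ n" if t: "t \<noteq> 0" "norm t \<le> r" for t
  proof -
    have "exp (n * ln r - n * ln (norm t)) = (r / norm t) ^ n"
      using t r by (simp add: exp_diff exp_of_nat_mult power_divide)
    then have "norm t ^ n * norm (A t) \<le> norm t ^ n * (M * (r / norm t) ^ n)"
      using M[OF t] by (intro mult_left_mono) auto
    also have "\<dots> = M * r ^ n" using t by (simp add: power_divide)
    finally show ?thesis by (simp add: norm_mult norm_power)
  qed
  then show ?thesis using r by (intro that[of n "M * r ^ n"]) (auto simp: eventually_at intro!: exI[of _ r])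
qed

section \<open>Holomorphic vector fields on the sphere\<close>

lemma entire_eq_0_if_card_zeros:
  fixes f :: "complex \<Rightarrow> complex"
  assumes holo: "f holomorphic_on UNIV" and zeros: "\<And>z. z \<in> Z \<Longrightarrow> f z = 0"
    and limit: "((\<lambda>z. f z / z ^ card Z) \<longlongrightarrow> 0) at_infinity"
  shows "f z = 0"
proof -
  let ?n = "card Z"
  obtain R where R: "\<And>z :: complex. R \<le> norm z \<Longrightarrow> norm (f z / z ^ ?n) < 1"
    using tendstoD[OF limit zero_less_one] unfolding eventually_at_infinity by auto
  have bound: "norm (f z) \<le> 1 * norm z ^ ?n" if "max R 1 \<le> norm z" for z :: complex
  proof -
    have "z \<noteq> 0" using that by auto
    then show ?thesis using R[of z] that by (simp add: norm_divide norm_power divide_less_eq)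
  qed
  define P where "P = (\<Sum>k\<le>?n. monom ((deriv ^^ k) f 0 / fact k) k)"
  have poly_eq: "poly P z = f z" for z :: complex
    using Liouville_polynomial[OF holo bound, of "max R 1" z] by (simp add: P_def poly_sum poly_monom)
  have "degree P \<le> ?n" unfolding P_def by (rule degree_sum_le) (auto intro: order_trans[OF degree_monom_le])
  have "P = 0"
  proof (rule ccontr)
    assume "P \<noteq> 0"
    have "Z \<subseteq> {z. poly P z = 0}" using zeros poly_eq by auto
    then have "?n \<le> card {z. poly P z = 0}" using \<open>P \<noteq> 0\<close> by (intro card_mono poly_roots_finite)
    also have "\<dots> \<le> degree P" using \<open>P \<noteq> 0\<close> by (rule card_poly_roots_bound)
    finally have "degree P = ?n" using \<open>degree P \<le> ?n\<close> by simp
    then have "((\<lambda>z. f z / z ^ ?n) \<longlongrightarrow> lead_coeff P) at_infinity"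
      using poly_divide_tendsto_aux[of P] by (simp add: poly_eq)
    then have "lead_coeff P = 0" using limit by (intro tendsto_unique[OF trivial_limit_at_infinity])
    then show False using \<open>P \<noteq> 0\<close> by simp
  qed
  then show ?thesis using poly_eq[of z] by simp
qed

lemma holomorphic_extend_by_zero:
  fixes f :: "complex \<Rightarrow> complex"
  assumes "finite Z" "f holomorphic_on - Z" "\<And>z. z \<in> Z \<Longrightarrow> (f \<longlongrightarrow> 0) (at z)"
  shows "(\<lambda>z. if z \<in> Z then 0 else f z) holomorphic_on UNIV"
proof (rule no_isolated_singularity[OF _ _ open_UNIV assms(1)])
  let ?g = "\<lambda>z. if z \<in> Z then 0 else f z"
  have holo: "?g holomorphic_on - Z" using assms(2) by (rule holomorphic_transform) simp
  then show "?g holomorphic_on UNIV - Z" by (simp add: Compl_eq_Diff_UNIV)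
  show "continuous_on UNIV ?g"
  proof (intro continuous_at_imp_continuous_on ballI)
    fix w :: complex
    show "isCont ?g w"
    proof (cases "w \<in> Z")
      case True
      have "(?g \<longlongrightarrow> 0) (at w)"
        by (rule Lim_null_comparison[OF _ tendsto_norm_zero[OF assms(3)[OF True]]]) simp
      then show ?thesis using True by (simp add: isCont_def)
    next
      case False
      have "open (- Z)" using assms(1) by (simp add: finite_imp_closed open_Compl)
      then show ?thesis
        using holomorphic_on_imp_continuous_on[OF holo] False by (simp add: continuous_on_eq_continuous_at)
    qed
  qed
qed

text \<open>The coefficient of the vector field \<open>A d/dz\<close> with respect to the coordinate at a point.\<close>

fun field_in_chart :: "(complex \<Rightarrow> complex) \<Rightarrow> cp1 \<Rightarrow> complex \<Rightarrow> complex" where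
  "field_in_chart A (Fin c) t = A (c + t)"
| "field_in_chart A Infty t = - t\<^sup>2 * A (1 / t)"

lemma DERIV_compose_reciprocal:
  fixes f :: "'a::real_normed_field \<Rightarrow> 'a"
  assumes "(f has_field_derivative d) (at (1 / t))" "t \<noteq> 0"
  shows "((\<lambda>s. f (1 / s)) has_field_derivative - d / t\<^sup>2) (at t)"
proof -
  have "((\<lambda>s. 1 / s) has_field_derivative - 1 / t\<^sup>2) (at t)"
    using assms(2) by (auto intro!: derivative_eq_intros simp: power2_eq_square)
  from DERIV_chain2[OF assms(1) this] show ?thesis by simp
qed

lemma symmetric_square_system_at_infinity:
  assumes "symmetric_square_system S b1 b2 A B C"
  shows "symmetric_square_system {t. t \<noteq> 0 \<and> 1 / t \<in> S} (coeff1 b1 Infty) (coeff2 b2 Infty)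
     (field_in_chart A Infty) (\<lambda>t. B (1 / t)) (\<lambda>t. - C (1 / t) / t\<^sup>2)"
  unfolding symmetric_square_system_def
proof (intro ballI conjI)
  fix t assume "t \<in> {t. t \<noteq> 0 \<and> 1 / t \<in> S}"
  then have t: "t \<noteq> 0" "1 / t \<in> S" by auto
  have A_deriv: "((\<lambda>t. A (1 / t)) has_field_derivative - (B (1 / t) + b1 (1 / t) * A (1 / t)) / t\<^sup>2) (at t)"
    and B_deriv: "((\<lambda>t. B (1 / t)) has_field_derivative - (2 * C (1 / t) - 2 * b2 (1 / t) * A (1 / t)) / t\<^sup>2) (at t)"
    and C_deriv: "((\<lambda>t. C (1 / t)) has_field_derivative
      - (- b1 (1 / t) * C (1 / t) - b2 (1 / t) * B (1 / t)) / t\<^sup>2) (at t)"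
    using assms t unfolding symmetric_square_system_def by (blast intro: DERIV_compose_reciprocal)+
  have field: "field_in_chart A Infty = (\<lambda>t. - t\<^sup>2 * A (1 / t))" by (simp add: fun_eq_iff)
  show "(field_in_chart A Infty has_field_derivative
      B (1 / t) + coeff1 b1 Infty t * field_in_chart A Infty t) (at t)"
    unfolding field using t by (auto intro!: derivative_eq_intros A_deriv simp: field_simps power2_eq_square)
  show "((\<lambda>t. B (1 / t)) has_field_derivative
      2 * (- C (1 / t) / t\<^sup>2) - 2 * coeff2 b2 Infty t * field_in_chart A Infty t) (at t)"
    by (rule DERIV_cong[OF B_deriv]) (use t in \<open>simp add: field_simps eval_nat_numeral\<close>)
  show "((\<lambda>t. - C (1 / t) / t\<^sup>2) has_field_derivative
      - coeff1 b1 Infty t * (- C (1 / t) / t\<^sup>2) - coeff2 b2 Infty t * B (1 / t)) (at t)"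
    by (rule DERIV_cong[OF DERIV_divide[OF DERIV_minus[OF C_deriv] DERIV_power[OF DERIV_ident]]])
      (use t in \<open>simp_all add: field_simps eval_nat_numeral\<close>)
qed

lemma symmetric_square_system_in_chart:
  assumes "symmetric_square_system {z. Fin z \<notin> D} b1 b2 A B C"
  obtains B' C' where "symmetric_square_system {t. t \<noteq> 0 \<and> chart p t \<notin> D}
    (coeff1 b1 p) (coeff2 b2 p) (field_in_chart A p) B' C'"
proof (cases p)
  case (Fin c)
  have "((\<lambda>t. f (c + t)) has_field_derivative d) (at t)"
    if "(f has_field_derivative d) (at (c + t))" for f d t
    using that DERIV_shift[of f d t c] by (simp add: add.commute)
  moreover have "field_in_chart A p = (\<lambda>t. A (c + t))" using Fin by (simp add: fun_eq_iff)
  ultimately have "symmetric_square_system {t. t \<noteq> 0 \<and> chart p t \<notin> D}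
      (coeff1 b1 p) (coeff2 b2 p) (field_in_chart A p) (\<lambda>t. B (c + t)) (\<lambda>t. C (c + t))"
    using assms Fin by (auto simp: symmetric_square_system_def)
  then show ?thesis by (rule that)
next
  case Infty
  have "{t. t \<noteq> 0 \<and> chart p t \<notin> D} = {t. t \<noteq> 0 \<and> 1 / t \<in> {z. Fin z \<notin> D}}" using Infty by auto
  then show ?thesis using that symmetric_square_system_at_infinity[OF assms] unfolding Infty by simp
qed

lemma symmetric_square_system_punctured_chart:
  assumes "finite D" "symmetric_square_system {z. Fin z \<notin> D} b1 b2 A B C"
  obtains R B' C' where "R > 0"
    "symmetric_square_system (ball 0 R - {0}) (coeff1 b1 p) (coeff2 b2 p) (field_in_chart A p) B' C'"
proof -
  obtain R where R: "R > 0" "\<And>t. t \<in> ball 0 R - {0} \<Longrightarrow> chart p t \<notin> D"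
    using punctured_chart_ball[OF assms(1), of p] by blast
  obtain B' C' where "symmetric_square_system {t. t \<noteq> 0 \<and> chart p t \<notin> D}
      (coeff1 b1 p) (coeff2 b2 p) (field_in_chart A p) B' C'"
    using symmetric_square_system_in_chart[OF assms(2)] .
  then have "symmetric_square_system (ball 0 R - {0}) (coeff1 b1 p) (coeff2 b2 p) (field_in_chart A p) B' C'"
    by (rule symmetric_square_system_subset) (use R(2) in auto)
  with R(1) show ?thesis by (rule that)
qed

lemma field_zero_or_primitive:
  assumes "finite D" "riemann_equation D b1 b2" "p \<in> D"
    and "symmetric_square_system {z. Fin z \<notin> D} b1 b2 A B C"
  obtains (zero) "(field_in_chart A p \<longlongrightarrow> 0) (at 0)"
    | (primitive) e K where "e > 0"
        "\<And>t. t \<in> ball 0 e - {0} \<Longrightarrow> field_in_chart A p t \<noteq> 0"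
        "\<And>t. t \<in> ball 0 e - {0} \<Longrightarrow> (K has_field_derivative 1 / field_in_chart A p t) (at t)"
proof -
  let ?A = "field_in_chart A p"
  obtain R B' C' where "R > 0"
    and system: "symmetric_square_system (ball 0 R - {0}) (coeff1 b1 p) (coeff2 b2 p) ?A B' C'"
    using symmetric_square_system_punctured_chart[OF assms(1,4)] .
  have "pole_order_at_most 1 (coeff1 b1 p)" "pole_order_at_most 2 (coeff2 b2 p)"
    using assms(2,3) unfolding riemann_equation_def by blast+
  then obtain n M where "\<forall>\<^sub>F t in at 0. norm (t ^ n * ?A t) \<le> M"
    using symmetric_square_moderate_growth[OF system \<open>R > 0\<close>] by blast
  moreover have holo: "?A holomorphic_on ball 0 R - {0}"
    by (rule symmetric_square_system_imp_holomorphic[OF system])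
  ultimately have not_essential: "not_essential ?A 0"
    using \<open>R > 0\<close> by (intro not_essential_moderate_growth[of ?A "ball 0 R" 0 n M]) auto
  have isolated: "isolated_singularity_at ?A 0"
    using holo \<open>R > 0\<close> by (intro isolated_singularity_at_holomorphic[of _ "ball 0 R"]) auto
  show ?thesis
  proof (rule not_essential_zero_or_inverse_extends[OF isolated not_essential])
    fix e h assume e: "e > 0" and h_holo: "h holomorphic_on ball 0 e"
      and inverse: "\<And>t. t \<in> ball 0 e - {0} \<Longrightarrow> ?A t \<noteq> 0 \<and> h t = 1 / ?A t"
    obtain K where "\<And>t. t \<in> ball 0 e \<Longrightarrow> (K has_field_derivative h t) (at t within ball 0 e)"
      using holomorphic_convex_primitive'[OF convex_ball open_ball h_holo] by blast
    then have K_deriv: "(K has_field_derivative h t) (at t)" if "t \<in> ball 0 e" for t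
      using that by (metis at_within_open open_ball)
    show ?thesis
    proof (rule primitive[OF e])
      fix t :: complex assume "t \<in> ball 0 e - {0}"
      then show "?A t \<noteq> 0" "(K has_field_derivative 1 / ?A t) (at t)"
        using inverse[of t] K_deriv[of t] by auto
    qed
  qed (rule zero)
qed

lemma tendsto_field_at_infinity_iff:
  assumes "2 \<le> n"
  shows "((\<lambda>z. A z / z ^ n) \<longlongrightarrow> 0) at_infinity \<longleftrightarrow>
    ((\<lambda>t. t ^ (n - 2) * field_in_chart A Infty t) \<longlongrightarrow> 0) (at 0)"
proof -
  have "\<forall>\<^sub>F t::complex in at 0. t \<noteq> 0" by (simp add: eventually_at_filter)
  then have "\<forall>\<^sub>F t in at 0. ((\<lambda>z. A z / z ^ n) \<circ> inverse) t = - (t ^ (n - 2) * field_in_chart A Infty t)"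
  proof eventually_elim
    case (elim t)
    have "t ^ n = t ^ (n - 2) * t\<^sup>2" by (metis assms le_add_diff_inverse2 power_add)
    then show ?case by (simp add: inverse_eq_divide power_divide)
  qed
  from tendsto_cong[OF this, of 0] show ?thesis
    unfolding lim_at_infinity_0
    using tendsto_minus_cancel_left[of "\<lambda>t. t ^ (n - 2) * field_in_chart A Infty t" 0 "at 0"]
    by (simp only: minus_zero)
qed

lemma tendsto_field_div_power_at_infinity:
  assumes D: "finite D" "card D = 3" and riemann: "riemann_equation D b1 b2"
    and system: "symmetric_square_system {z. Fin z \<notin> D} b1 b2 A B C"
    and zero: "Infty \<in> D \<Longrightarrow> (field_in_chart A Infty \<longlongrightarrow> 0) (at 0)"
  shows "((\<lambda>z. A z / z ^ card (Fin -` D)) \<longlongrightarrow> 0) at_infinity"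
proof -
  let ?Z = "Fin -` D"
  have "card ?Z = card (Fin -` (D - {Infty}))" by (rule arg_cong[of _ _ card]) auto
  also have "\<dots> = card (D - {Infty})"
    by (rule card_vimage_inj) (auto simp: inj_def intro: cp1.exhaust)
  finally have card: "card ?Z = (if Infty \<in> D then 2 else 3)" using D by simp
  show ?thesis
  proof (cases "Infty \<in> D")
    case True
    then show ?thesis using zero card tendsto_field_at_infinity_iff[of 2 A] by (simp del: field_in_chart.simps)
  next
    case False
    then have "pole_order_at_most 0 (coeff1 b1 Infty)" "pole_order_at_most 0 (coeff2 b2 Infty)"
      using riemann unfolding riemann_equation_def by blast+
    then obtain e M where e: "e > 0" "\<And>t. t \<noteq> 0 \<Longrightarrow> norm t \<le> e \<Longrightarrow> norm (field_in_chart A Infty t) \<le> M"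
      using symmetric_square_system_punctured_chart[OF D(1) system, of Infty] symmetric_square_bounded by metis
    have "\<forall>\<^sub>F t in at 0. norm (t ^ 1 * field_in_chart A Infty t) \<le> norm t * M"
      using e by (auto simp: eventually_at norm_mult intro!: exI[of _ e] mult_left_mono)
    moreover have "((\<lambda>t::complex. norm t * M) \<longlongrightarrow> 0) (at 0)"
      by (auto intro!: tendsto_eq_intros)
    ultimately have "((\<lambda>t. t ^ 1 * field_in_chart A Infty t) \<longlongrightarrow> 0) (at 0)"
      by (rule Lim_null_comparison)
    then show ?thesis using False card tendsto_field_at_infinity_iff[of 3 A] by (simp del: field_in_chart.simps)
  qed
qed

lemma field_eq_0_if_zero_at_three_points:
  assumes D: "finite D" "card D = 3" and riemann: "riemann_equation D b1 b2"
    and system: "symmetric_square_system {z. Fin z \<notin> D} b1 b2 A B C"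
    and zero: "\<And>p. p \<in> D \<Longrightarrow> (field_in_chart A p \<longlongrightarrow> 0) (at 0)" and z: "Fin z \<notin> D"
  shows "A z = 0"
proof -
  let ?Z = "Fin -` D"
  let ?g = "\<lambda>z. if z \<in> ?Z then 0 else A z"
  have "A holomorphic_on - ?Z"
    using symmetric_square_system_imp_holomorphic[OF system] by (simp add: vimage_def Compl_eq)
  moreover have "(A \<longlongrightarrow> 0) (at w)" if "w \<in> ?Z" for w
  proof -
    have "field_in_chart A (Fin w) = (\<lambda>t. A (w + t))" by (simp add: fun_eq_iff)
    then show ?thesis using zero[of "Fin w"] that by (simp add: LIM_offset_zero_iff)
  qed
  ultimately have holo: "?g holomorphic_on UNIV"
    by (rule holomorphic_extend_by_zero[OF finite_vimage_Fin[OF D(1)]])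
  have "((\<lambda>z. A z / z ^ card ?Z) \<longlongrightarrow> 0) at_infinity"
    by (rule tendsto_field_div_power_at_infinity[OF D riemann system zero])
  moreover have "\<forall>\<^sub>F z in at_infinity. A z / z ^ card ?Z = ?g z / z ^ card ?Z"
  proof -
    have "bounded ?Z" using finite_vimage_Fin[OF D(1)] by (rule finite_imp_bounded)
    then obtain R where "\<And>w. w \<in> ?Z \<Longrightarrow> norm w \<le> R" unfolding bounded_iff by blast
    then show ?thesis unfolding eventually_at_infinity by (intro exI[of _ "R + 1"]) force
  qed
  ultimately have limit: "((\<lambda>z. ?g z / z ^ card ?Z) \<longlongrightarrow> 0) at_infinity"
    by (rule Lim_transform_eventually)
  have "?g z = 0" by (rule entire_eq_0_if_card_zeros[OF holo _ limit]) simp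
  then show ?thesis using z by simp
qed

section \<open>Second order linear equations\<close>

definition ode_lhs ::
  "(complex \<Rightarrow> complex) \<Rightarrow> (complex \<Rightarrow> complex) \<Rightarrow> (complex \<Rightarrow> complex) \<Rightarrow> complex \<Rightarrow> complex" where
  "ode_lhs b1 b2 f w = deriv (deriv f) w + b1 w * deriv f w + b2 w * f w"

lemma ode_lhs_cong:
  assumes "\<forall>\<^sub>F v in nhds w. f v = g v"
  shows "ode_lhs b1 b2 f w = ode_lhs b1 b2 g w"
  using higher_deriv_cong_ev[OF assms refl, of 1] higher_deriv_cong_ev[OF assms refl, of 2]
    eventually_nhds_x_imp_x[OF assms]
  by (simp add: ode_lhs_def numeral_2_eq_2)

lemma ode_lhs_linear:
  assumes "f analytic_on {w}" "g analytic_on {w}"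
  shows "ode_lhs b1 b2 (\<lambda>v. a * f v + b * g v) w = a * ode_lhs b1 b2 f w + b * ode_lhs b1 b2 g w"
proof -
  have "(deriv ^^ n) (\<lambda>v. a * f v + b * g v) w = a * (deriv ^^ n) f w + b * (deriv ^^ n) g w" for n
    using assms by (subst higher_deriv_add_at) (auto intro!: analytic_intros simp: higher_deriv_cmult')
  from this[of 1] this[of 2] show ?thesis
    by (simp add: ode_lhs_def numeral_2_eq_2 algebra_simps)
qed

lemma analytic_ode_lhs:
  assumes "f analytic_on {w}" "b1 analytic_on {w}" "b2 analytic_on {w}"
  shows "ode_lhs b1 b2 f analytic_on {w}"
  unfolding ode_lhs_def using assms by (intro analytic_intros) (auto intro: analytic_deriv)

lemma deriv_compose_reciprocal:
  assumes "f analytic_on {1 / t}" "t \<noteq> 0"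
  shows "deriv (\<lambda>s. f (1 / s)) t = - deriv f (1 / t) / t\<^sup>2"
  using assms by (intro DERIV_imp_deriv DERIV_compose_reciprocal)
    (auto simp: analytic_on_imp_differentiable_at field_differentiable_derivI)

lemma deriv_deriv_compose_reciprocal:
  assumes "f analytic_on {1 / t}" "t \<noteq> 0"
  shows "deriv (deriv (\<lambda>s. f (1 / s))) t = deriv (deriv f) (1 / t) / t ^ 4 + 2 * deriv f (1 / t) / t ^ 3"
proof -
  obtain S where S: "open S" "1 / t \<in> S" "f holomorphic_on S"
    using assms(1) analytic_at by blast
  have "isCont (\<lambda>s. 1 / s) t" using assms(2) by (intro continuous_intros)
  then have "((\<lambda>s. 1 / s) \<longlongrightarrow> 1 / t) (nhds t)"
    unfolding isCont_def using tendsto_at_iff_tendsto_nhds[of "\<lambda>s. 1 / s" t] by simp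
  moreover have "\<forall>\<^sub>F w in nhds (1 / t). f analytic_on {w}"
    by (rule eventually_mono[OF eventually_nhds_in_open[OF S(1,2)]]) (use S analytic_at in blast)
  ultimately have "\<forall>\<^sub>F s in nhds t. f analytic_on {1 / s}" by (rule eventually_compose_filterlim[rotated])
  with t1_space_nhds[OF assms(2)]
  have "\<forall>\<^sub>F s in nhds t. deriv (\<lambda>s. f (1 / s)) s = - deriv f (1 / s) / s\<^sup>2"
    by eventually_elim (rule deriv_compose_reciprocal)
  from deriv_cong_ev[OF this refl]
  have "deriv (deriv (\<lambda>s. f (1 / s))) t = deriv (\<lambda>s. - deriv f (1 / s) / s\<^sup>2) t" .
  also have "\<dots> = deriv (deriv f) (1 / t) / t ^ 4 + 2 * deriv f (1 / t) / t ^ 3"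
  proof (rule DERIV_imp_deriv)
    have "(deriv f has_field_derivative deriv (deriv f) (1 / t)) (at (1 / t))"
      using analytic_deriv[OF assms(1)]
      by (simp add: analytic_on_imp_differentiable_at field_differentiable_derivI)
    note outer = DERIV_compose_reciprocal[OF this assms(2)]
    show "((\<lambda>s. - deriv f (1 / s) / s\<^sup>2) has_field_derivative
        deriv (deriv f) (1 / t) / t ^ 4 + 2 * deriv f (1 / t) / t ^ 3) (at t)"
      by (rule DERIV_cong[OF DERIV_divide[OF DERIV_minus[OF outer] DERIV_power[OF DERIV_ident]]])
        (use assms(2) in \<open>simp_all add: field_simps eval_nat_numeral\<close>)
  qed
  finally show ?thesis .
qed

lemma ode_in_chart_iff:
  fixes y :: "cp1 \<Rightarrow> complex"
  assumes "analytic_at_cp1 y (chart p t)" "t \<noteq> 0"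
  defines "u \<equiv> y \<circ> chart p"
  shows "deriv (deriv u) t + coeff1 b1 p t * deriv u t + coeff2 b2 p t * u t = 0 \<longleftrightarrow>
    ode_lhs b1 b2 (\<lambda>w. y (Fin w)) (affine_coord p t) = 0"
proof (cases p)
  case (Fin c)
  have shift: "deriv (\<lambda>t. f (c + t)) = (\<lambda>t. deriv f (c + t))" for f :: "complex \<Rightarrow> complex"
    by (simp add: fun_eq_iff deriv_def DERIV_shift[of f _ _ c, symmetric] add.commute)
  have "u = (\<lambda>t. y (Fin (c + t)))" using Fin by (simp add: u_def fun_eq_iff)
  then show ?thesis
    using Fin shift[of "\<lambda>w. y (Fin w)"] shift[of "deriv (\<lambda>w. y (Fin w))"] by (simp add: ode_lhs_def)
next
  case Infty
  let ?Y = "\<lambda>w. y (Fin w)"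
  have near: "\<forall>\<^sub>F s in nhds t. u s = ?Y (1 / s)"
    using t1_space_nhds[OF assms(2)] by eventually_elim (simp add: u_def Infty)
  have Y_analytic: "?Y analytic_on {1 / t}" using assms Infty by (simp add: analytic_at_Fin)
  have first: "deriv u t = - deriv ?Y (1 / t) / t\<^sup>2"
    using higher_deriv_cong_ev[OF near refl, of 1] deriv_compose_reciprocal[OF Y_analytic assms(2)] by simp
  have second: "deriv (deriv u) t = deriv (deriv ?Y) (1 / t) / t ^ 4 + 2 * deriv ?Y (1 / t) / t ^ 3"
    using higher_deriv_cong_ev[OF near refl, of 2] deriv_deriv_compose_reciprocal[OF Y_analytic assms(2)]
    by (simp add: numeral_2_eq_2)
  have "deriv (deriv u) t + coeff1 b1 p t * deriv u t + coeff2 b2 p t * u t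
      = ode_lhs b1 b2 ?Y (1 / t) / t ^ 4"
    unfolding first second eventually_nhds_x_imp_x[OF near] ode_lhs_def Infty coeff1.simps coeff2.simps
    using assms(2) by (simp add: field_simps eval_nat_numeral)
  then show ?thesis using assms(2) Infty by simp
qed

text \<open>The centre \<open>p\<close> is left out here, which makes the condition meaningful at infinity, too.\<close>

definition ode_near :: "(complex \<Rightarrow> complex) \<Rightarrow> (complex \<Rightarrow> complex) \<Rightarrow> cp1 \<Rightarrow> (cp1 \<Rightarrow> complex) \<Rightarrow> bool" where
  "ode_near b1 b2 p y \<longleftrightarrow>
     (\<forall>\<^sub>F q in nhds p. q \<noteq> p \<longrightarrow> (\<forall>w. q = Fin w \<longrightarrow> ode_lhs b1 b2 (\<lambda>w. y (Fin w)) w = 0))"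

lemma ode_near_chart:
  "ode_near b1 b2 (chart p t) y \<longleftrightarrow>
    (\<forall>\<^sub>F s in at t. ode_lhs b1 b2 (\<lambda>w. y (Fin w)) (affine_coord p s) = 0)"
proof -
  have "ode_near b1 b2 (chart p t) y \<longleftrightarrow>
      (\<forall>\<^sub>F s in at t. \<forall>w. chart p s = Fin w \<longrightarrow> ode_lhs b1 b2 (\<lambda>w. y (Fin w)) w = 0)"
    unfolding ode_near_def nhds_chart eventually_filtermap eventually_at_filter
    by (simp add: inj_eq[OF inj_chart])
  also have "\<dots> \<longleftrightarrow> (\<forall>\<^sub>F s in at t. ode_lhs b1 b2 (\<lambda>w. y (Fin w)) (affine_coord p s) = 0)"
    by (rule eventually_cong[OF eventually_neq_at_within[of 0]]) (simp add: chart_eq_Fin)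
  finally show ?thesis .
qed

lemma solution_near_iff:
  "solution_near b1 b2 p y \<longleftrightarrow> analytic_at_cp1 y p \<and> ode_near b1 b2 p y"
proof (cases "analytic_at_cp1 y p")
  case True
  let ?u = "y \<circ> chart p"
  have "\<forall>\<^sub>F t in nhds 0. analytic_at_cp1 y (chart p t)"
    using eventually_analytic_at_cp1[OF True] unfolding nhds_cp1 eventually_filtermap .
  then have "\<forall>\<^sub>F t in at 0. (deriv (deriv ?u) t + coeff1 b1 p t * deriv ?u t + coeff2 b2 p t * ?u t = 0) =
      (ode_lhs b1 b2 (\<lambda>w. y (Fin w)) (affine_coord p t) = 0)"
    unfolding eventually_at_filter by eventually_elim (use ode_in_chart_iff in blast)
  then have "(\<forall>\<^sub>F t in at 0. deriv (deriv ?u) t + coeff1 b1 p t * deriv ?u t + coeff2 b2 p t * ?u t = 0) =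
      (\<forall>\<^sub>F t in at 0. ode_lhs b1 b2 (\<lambda>w. y (Fin w)) (affine_coord p t) = 0)"
    by (rule eventually_cong)
  then show ?thesis
    using True ode_near_chart[of b1 b2 p 0 y] by (simp add: solution_near_def Let_def)
qed (simp add: solution_near_def)

lemma ode_near_cong:
  assumes "\<forall>\<^sub>F q in nhds p. y q = y' q"
  shows "ode_near b1 b2 p y \<longleftrightarrow> ode_near b1 b2 p y'"
proof -
  have "\<forall>\<^sub>F q in nhds p. \<forall>\<^sub>F r in nhds q. y r = y' r"
    using assms by (simp add: eventually_eventually)
  then have "\<forall>\<^sub>F q in nhds p. \<forall>w. q = Fin w \<longrightarrow>
      ode_lhs b1 b2 (\<lambda>w. y (Fin w)) w = ode_lhs b1 b2 (\<lambda>w. y' (Fin w)) w"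
    by eventually_elim (auto simp: nhds_Fin eventually_filtermap intro: ode_lhs_cong)
  then show ?thesis unfolding ode_near_def by (rule eventually_cong) auto
qed

lemma solution_near_linear:
  assumes "solution_near b1 b2 p y1" "solution_near b1 b2 p y2"
  shows "solution_near b1 b2 p (\<lambda>q. a * y1 q + b * y2 q)"
proof -
  have analytic: "analytic_at_cp1 y1 p" "analytic_at_cp1 y2 p"
    and ode: "ode_near b1 b2 p y1" "ode_near b1 b2 p y2"
    using assms by (auto simp: solution_near_iff)
  have "ode_near b1 b2 p (\<lambda>q. a * y1 q + b * y2 q)"
    using eventually_analytic_at_cp1[OF analytic(1)] eventually_analytic_at_cp1[OF analytic(2)] ode
    unfolding ode_near_def
    by eventually_elim (auto simp: analytic_at_Fin ode_lhs_linear)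
  then show ?thesis using analytic by (auto simp: solution_near_iff intro!: analytic_at_cp1_intros)
qed

lemma solution_near_matrix:
  fixes Y :: "cp1 \<Rightarrow> complex^2" and M :: "complex^2^2"
  assumes "\<And>j. solution_near b1 b2 p (\<lambda>q. Y q $ j)"
  shows "solution_near b1 b2 p (\<lambda>q. (Y q v* M) $ j)"
  unfolding vector_matrix_mult_2 by (intro solution_near_linear assms)

section \<open>The Wronskian\<close>

definition solves_ode_on ::
  "(complex \<Rightarrow> complex) \<Rightarrow> (complex \<Rightarrow> complex) \<Rightarrow> complex set \<Rightarrow> (complex \<Rightarrow> complex) \<Rightarrow> bool" where
  "solves_ode_on b1 b2 S f \<longleftrightarrow> (\<forall>w\<in>S. (f has_field_derivative deriv f w) (at w) \<and>
     (deriv f has_field_derivative - b1 w * deriv f w - b2 w * f w) (at w))"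

lemma solves_ode_onD:
  assumes "solves_ode_on b1 b2 S f" "w \<in> S"
  shows "(f has_field_derivative deriv f w) (at w)"
    and "(deriv f has_field_derivative - b1 w * deriv f w - b2 w * f w) (at w)"
  using assms by (auto simp: solves_ode_on_def)

lemma solves_ode_on_subset: "solves_ode_on b1 b2 S f \<Longrightarrow> T \<subseteq> S \<Longrightarrow> solves_ode_on b1 b2 T f"
  by (auto simp: solves_ode_on_def)

lemma solves_ode_on_imp_holomorphic: "solves_ode_on b1 b2 S f \<Longrightarrow> f holomorphic_on S"
  unfolding holomorphic_on_def field_differentiable_def
  by (blast dest: solves_ode_onD(1) intro: has_field_derivative_at_within)

definition wronskian :: "(complex \<Rightarrow> complex) \<Rightarrow> (complex \<Rightarrow> complex) \<Rightarrow> complex \<Rightarrow> complex" where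
  "wronskian f g w = f w * deriv g w - g w * deriv f w"

lemma DERIV_wronskian:
  assumes "solves_ode_on b1 b2 S f" "solves_ode_on b1 b2 S g" "w \<in> S"
  shows "(wronskian f g has_field_derivative - b1 w * wronskian f g w) (at w)"
  unfolding wronskian_def
  by (rule derivative_eq_intros refl solves_ode_onD[OF assms(1,3)] solves_ode_onD[OF assms(2,3)])+
    (simp add: algebra_simps)

lemma wronskian_zero_or_nonzero:
  assumes S: "open S" "convex S" and b1_holo: "b1 holomorphic_on S"
    and solutions: "solves_ode_on b1 b2 S f" "solves_ode_on b1 b2 S g"
    and "z \<in> S" "w \<in> S" "wronskian f g z = 0"
  shows "wronskian f g w = 0"
proof -
  obtain K where "\<And>w. w \<in> S \<Longrightarrow> (K has_field_derivative b1 w) (at w within S)"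
    using holomorphic_convex_primitive'[OF S(2,1) b1_holo] by blast
  then have K_deriv: "(K has_field_derivative b1 w) (at w)" if "w \<in> S" for w
    using that S(1) by (metis at_within_open)
  have "\<exists>k. \<forall>w\<in>S. wronskian f g w * exp (K w) = k"
  proof (rule has_field_derivative_zero_constant[OF S(2)])
    fix w assume w: "w \<in> S"
    have "((\<lambda>w. wronskian f g w * exp (K w)) has_field_derivative
       (- b1 w * wronskian f g w) * exp (K w) + (exp (K w) * b1 w) * wronskian f g w) (at w)"
      by (rule DERIV_mult[OF DERIV_wronskian[OF solutions w] DERIV_fun_exp[OF K_deriv[OF w]]])
    then show "((\<lambda>w. wronskian f g w * exp (K w)) has_field_derivative 0) (at w within S)"
      by (simp add: algebra_simps has_field_derivative_at_within)
  qed
  then obtain k where k: "\<And>w. w \<in> S \<Longrightarrow> wronskian f g w * exp (K w) = k" by blast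
  have "k = 0" using k[OF \<open>z \<in> S\<close>] assms(8) by simp
  then show ?thesis using k[OF \<open>w \<in> S\<close>] by simp
qed

lemma wronskian_zero_imp_dependent:
  assumes S: "open S" "connected S" and holo: "f holomorphic_on S" "g holomorphic_on S"
    and wronskian_0: "\<And>w. w \<in> S \<Longrightarrow> wronskian f g w = 0"
  obtains a b where "a \<noteq> 0 \<or> b \<noteq> 0" "\<And>w. w \<in> S \<Longrightarrow> a * f w + b * g w = 0"
proof (cases "\<forall>w\<in>S. f w = 0")
  case True
  then show ?thesis using that[of 1 0] by simp
next
  case False
  then obtain v where v: "v \<in> S" "f v \<noteq> 0" by blast
  have f_deriv: "(f has_field_derivative deriv f w) (at w)" and g_deriv: "(g has_field_derivative deriv g w) (at w)"
    if "w \<in> S" for w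
    using holo S(1) that holomorphic_derivI by blast+
  obtain e1 where e1: "e1 > 0" "\<And>w. dist v w < e1 \<Longrightarrow> f w \<noteq> 0"
    using continuous_at_avoid[OF DERIV_isCont[OF f_deriv[OF v(1)]] v(2)] by blast
  obtain e2 where e2: "e2 > 0" "ball v e2 \<subseteq> S" using S(1) v(1) open_contains_ball by blast
  define e where "e = min e1 e2"
  have e: "e > 0" "ball v e \<subseteq> S" "\<And>w. w \<in> ball v e \<Longrightarrow> f w \<noteq> 0"
    using e1 e2 by (auto simp: e_def subset_iff)
  have "\<exists>k. \<forall>w\<in>ball v e. g w / f w = k"
  proof (rule has_field_derivative_zero_constant[OF convex_ball])
    fix w assume w: "w \<in> ball v e"
    then have "w \<in> S" using e(2) by blast
    have "((\<lambda>w. g w / f w) has_field_derivative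
        (deriv g w * f w - g w * deriv f w) / (f w * f w)) (at w)"
      by (rule DERIV_divide[OF g_deriv[OF \<open>w \<in> S\<close>] f_deriv[OF \<open>w \<in> S\<close>] e(3)[OF w]])
    then show "((\<lambda>w. g w / f w) has_field_derivative 0) (at w within ball v e)"
      using wronskian_0[OF \<open>w \<in> S\<close>] by (simp add: wronskian_def mult.commute has_field_derivative_at_within)
  qed
  then obtain k where k: "\<And>w. w \<in> ball v e \<Longrightarrow> g w / f w = k" by blast
  have "- k * f w + 1 * g w = 0" if "w \<in> S" for w
    by (rule analytic_continuation_open[of "ball v e" S "\<lambda>w. - k * f w + 1 * g w" "\<lambda>_. 0"])
      (use S e that k in \<open>auto intro!: holomorphic_intros holo simp: field_simps\<close>)
  then show ?thesis using that[of "- k" 1] by simp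
qed

definition fundamental_system_on ::
  "(complex \<Rightarrow> complex) \<Rightarrow> (complex \<Rightarrow> complex) \<Rightarrow> complex set \<Rightarrow>
   (complex \<Rightarrow> complex) \<Rightarrow> (complex \<Rightarrow> complex) \<Rightarrow> bool" where
  "fundamental_system_on b1 b2 S f g \<longleftrightarrow>
     solves_ode_on b1 b2 S f \<and> solves_ode_on b1 b2 S g \<and> (\<forall>w\<in>S. wronskian f g w \<noteq> 0)"

lemma fundamental_system_on_subset:
  "fundamental_system_on b1 b2 S f g \<Longrightarrow> T \<subseteq> S \<Longrightarrow> fundamental_system_on b1 b2 T f g"
  by (auto simp: fundamental_system_on_def intro: solves_ode_on_subset)

text \<open>The coefficients are given by Cramer's rule as quotients of Wronskians.\<close>

lemma fundamental_system_spans: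
  assumes system: "fundamental_system_on b1 b2 S f g" and y_solves: "solves_ode_on b1 b2 S y" and "convex S"
  obtains a b where "\<And>w. w \<in> S \<Longrightarrow> y w = a * f w + b * g w"
proof -
  have solutions: "solves_ode_on b1 b2 S f" "solves_ode_on b1 b2 S g"
    and wronskian_nz: "\<And>w. w \<in> S \<Longrightarrow> wronskian f g w \<noteq> 0"
    using system by (auto simp: fundamental_system_on_def)
  have quotient: "\<exists>k. \<forall>w\<in>S. wronskian h1 h2 w / wronskian f g w = k"
    if "solves_ode_on b1 b2 S h1" "solves_ode_on b1 b2 S h2" for h1 h2
  proof (rule has_field_derivative_zero_constant[OF \<open>convex S\<close>])
    fix w assume w: "w \<in> S"
    have "((\<lambda>w. wronskian h1 h2 w / wronskian f g w) has_field_derivative 0) (at w)"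
      by (rule DERIV_cong[OF DERIV_divide[OF DERIV_wronskian[OF that w] DERIV_wronskian[OF solutions w] wronskian_nz[OF w]]])
        simp
    then show "((\<lambda>w. wronskian h1 h2 w / wronskian f g w) has_field_derivative 0) (at w within S)"
      by (rule has_field_derivative_at_within)
  qed
  obtain a b where a: "\<And>w. w \<in> S \<Longrightarrow> wronskian y g w / wronskian f g w = a"
    and b_const: "\<And>w. w \<in> S \<Longrightarrow> wronskian f y w / wronskian f g w = b"
    using quotient[OF y_solves solutions(2)] quotient[OF solutions(1) y_solves] by blast
  show ?thesis
  proof (rule that[of a b])
    fix w assume w: "w \<in> S"
    have "y w * wronskian f g w = wronskian y g w * f w + wronskian f y w * g w"
      by (simp add: wronskian_def algebra_simps)
    also have "\<dots> = (a * f w + b * g w) * wronskian f g w"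
      using wronskian_nz[OF w] by (simp add: a[OF w, symmetric] b_const[OF w, symmetric] field_simps)
    finally show "y w = a * f w + b * g w" using wronskian_nz[OF w] by simp
  qed
qed

abbreviation affine_comp :: "(cp1 \<Rightarrow> complex^2) \<Rightarrow> 2 \<Rightarrow> complex \<Rightarrow> complex" where
  "affine_comp f j w \<equiv> f (Fin w) $ j"

lemma wronskian_nonzero_imp_independent_near:
  assumes "\<And>j. analytic_at_cp1 (\<lambda>q. f q $ j) (Fin z)"
    and "wronskian (affine_comp f 1) (affine_comp f 2) z \<noteq> 0"
  shows "independent_near (Fin z) f"
  unfolding independent_near_def
proof (intro allI impI)
  fix c :: "complex^2"
  assume "\<forall>\<^sub>F q in nhds (Fin z). (\<Sum>j\<in>UNIV. c $ j * f q $ j) = 0"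
  then have relation: "\<forall>\<^sub>F w in nhds z. c $ 1 * affine_comp f 1 w + c $ 2 * affine_comp f 2 w = 0"
    by (simp add: nhds_Fin eventually_filtermap sum_2)
  have f_deriv: "(affine_comp f j has_field_derivative deriv (affine_comp f j) z) (at z)" for j
    using assms(1)[of j] unfolding analytic_at_Fin
    by (simp add: analytic_on_imp_differentiable_at field_differentiable_derivI)
  have "((\<lambda>w. c $ 1 * affine_comp f 1 w + c $ 2 * affine_comp f 2 w) has_field_derivative
      c $ 1 * deriv (affine_comp f 1) z + c $ 2 * deriv (affine_comp f 2) z) (at z)"
    by (intro DERIV_add DERIV_cmult f_deriv)
  moreover have "((\<lambda>w. c $ 1 * affine_comp f 1 w + c $ 2 * affine_comp f 2 w) has_field_derivative 0) (at z)"
    using DERIV_cong_ev[OF refl relation refl, of 0] by simp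
  ultimately have deriv_relation: "c $ 1 * deriv (affine_comp f 1) z + c $ 2 * deriv (affine_comp f 2) z = 0"
      "c $ 1 * affine_comp f 1 z + c $ 2 * affine_comp f 2 z = 0"
    using DERIV_unique eventually_nhds_x_imp_x[OF relation] by blast+
  have "c $ 1 * wronskian (affine_comp f 1) (affine_comp f 2) z
      = (c $ 1 * affine_comp f 1 z + c $ 2 * affine_comp f 2 z) * deriv (affine_comp f 2) z
        - (c $ 1 * deriv (affine_comp f 1) z + c $ 2 * deriv (affine_comp f 2) z) * affine_comp f 2 z"
    by (simp add: wronskian_def algebra_simps)
  moreover have "c $ 2 * wronskian (affine_comp f 1) (affine_comp f 2) z
      = (c $ 1 * deriv (affine_comp f 1) z + c $ 2 * deriv (affine_comp f 2) z) * affine_comp f 1 z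
        - (c $ 1 * affine_comp f 1 z + c $ 2 * affine_comp f 2 z) * deriv (affine_comp f 1) z"
    by (simp add: wronskian_def algebra_simps)
  ultimately have "c $ 1 = 0" "c $ 2 = 0" using assms(2) unfolding deriv_relation by simp_all
  then show "c = 0" by (simp add: vec_eq_iff forall_2)
qed

lemma independent_near_imp_wronskian_nonzero:
  assumes "open S" "convex S" "z \<in> S" "b1 holomorphic_on S"
    and solutions: "\<And>j. solves_ode_on b1 b2 S (affine_comp f j)"
    and "independent_near (Fin z) f"
  shows "wronskian (affine_comp f 1) (affine_comp f 2) z \<noteq> 0"
proof
  assume "wronskian (affine_comp f 1) (affine_comp f 2) z = 0"
  then have "wronskian (affine_comp f 1) (affine_comp f 2) w = 0" if "w \<in> S" for w
    using wronskian_zero_or_nonzero[OF assms(1,2,4) solutions solutions assms(3) that] by blast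
  then obtain a b where ab: "a \<noteq> 0 \<or> b \<noteq> 0" "\<And>w. w \<in> S \<Longrightarrow> a * affine_comp f 1 w + b * affine_comp f 2 w = 0"
    using wronskian_zero_imp_dependent[OF assms(1) convex_connected[OF assms(2)]
        solutions[THEN solves_ode_on_imp_holomorphic] solutions[THEN solves_ode_on_imp_holomorphic]] by metis
  have "\<forall>\<^sub>F q in nhds (Fin z). (\<Sum>j\<in>UNIV. (vector [a, b] :: complex^2) $ j * f q $ j) = 0"
    unfolding nhds_Fin eventually_filtermap
    by (rule eventually_mono[OF eventually_nhds_in_open[OF assms(1,3)]]) (simp add: sum_2 ab(2))
  then have "(vector [a, b] :: complex^2) = 0" using assms(6) unfolding independent_near_def by blast
  then show False using ab(1) by (simp add: vec_eq_iff forall_2)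
qed

section \<open>Solutions of Riemann equations\<close>

locale riemann_ode =
  fixes D :: "cp1 set" and b1 b2 :: "complex \<Rightarrow> complex"
  assumes finite_D: "finite D" and riemann: "riemann_equation D b1 b2"
begin

lemma coefficients_holomorphic:
  "b1 holomorphic_on {w. Fin w \<notin> D}" "b2 holomorphic_on {w. Fin w \<notin> D}"
  using riemann by (auto simp: riemann_equation_def)

lemma coefficients_analytic:
  assumes "Fin w \<notin> D"
  shows "b1 analytic_on {w}" "b2 analytic_on {w}"
  using coefficients_holomorphic open_affine_part[OF finite_D] assms
  by (auto simp: analytic_on_open[symmetric] intro: analytic_on_subset)

lemma eventually_notin_D: "p \<notin> D \<Longrightarrow> \<forall>\<^sub>F q in nhds p. q \<notin> D"
  using finite_D eventually_nhds_in_open[of "- D" p] by (simp add: finite_imp_closed open_Compl)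

lemma ode_lhs_in_chart_holomorphic:
  assumes y_holo: "(y \<circ> chart p) holomorphic_on ball 0 e" and avoids_D: "\<And>t. t \<in> ball 0 e \<Longrightarrow> chart p t \<notin> D"
  shows "(\<lambda>t. ode_lhs b1 b2 (\<lambda>w. y (Fin w)) (affine_coord p t)) holomorphic_on ball 0 e - {0}"
proof -
  have "(\<lambda>t. ode_lhs b1 b2 (\<lambda>w. y (Fin w)) (affine_coord p t)) analytic_on {t}" if t: "t \<in> ball 0 e - {0}" for t
  proof -
    let ?w = "affine_coord p t"
    have w: "chart p t = Fin ?w" using t by (simp add: chart_eq_Fin)
    have "(y \<circ> chart p) analytic_on ball 0 e" using y_holo by (simp add: analytic_on_open)
    then have "analytic_at_cp1 y (chart p t)" using t by (auto simp: analytic_at_chart intro: analytic_on_subset)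
    then have "(\<lambda>w. y (Fin w)) analytic_on {?w}" by (simp add: w analytic_at_Fin)
    moreover have "Fin ?w \<notin> D" using avoids_D[of t] t w by simp
    ultimately have "ode_lhs b1 b2 (\<lambda>w. y (Fin w)) analytic_on affine_coord p ` {t}"
      using analytic_ode_lhs coefficients_analytic by simp
    from analytic_on_compose[OF analytic_on_affine_coord this] show ?thesis using t by (simp add: o_def)
  qed
  then show ?thesis by (meson analytic_imp_holomorphic analytic_on_analytic_at)
qed

lemma eventually_ode_near_iff:
  assumes "p \<notin> D" and y_analytic: "analytic_at_cp1 y p"
  shows "\<forall>\<^sub>F q in nhds p. ode_near b1 b2 q y = ode_near b1 b2 p y"
proof -
  obtain e1 where e1: "e1 > 0" "(y \<circ> chart p) holomorphic_on ball 0 e1"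
    using y_analytic unfolding analytic_at_cp1_def analytic_at_ball by blast
  obtain e2 where e2: "e2 > 0" "\<And>t. t \<in> ball 0 e2 \<Longrightarrow> chart p t \<notin> D"
    using chart_ball[OF finite_D assms(1)] by blast
  define e where "e = min e1 e2"
  let ?S = "ball (0::complex) e - {0}" and ?E = "\<lambda>t. ode_lhs b1 b2 (\<lambda>w. y (Fin w)) (affine_coord p t)"
  have e: "e > 0" using e1(1) e2(1) by (simp add: e_def)
  have holo: "?E holomorphic_on ?S"
  proof (rule ode_lhs_in_chart_holomorphic)
    show "(y \<circ> chart p) holomorphic_on ball 0 e" using e1(2) by (rule holomorphic_on_subset) (auto simp: e_def)
    show "chart p t \<notin> D" if "t \<in> ball 0 e" for t using that by (intro e2(2)) (simp add: e_def)
  qed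
  have S: "open ?S" "connected ?S" by (auto intro: connected_punctured_ball)
  have iff: "ode_near b1 b2 (chart p t) y \<longleftrightarrow> (\<forall>s\<in>?S. ?E s = 0)" if t: "t \<in> ball 0 e" for t
    unfolding ode_near_chart
  proof
    have in_S: "\<forall>\<^sub>F s in at t. s \<in> ?S"
      using eventually_at_in_open'[OF open_ball t] eventually_neq_at_within[of 0 t UNIV]
      by eventually_elim simp
    then have "t islimpt ?S" unfolding islimpt_iff_eventually
      using eventually_happens[of _ "at t"] by (auto simp: eventually_conj_iff dest: eventually_conj)
    then show "\<forall>s\<in>?S. ?E s = 0" if "\<forall>\<^sub>F s in at t. ?E s = 0"
      using identity_theorem_at[OF holo S _ that] by blast
    show "\<forall>\<^sub>F s in at t. ?E s = 0" if "\<forall>s\<in>?S. ?E s = 0"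
      using in_S by eventually_elim (use that in blast)
  qed
  show ?thesis
    by (rule eventually_nhds_chart_ball[OF e]) (use iff iff[of 0] e in auto)
qed

lemma locally_constant_property_ode_near:
  "locally_constant_property (- D) (\<lambda>p f. ode_near b1 b2 p (\<lambda>q. f q $ j))"
  unfolding locally_constant_property_def
proof (intro conjI allI ballI impI)
  show "ode_near b1 b2 p (\<lambda>q. g q $ j)"
    if "\<forall>\<^sub>F q in nhds p. f q = g q" "ode_near b1 b2 p (\<lambda>q. f q $ j)" for p and f g :: "cp1 \<Rightarrow> complex^2"
  proof -
    have "\<forall>\<^sub>F q in nhds p. f q $ j = g q $ j" using that(1) by eventually_elim simp
    from ode_near_cong[OF this] show ?thesis using that(2) by simp
  qed
qed (use eventually_ode_near_iff in auto)

lemma eventually_solution_near: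
  assumes "p \<notin> D" "solution_near b1 b2 p y"
  shows "\<forall>\<^sub>F q in nhds p. solution_near b1 b2 q y"
proof -
  have y_conds: "analytic_at_cp1 y p" "ode_near b1 b2 p y" using assms(2) by (auto simp: solution_near_iff)
  show ?thesis
    using eventually_analytic_at_cp1[OF y_conds(1)] eventually_ode_near_iff[OF assms(1) y_conds(1)]
    by eventually_elim (simp add: solution_near_iff y_conds(2))
qed

lemma solution_near_imp_solves_ode_on_ball:
  assumes "Fin z \<notin> D" and y: "solution_near b1 b2 (Fin z) y"
  obtains d where "d > 0" "ball z d \<subseteq> {w. Fin w \<notin> D}" "solves_ode_on b1 b2 (ball z d) (\<lambda>w. y (Fin w))"
proof -
  let ?Y = "\<lambda>w. y (Fin w)"
  have analytic: "?Y analytic_on {z}" and ode: "ode_near b1 b2 (Fin z) y"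
    using y by (auto simp: solution_near_iff analytic_at_Fin)
  obtain d1 where d1: "d1 > 0" "?Y holomorphic_on ball z d1" using analytic analytic_at_ball by blast
  obtain d2 where d2: "d2 > 0" "ball z d2 \<subseteq> {w. Fin w \<notin> D}"
    using open_affine_part[OF finite_D] assms(1) open_contains_ball by blast
  define d where "d = min d1 d2"
  have d: "d > 0" "ball z d \<subseteq> {w. Fin w \<notin> D}" using d1(1) d2 by (auto simp: d_def)
  have holo: "?Y holomorphic_on ball z d" using d1(2) by (rule holomorphic_on_subset) (auto simp: d_def)
  have "b1 holomorphic_on ball z d" "b2 holomorphic_on ball z d"
    using coefficients_holomorphic d(2) by (auto intro: holomorphic_on_subset)
  then have holo_lhs: "ode_lhs b1 b2 ?Y holomorphic_on ball z d"
    unfolding ode_lhs_def by (intro holomorphic_intros holomorphic_deriv holo open_ball)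
  have "ode_lhs b1 b2 ?Y w = 0" if w: "w \<in> ball z d" for w
  proof (rule identity_theorem_at[OF holo_lhs open_ball connected_ball _ _ w])
    show "z islimpt ball z d" using d(1) by (simp add: open_imp_islimpt)
    show "\<forall>\<^sub>F w in at z. ode_lhs b1 b2 ?Y w = 0"
      using ode ode_near_chart[of b1 b2 "Fin 0" z y] by (simp add: chart_Fin_0)
  qed
  then have "solves_ode_on b1 b2 (ball z d) ?Y"
    unfolding solves_ode_on_def
    by (auto simp: ode_lhs_def algebra_simps eq_neg_iff_add_eq_0
        intro!: holomorphic_derivI[OF holo] DERIV_cong[OF holomorphic_derivI[OF holomorphic_deriv[OF holo]]])
  with d show ?thesis by (rule that)
qed

lemma fundamental_system_on_ball:
  assumes "Fin z \<notin> D" "\<And>j. solution_near b1 b2 (Fin z) (\<lambda>q. f q $ j)" "independent_near (Fin z) f"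
  obtains d where "d > 0" "ball z d \<subseteq> {w. Fin w \<notin> D}"
    "fundamental_system_on b1 b2 (ball z d) (affine_comp f 1) (affine_comp f 2)"
proof -
  obtain d1 where d1: "d1 > 0" "ball z d1 \<subseteq> {w. Fin w \<notin> D}" "solves_ode_on b1 b2 (ball z d1) (affine_comp f 1)"
    using solution_near_imp_solves_ode_on_ball[OF assms(1,2)] by blast
  obtain d2 where d2: "d2 > 0" "ball z d2 \<subseteq> {w. Fin w \<notin> D}" "solves_ode_on b1 b2 (ball z d2) (affine_comp f 2)"
    using solution_near_imp_solves_ode_on_ball[OF assms(1,2)] by blast
  define d where "d = min d1 d2"
  have d: "d > 0" "ball z d \<subseteq> {w. Fin w \<notin> D}" using d1 d2 by (auto simp: d_def)
  have "solves_ode_on b1 b2 (ball z d) (affine_comp f 1)" "solves_ode_on b1 b2 (ball z d) (affine_comp f 2)"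
    using d1(3) d2(3) by (auto intro: solves_ode_on_subset simp: d_def)
  then have solves: "solves_ode_on b1 b2 (ball z d) (affine_comp f j)" for j using exhaust_2[of j] by auto
  have b1_holo: "b1 holomorphic_on ball z d" using coefficients_holomorphic(1) d(2) by (rule holomorphic_on_subset)
  have "z \<in> ball z d" using d(1) by simp
  then have "wronskian (affine_comp f 1) (affine_comp f 2) z \<noteq> 0"
    by (rule independent_near_imp_wronskian_nonzero[OF open_ball convex_ball _ b1_holo solves assms(3)])
  then have "wronskian (affine_comp f 1) (affine_comp f 2) w \<noteq> 0" if "w \<in> ball z d" for w
    using wronskian_zero_or_nonzero[OF open_ball convex_ball b1_holo solves solves that \<open>z \<in> ball z d\<close>] by blast
  with solves have "fundamental_system_on b1 b2 (ball z d) (affine_comp f 1) (affine_comp f 2)"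
    by (simp add: fundamental_system_on_def)
  with d show ?thesis by (rule that)
qed

end

lemma eventually_nhds_affine_point:
  assumes "\<forall>\<^sub>F q in nhds p. Q q" "e > 0"
  obtains t where "t \<noteq> 0" "t \<in> ball 0 e" "Q (chart p t)"
proof -
  have "\<forall>\<^sub>F t in nhds 0. Q (chart p t)" using assms(1) unfolding nhds_cp1 eventually_filtermap .
  moreover have "\<forall>\<^sub>F t in nhds 0. t \<in> ball (0::complex) e"
    using assms(2) by (intro eventually_nhds_in_open) auto
  ultimately have "\<forall>\<^sub>F t in at 0. t \<noteq> 0 \<and> t \<in> ball 0 e \<and> Q (chart p t)"
    unfolding eventually_at_filter by eventually_elim simp
  then obtain t where "t \<noteq> 0 \<and> t \<in> ball 0 e \<and> Q (chart p t)"
    using eventually_happens[of _ "at (0::complex)"] by auto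
  then show ?thesis using that by blast
qed

lemma solution_basis_iff:
  "solution_basis b1 b2 p Y \<longleftrightarrow>
     (\<forall>j. solution_near b1 b2 p (\<lambda>q. Y q $ j)) \<and> independent_near p Y \<and>
     (\<forall>y. solution_near b1 b2 p y \<longrightarrow>
        (\<exists>c :: complex^2. \<forall>\<^sub>F q in nhds p. y q = (\<Sum>j\<in>UNIV. c $ j * Y q $ j)))"
  unfolding solution_basis_def independent_near_def ..

context riemann_ode
begin

lemma independent_solutions_span_at_affine_point:
  assumes w: "Fin w \<notin> D" and Y: "\<And>j. solution_near b1 b2 (Fin w) (\<lambda>q. Y q $ j)" "independent_near (Fin w) Y"
    and y: "solution_near b1 b2 (Fin w) y"
  obtains a b where "\<forall>\<^sub>F q in nhds (Fin w). y q = a * Y q $ 1 + b * Y q $ 2"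
proof -
  obtain d1 where d1: "d1 > 0" "fundamental_system_on b1 b2 (ball w d1) (affine_comp Y 1) (affine_comp Y 2)"
    using fundamental_system_on_ball[OF w Y] by blast
  obtain d2 where d2: "d2 > 0" "solves_ode_on b1 b2 (ball w d2) (\<lambda>w. y (Fin w))"
    using solution_near_imp_solves_ode_on_ball[OF w y] by blast
  define d where "d = min d1 d2"
  have "d > 0" "ball w d \<subseteq> ball w d1" "ball w d \<subseteq> ball w d2" using d1(1) d2(1) by (auto simp: d_def)
  obtain a b where ab: "\<And>v. v \<in> ball w d \<Longrightarrow> y (Fin v) = a * affine_comp Y 1 v + b * affine_comp Y 2 v"
    using fundamental_system_spans[OF fundamental_system_on_subset[OF d1(2)]
        solves_ode_on_subset[OF d2(2)] convex_ball] \<open>ball w d \<subseteq> ball w d1\<close> \<open>ball w d \<subseteq> ball w d2\<close> by blast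
  have "\<forall>\<^sub>F q in nhds (Fin w). y q = a * Y q $ 1 + b * Y q $ 2"
    unfolding nhds_Fin eventually_filtermap
    by (rule eventually_mono[OF eventually_nhds_in_open[of "ball w d"]]) (use \<open>d > 0\<close> ab in auto)
  then show ?thesis by (rule that)
qed

lemma independent_solutions_span:
  assumes p: "p \<notin> D" and Y: "\<And>j. solution_near b1 b2 p (\<lambda>q. Y q $ j)" "independent_near p Y"
    and y: "solution_near b1 b2 p y"
  shows "\<exists>c :: complex^2. \<forall>\<^sub>F q in nhds p. y q = (\<Sum>j\<in>UNIV. c $ j * Y q $ j)"
proof -
  obtain e1 where e1: "e1 > 0" "\<And>j. ((\<lambda>q. Y q $ j) \<circ> chart p) holomorphic_on ball 0 e1"
    using analytic_at_cp1_ball[of "\<lambda>j q. Y q $ j" p] Y(1) by (auto simp: solution_near_iff)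
  obtain e2 where e2: "e2 > 0" "(y \<circ> chart p) holomorphic_on ball 0 e2"
    using y unfolding solution_near_iff analytic_at_cp1_def analytic_at_ball by blast
  have "\<forall>\<^sub>F q in nhds p. \<forall>j. solution_near b1 b2 q (\<lambda>q. Y q $ j)"
    by (intro eventually_all_finite eventually_solution_near p Y)
  moreover have "\<forall>\<^sub>F q in nhds p. independent_near q Y = independent_near p Y"
    using locally_constant_property_independent_near[of UNIV] Y(1)
    unfolding locally_constant_property_def solution_near_iff by blast
  ultimately have ev: "\<forall>\<^sub>F q in nhds p. q \<notin> D \<and> solution_near b1 b2 q y \<and>
      (\<forall>j. solution_near b1 b2 q (\<lambda>q. Y q $ j)) \<and> independent_near q Y"
    using eventually_notin_D[OF p] eventually_solution_near[OF p y]
    by eventually_elim (use Y(2) in auto)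
  have "0 < min e1 e2" using e1(1) e2(1) by simp
  then obtain t where t: "t \<noteq> 0" "t \<in> ball 0 (min e1 e2)" "chart p t \<notin> D" "solution_near b1 b2 (chart p t) y"
    "\<And>j. solution_near b1 b2 (chart p t) (\<lambda>q. Y q $ j)" "independent_near (chart p t) Y"
    using eventually_nhds_affine_point[OF ev] by blast
  define w where "w = affine_coord p t"
  have w: "chart p t = Fin w" using t(1) by (simp add: w_def chart_eq_Fin)
  obtain a b where "\<forall>\<^sub>F q in nhds (chart p t). y q = a * Y q $ 1 + b * Y q $ 2"
    using independent_solutions_span_at_affine_point[of w Y y] t(3-6) unfolding w by blast
  then have "\<forall>\<^sub>F q in nhds (chart p t). y q - (a * Y q $ 1 + b * Y q $ 2) = 0" by simp
  moreover have "((\<lambda>q. y q - (a * Y q $ 1 + b * Y q $ 2)) \<circ> chart p) holomorphic_on ball 0 (min e1 e2)"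
    unfolding o_def
    by (intro holomorphic_intros; rule holomorphic_on_subset[OF e1(2)[unfolded o_def]]
        holomorphic_on_subset[OF e2(2)[unfolded o_def]]) auto
  ultimately have "\<forall>\<^sub>F q in nhds p. y q - (a * Y q $ 1 + b * Y q $ 2) = 0"
    using vanishing_near_transfer[OF _ t(2)] by blast
  then have "\<forall>\<^sub>F q in nhds p. y q = (\<Sum>j\<in>UNIV. (vector [a, b] :: complex^2) $ j * Y q $ j)"
    by eventually_elim (simp add: sum_2)
  then show ?thesis by blast
qed

lemma solution_basis_if_independent:
  assumes "p \<notin> D" "\<And>j. solution_near b1 b2 p (\<lambda>q. Y q $ j)" "independent_near p Y"
  shows "solution_basis b1 b2 p Y"
  unfolding solution_basis_iff using assms independent_solutions_span by blast

end

section \<open>Loops around a point of the sphere\<close>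

lemma loop_around_is_loop:
  assumes "loop_around D x p g"
  shows "is_loop (- D) x g"
proof -
  obtain d r where d: "pathstart d = x"
    and hom: "homotopic_paths (- D) g (d +++ (chart p \<circ> circlepath 0 r) +++ reversepath d)"
    using assms unfolding loop_around_def by blast
  show ?thesis
    using homotopic_paths_imp_path[OF hom] homotopic_paths_imp_subset[OF hom]
      homotopic_paths_imp_pathstart[OF hom] homotopic_paths_imp_pathfinish[OF hom] d
    by (simp add: is_loop_def)
qed

lemma homotopic_paths_punctured_cball:
  fixes p q :: "real \<Rightarrow> complex"
  assumes "path p" "path_image p \<subseteq> cball 0 r - {0}" "path q" "path_image q \<subseteq> cball 0 r - {0}"
    and "pathstart q = pathstart p" "pathfinish q = pathfinish p"
    and "winding_number p 0 = winding_number q 0"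
  shows "homotopic_paths (cball 0 r - {0}) p q"
proof -
  let ?S = "cball 0 r - {0::complex}"
  define h where "h = (\<lambda>t::complex. min 1 (r / norm t) *\<^sub>R t)"
  have "r > 0"
    using assms(2) pathstart_in_path_image[of p] by (force intro: less_le_trans[of 0 "norm (pathstart p)" r])
  have h_id: "h t = t" if "t \<in> ?S" for t using that by (simp add: h_def)
  have "homotopic_paths (- {0}) p q"
    using assms by (subst winding_number_homotopic_paths_eq[symmetric]) auto
  moreover have "continuous_on (- {0}) h" unfolding h_def by (intro continuous_intros) auto
  moreover have "h \<in> - {0} \<rightarrow> ?S"
    using \<open>r > 0\<close> by (auto simp: h_def min_def divide_simps split: if_splits)
  ultimately have "homotopic_paths ?S (h \<circ> p) (h \<circ> q)"
    by (rule homotopic_paths_continuous_image)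
  moreover have "homotopic_paths ?S p (h \<circ> p)" "homotopic_paths ?S q (h \<circ> q)"
    using assms(1-4) h_id by (auto intro!: homotopic_paths_eq simp: path_image_def subset_iff)
  ultimately show ?thesis by (meson homotopic_paths_sym homotopic_paths_trans)
qed

lemma homotopic_paths_circlepath_shrink:
  assumes "0 < r'" "r' \<le> r"
  defines "L \<equiv> linepath (complex_of_real r) (of_real r')"
  shows "homotopic_paths (cball 0 r - {0}) (circlepath 0 r) (L +++ circlepath 0 r' +++ reversepath L)"
proof (rule homotopic_paths_punctured_cball)
  have ends: "path L" "pathstart L = of_real r" "pathfinish L = of_real r'" by (simp_all add: L_def)
  have "closed_segment (complex_of_real r) (of_real r') = of_real ` closed_segment r r'"
    by (rule closed_segment_of_real)
  then have L_image: "path_image L \<subseteq> cball 0 r - {0}"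
    using assms(1,2) by (auto simp: L_def closed_segment_eq_real_ivl)
  moreover have circle: "path_image (circlepath 0 s) \<subseteq> cball 0 r - {0}" if "0 < s" "s \<le> r" for s
    using that by auto
  ultimately show "path_image (L +++ circlepath 0 r' +++ reversepath L) \<subseteq> cball 0 r - {0}"
    using assms(1,2) ends by (intro subset_path_image_join) auto
  show "path_image (circlepath 0 r) \<subseteq> cball 0 r - {0}" using assms(1,2) by (intro circle) auto
  have "0 \<notin> path_image L" using L_image by blast
  then have "winding_number (L +++ circlepath 0 r' +++ reversepath L) 0 = 1"
    using assms(1) ends
    by (simp add: winding_number_join not_in_path_image_join winding_number_reversepath
        winding_number_circlepath_centre)
  then show "winding_number (circlepath 0 r) 0 = winding_number (L +++ circlepath 0 r' +++ reversepath L) 0"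
    using assms(1,2) by (simp add: winding_number_circlepath_centre)
qed (simp_all add: L_def)

lemma homotopic_paths_conjugate_extend:
  assumes d: "path d" "path_image d \<subseteq> S" and L: "path L" "path_image L \<subseteq> S" "pathstart L = pathfinish d"
    and c: "path c" "path_image c \<subseteq> S" "pathstart c = pathfinish L" "pathfinish c = pathfinish L"
    and hom: "homotopic_paths S C (L +++ c +++ reversepath L)"
  shows "homotopic_paths S (d +++ C +++ reversepath d) ((d +++ L) +++ c +++ reversepath (d +++ L))"
proof -
  let ?L' = "reversepath L" and ?d' = "reversepath d"
  have ends: "pathstart C = pathfinish d" "pathfinish C = pathfinish d"
    using homotopic_paths_imp_pathstart[OF hom] homotopic_paths_imp_pathfinish[OF hom] L(3) by auto
  have refl: "homotopic_paths S d d" "homotopic_paths S L L" "homotopic_paths S ?d' ?d'" using d L by auto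
  have "homotopic_paths S (d +++ C +++ ?d') (d +++ (L +++ c +++ ?L') +++ ?d')"
    by (intro homotopic_paths_join refl hom) (use ends L c in auto)
  also have "homotopic_paths S (d +++ (L +++ c +++ ?L') +++ ?d') (d +++ L +++ (c +++ ?L') +++ ?d')"
    by (rule homotopic_paths_join[OF refl(1)], rule homotopic_paths_sym, rule homotopic_paths_assoc)
      (use d L c in \<open>auto simp: path_image_join\<close>)
  also have "homotopic_paths S (d +++ L +++ (c +++ ?L') +++ ?d') (d +++ L +++ c +++ ?L' +++ ?d')"
    by (rule homotopic_paths_join[OF refl(1)], rule homotopic_paths_join[OF refl(2)],
        rule homotopic_paths_sym, rule homotopic_paths_assoc) (use d L c in \<open>auto simp: path_image_join\<close>)
  also have "homotopic_paths S (d +++ L +++ c +++ ?L' +++ ?d') ((d +++ L) +++ c +++ ?L' +++ ?d')"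
    by (rule homotopic_paths_assoc) (use d L c in \<open>auto simp: path_image_join\<close>)
  also have "?L' +++ ?d' = reversepath (d +++ L)" using L by (simp add: reversepath_joinpaths)
  finally show ?thesis .
qed

lemma loop_around_small:
  assumes "loop_around D x p g" "e > 0"
  obtains d r where "0 < r" "r < e" "chart p ` (cball 0 r - {0}) \<inter> D = {}"
    "path d" "path_image d \<subseteq> - D" "pathstart d = x" "pathfinish d = chart p (of_real r)"
    "homotopic_paths (- D) g (d +++ (chart p \<circ> circlepath 0 r) +++ reversepath d)"
proof -
  obtain d r where r: "0 < r" "chart p ` (cball 0 r - {0}) \<inter> D = {}"
    and d: "path d" "path_image d \<subseteq> - D" "pathstart d = x" "pathfinish d = chart p (of_real r)"
    and hom: "homotopic_paths (- D) g (d +++ (chart p \<circ> circlepath 0 r) +++ reversepath d)"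
    using assms unfolding loop_around_def by blast
  define r' where "r' = min r (e / 2)"
  have r': "0 < r'" "r' \<le> r" "r' < e" using r(1) assms(2) by (auto simp: r'_def)
  let ?l = "linepath (complex_of_real r) (of_real r')"
  let ?L = "chart p \<circ> ?l" and ?c = "chart p \<circ> circlepath 0 r'"
  have shrink: "homotopic_paths (cball 0 r - {0}) (circlepath 0 r) (?l +++ circlepath 0 r' +++ reversepath ?l)"
    using r'(1,2) by (rule homotopic_paths_circlepath_shrink)
  then have "path_image ?l \<subseteq> cball 0 r - {0}" "path_image (circlepath 0 r') \<subseteq> cball 0 r - {0}"
    using homotopic_paths_imp_subset[OF shrink] by (auto simp: path_image_join simp del: path_image_circlepath)
  then have images: "path_image ?L \<subseteq> - D" "path_image ?c \<subseteq> - D"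
    unfolding path_image_compose using r(2) by blast+
  have paths: "path ?L" "path ?c" by (auto intro: path_chart_compose)
  have "homotopic_paths (- D) (chart p \<circ> circlepath 0 r) (chart p \<circ> (?l +++ circlepath 0 r' +++ reversepath ?l))"
    by (rule homotopic_paths_continuous_image[OF shrink continuous_on_chart]) (use r(2) in blast)
  then have "homotopic_paths (- D) (chart p \<circ> circlepath 0 r) (?L +++ ?c +++ reversepath ?L)"
    by (simp only: path_compose_join path_compose_reversepath)
  then have "homotopic_paths (- D) (d +++ (chart p \<circ> circlepath 0 r) +++ reversepath d)
      ((d +++ ?L) +++ ?c +++ reversepath (d +++ ?L))"
    by (intro homotopic_paths_conjugate_extend d(1,2) paths images)
      (simp_all add: d(4) pathstart_compose pathfinish_compose)
  then have "homotopic_paths (- D) g ((d +++ ?L) +++ ?c +++ reversepath (d +++ ?L))"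
    by (rule homotopic_paths_trans[OF hom])
  moreover have "cball 0 r' - {0} \<subseteq> cball 0 r - {0::complex}" using r'(2) by auto
  then have "chart p ` (cball 0 r' - {0}) \<inter> D = {}" using r(2) by blast
  moreover have "path (d +++ ?L)" "path_image (d +++ ?L) \<subseteq> - D"
    using d paths images by (auto simp: path_image_join pathstart_compose)
  ultimately show ?thesis
    using that[of r' "d +++ ?L"] r' d(3) by (simp add: pathfinish_compose)
qed

section \<open>The symmetric square of a fundamental system\<close>

definition sym_A :: "(complex \<Rightarrow> complex) \<Rightarrow> (complex \<Rightarrow> complex) \<Rightarrow> complex \<Rightarrow> complex" where
  "sym_A f g w = f w * g w / wronskian f g w"

definition sym_B :: "(complex \<Rightarrow> complex) \<Rightarrow> (complex \<Rightarrow> complex) \<Rightarrow> complex \<Rightarrow> complex" where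
  "sym_B f g w = (deriv f w * g w + f w * deriv g w) / wronskian f g w"

definition sym_C :: "(complex \<Rightarrow> complex) \<Rightarrow> (complex \<Rightarrow> complex) \<Rightarrow> complex \<Rightarrow> complex" where
  "sym_C f g w = deriv f w * deriv g w / wronskian f g w"

lemma sym_discriminant:
  assumes "wronskian f g w \<noteq> 0"
  shows "(sym_B f g w)\<^sup>2 - 4 * sym_A f g w * sym_C f g w = 1"
proof -
  have "(deriv f w * g w + f w * deriv g w)\<^sup>2 - 4 * (f w * g w) * (deriv f w * deriv g w) = (wronskian f g w)\<^sup>2"
    by (simp add: wronskian_def power2_eq_square algebra_simps)
  then show ?thesis
    using assms by (simp add: sym_A_def sym_B_def sym_C_def power_divide power2_eq_square[of "wronskian f g w"]
        diff_divide_distrib[symmetric])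
qed

lemma symmetric_square_of_fundamental_system:
  assumes "fundamental_system_on b1 b2 S f g"
  shows "symmetric_square_system S b1 b2 (sym_A f g) (sym_B f g) (sym_C f g)"
  unfolding symmetric_square_system_def
proof (intro ballI conjI)
  fix w assume w: "w \<in> S"
  have solutions: "solves_ode_on b1 b2 S f" "solves_ode_on b1 b2 S g" and wronskian_nz: "wronskian f g w \<noteq> 0"
    using assms w by (auto simp: fundamental_system_on_def)
  note derivs = solves_ode_onD[OF solutions(1) w] solves_ode_onD[OF solutions(2) w]
  note wronskian_deriv = DERIV_wronskian[OF solutions w]
  have quotient: "((\<lambda>w. n w / wronskian f g w) has_field_derivative (n' + b1 w * n w) / wronskian f g w) (at w)"
    if "(n has_field_derivative n') (at w)" for n n'
    by (rule DERIV_cong[OF DERIV_divide[OF that wronskian_deriv wronskian_nz]]) (use wronskian_nz in \<open>simp add: field_simps power2_eq_square\<close>)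
  have "((\<lambda>w. f w * g w) has_field_derivative deriv f w * g w + f w * deriv g w) (at w)"
    by (rule derivative_eq_intros refl derivs)+ simp
  from quotient[OF this] show "(sym_A f g has_field_derivative sym_B f g w + b1 w * sym_A f g w) (at w)"
    unfolding sym_A_def sym_B_def by (simp add: add_divide_distrib)
  have "((\<lambda>w. deriv f w * g w + f w * deriv g w) has_field_derivative
      2 * (deriv f w * deriv g w) - 2 * b2 w * (f w * g w)
      - b1 w * (deriv f w * g w + f w * deriv g w)) (at w)"
    by (rule derivative_eq_intros refl derivs)+ (simp add: algebra_simps)
  from quotient[OF this]
  show "(sym_B f g has_field_derivative 2 * sym_C f g w - 2 * b2 w * sym_A f g w) (at w)"
    unfolding sym_A_def sym_B_def sym_C_def by (simp add: diff_divide_distrib)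
  have "((\<lambda>w. deriv f w * deriv g w) has_field_derivative
      - 2 * b1 w * (deriv f w * deriv g w) - b2 w * (deriv f w * g w + f w * deriv g w)) (at w)"
    by (rule derivative_eq_intros refl derivs)+ (simp add: algebra_simps)
  from quotient[OF this]
  show "(sym_C f g has_field_derivative - b1 w * sym_C f g w - b2 w * sym_B f g w) (at w)"
    unfolding sym_B_def sym_C_def by (rule DERIV_cong) (use wronskian_nz in \<open>simp add: field_simps\<close>)
qed

lemma sym_scale:
  assumes f: "f field_differentiable at z" "\<forall>\<^sub>F w in nhds z. f' w = a * f w" "a \<noteq> 0"
    and g: "g field_differentiable at z" "\<forall>\<^sub>F w in nhds z. g' w = b * g w" "b \<noteq> 0"
  shows "sym_A f' g' z = sym_A f g z" "sym_B f' g' z = sym_B f g z" "sym_C f' g' z = sym_C f g z"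
proof -
  have scaled: "f' z = a * f z" "g' z = b * g z"
    using eventually_nhds_x_imp_x[OF f(2)] eventually_nhds_x_imp_x[OF g(2)] by auto
  have derivs: "deriv f' z = a * deriv f z" "deriv g' z = b * deriv g z"
    using deriv_cong_ev[OF f(2) refl] deriv_cong_ev[OF g(2) refl] f(1) g(1) by simp_all
  have wronskian_scaled: "wronskian f' g' z = (a * b) * wronskian f g z"
    unfolding wronskian_def scaled derivs by (simp add: algebra_simps)
  have cancel: "(a * b) * u / ((a * b) * v) = u / v" for u v using f(3) g(3) by simp
  show "sym_A f' g' z = sym_A f g z"
    unfolding sym_A_def wronskian_scaled scaled cancel[of _ "wronskian f g z", symmetric] by (simp add: mult_ac)
  show "sym_B f' g' z = sym_B f g z"
    unfolding sym_B_def wronskian_scaled scaled derivs cancel[of _ "wronskian f g z", symmetric] by (simp add: algebra_simps)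
  show "sym_C f' g' z = sym_C f g z"
    unfolding sym_C_def wronskian_scaled derivs cancel[of _ "wronskian f g z", symmetric] by (simp add: mult_ac)
qed

text \<open>Since \<open>(log (g / f))' = wronskian f g / (f g)\<close>, a primitive of the right hand side determines
  the quotient of the solutions.\<close>

lemma quotient_eq_exp_primitive:
  assumes "convex S"
    and f: "\<And>w. w \<in> S \<Longrightarrow> (f has_field_derivative deriv f w) (at w)" "\<And>w. w \<in> S \<Longrightarrow> f w \<noteq> 0"
    and g: "\<And>w. w \<in> S \<Longrightarrow> (g has_field_derivative deriv g w) (at w)" "\<And>w. w \<in> S \<Longrightarrow> g w \<noteq> 0"
    and K: "\<And>w. w \<in> S \<Longrightarrow> (K has_field_derivative wronskian f g w / (f w * g w)) (at w)"
  obtains k where "\<And>w. w \<in> S \<Longrightarrow> g w = k * f w * exp (K w)"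
proof -
  have "\<exists>k. \<forall>w\<in>S. g w / f w * exp (- K w) = k"
  proof (rule has_field_derivative_zero_constant[OF assms(1)])
    fix w assume w: "w \<in> S"
    have "((\<lambda>w. g w / f w * exp (- K w)) has_field_derivative
        (deriv g w * f w - g w * deriv f w) / (f w * f w) * exp (- K w) +
        exp (- K w) * - (wronskian f g w / (f w * g w)) * (g w / f w)) (at w)"
      by (rule DERIV_mult[OF DERIV_divide[OF g(1) f(1) f(2)] DERIV_fun_exp[OF DERIV_minus[OF K]]]; fact w)
    then show "((\<lambda>w. g w / f w * exp (- K w)) has_field_derivative 0) (at w within S)"
      using f(2)[OF w] g(2)[OF w] by (simp add: wronskian_def field_simps has_field_derivative_at_within)
  qed
  then obtain k where k: "\<And>w. w \<in> S \<Longrightarrow> g w / f w * exp (- K w) = k" by blast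
  have "g w = k * f w * exp (K w)" if "w \<in> S" for w
    using k[OF that] f(2)[OF that] by (simp add: exp_minus field_simps)
  then show ?thesis by (rule that)
qed

lemma DERIV_primitive_in_affine_coord:
  assumes "t \<noteq> 0" "(K has_field_derivative 1 / field_in_chart A p t) (at t)"
  shows "((\<lambda>w. K (local_coord p w)) has_field_derivative 1 / A (affine_coord p t)) (at (affine_coord p t))"
proof (cases p)
  case (Fin c)
  then show ?thesis
    using assms(2) DERIV_shift[of K _ "c + t" "- c"] by simp
next
  case Infty
  have "(K has_field_derivative 1 / (- t\<^sup>2 * A (1 / t))) (at (1 / (1 / t)))" using assms Infty by simp
  from DERIV_compose_reciprocal[OF this] show ?thesis
    using assms(1) Infty by (simp add: power_divide)
qed

lemma primitive_in_affine_part: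
  assumes A_nz: "\<And>t. t \<in> ball 0 e - {0} \<Longrightarrow> field_in_chart A p t \<noteq> 0"
    and K_deriv: "\<And>t. t \<in> ball 0 e - {0} \<Longrightarrow> (K has_field_derivative 1 / field_in_chart A p t) (at t)"
    and w: "w \<in> Fin -` (chart p ` (ball 0 e - {0}))"
  shows "A w \<noteq> 0" "((\<lambda>w. K (the_inv (chart p) (Fin w))) has_field_derivative 1 / A w) (at w)"
proof -
  obtain t where t: "t \<in> ball 0 e - {0}" "Fin w = chart p t" using w by blast
  then have w_eq: "w = affine_coord p t" by (simp add: chart_eq_Fin)
  show "A w \<noteq> 0" using A_nz[OF t(1)] t(1) by (cases p) (auto simp: w_eq)
  have "\<forall>\<^sub>F v in nhds w. v \<in> Fin -` (chart p ` (ball 0 e - {0}))"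
    using w by (intro eventually_nhds_in_open open_vimage_Fin open_chart_image) auto
  then have "\<forall>\<^sub>F v in nhds w. K (the_inv (chart p) (Fin v)) = K (local_coord p v)"
  proof eventually_elim
    case (elim v)
    then obtain s where s: "s \<noteq> 0" "Fin v = chart p s" by blast
    then have "v = affine_coord p s" by (simp add: chart_eq_Fin)
    then show ?case using s by (simp add: the_inv_f_f[OF inj_chart] local_coord_affine_coord)
  qed
  from DERIV_cong_ev[OF refl this refl]
  show "((\<lambda>w. K (the_inv (chart p) (Fin w))) has_field_derivative 1 / A w) (at w)"
    using DERIV_primitive_in_affine_coord[of t K A p] t(1) K_deriv[OF t(1)] unfolding w_eq by auto
qed

lemma locally_constant_property_exp_quotient:
  assumes "K analytic_on S"
  shows "locally_constant_property (chart p ` S)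
    (\<lambda>q h. \<forall>\<^sub>F r in nhds q. h r $ 2 - k * h r $ 1 * exp (K (the_inv (chart p) r)) = 0)"
proof (rule locally_constant_property_vanishing)
  fix q and h :: "cp1 \<Rightarrow> complex^2"
  assume "q \<in> chart p ` S" and h: "\<And>j. analytic_at_cp1 (\<lambda>q. h q $ j) q"
  then obtain t where t: "t \<in> S" "q = chart p t" by blast
  then have "K analytic_on {t}" using assms by (auto intro: analytic_on_subset)
  then show "analytic_at_cp1 (\<lambda>q. h q $ 2 - k * h q $ 1 * exp (K (the_inv (chart p) q))) q"
    using h unfolding t(2) analytic_at_chart o_def the_inv_f_f[OF inj_chart] by (intro analytic_intros)
qed

section \<open>Equations with diagonal monodromy\<close>

lemma vector_diag2 [simp]:
  "((y::complex^2) v* diag2 a b) $ 1 = a * y $ 1" "(y v* diag2 a b) $ 2 = b * y $ 2"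
  by (simp_all add: vector_matrix_mult_2 diag2_def)

lemma diag2_scalar: "diag2 a a = mat a"
  by (simp add: diag2_def mat_def vec_eq_iff forall_2)

locale diagonal_monodromy = riemann_ode +
  fixes x :: cp1 and Z :: "cp1 \<Rightarrow> complex^2" and \<rho> :: "(real \<Rightarrow> cp1) set \<Rightarrow> complex^2^2"
  assumes x_notin_D: "x \<notin> D" and Z_basis: "solution_basis b1 b2 x Z"
    and monodromy: "\<And>\<gamma>. is_loop (- D) x \<gamma> \<Longrightarrow>
       \<exists>Z'. continuation_along \<gamma> Z Z' \<and> (\<forall>\<^sub>F q in nhds x. Z q = Z' q v* \<rho> (path_class (- D) \<gamma>))"
    and diagonal: "\<And>\<gamma>. is_loop (- D) x \<gamma> \<Longrightarrow>
       \<exists>a b. a \<noteq> 0 \<and> b \<noteq> 0 \<and> \<rho> (path_class (- D) \<gamma>) = diag2 a b"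
begin

lemma continuation_exists:
  assumes "path d" "path_image d \<subseteq> - D" "pathstart d = x"
  obtains f where "continuation_along d Z f"
proof -
  have "is_loop (- D) x (d +++ reversepath d)"
    using assms by (auto simp: is_loop_def path_image_join)
  then obtain Z' where "continuation_along (d +++ reversepath d) Z Z'" using monodromy by blast
  then show ?thesis by (rule continuation_along_join_split) (use that in auto)
qed

lemma continuations_differ_by_monodromy:
  assumes d: "path d" "path_image d \<subseteq> - D" "pathstart d = x" "continuation_along d Z f"
    and d': "path d'" "path_image d' \<subseteq> - D" "pathstart d' = x" "continuation_along d' Z g"
    and meet: "pathfinish d = pathfinish d'"
  shows "is_loop (- D) x (d +++ reversepath d')"
    and "\<forall>\<^sub>F q in nhds (pathfinish d). g q = f q v* \<rho> (path_class (- D) (d +++ reversepath d'))"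
proof -
  let ?l = "d +++ reversepath d'" and ?M = "\<rho> (path_class (- D) (d +++ reversepath d'))"
  show loop: "is_loop (- D) x ?l"
    using d d' meet by (auto simp: is_loop_def path_image_join)
  obtain Z' where Z': "continuation_along ?l Z Z'" "\<forall>\<^sub>F q in nhds x. Z q = Z' q v* ?M"
    using monodromy[OF loop] by blast
  obtain h where h: "continuation_along d Z h" "continuation_along (reversepath d') h Z'"
    by (rule continuation_along_join_split[OF Z'(1)]) (use meet in auto)
  have "continuation_along d' (\<lambda>q. Z' q v* ?M) (\<lambda>q. h q v* ?M)"
    using continuation_along_matrix[OF continuation_along_reversepath[OF h(2)]] by simp
  moreover have "\<forall>\<^sub>F q in nhds (pathstart d'). Z' q v* ?M = Z q"
    using Z'(2) unfolding d'(3) by eventually_elim simp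
  ultimately have "continuation_along d' Z (\<lambda>q. h q v* ?M)"
    by (rule continuation_along_cong) simp
  from continuation_along_unique[OF d'(4) this d'(1)]
  have "\<forall>\<^sub>F q in nhds (pathfinish d). g q = h q v* ?M" by (simp add: meet)
  with continuation_along_unique[OF d(4) h(1) d(1)]
  show "\<forall>\<^sub>F q in nhds (pathfinish d). g q = f q v* ?M" by eventually_elim simp
qed

definition branch :: "cp1 \<Rightarrow> (cp1 \<Rightarrow> complex^2) \<Rightarrow> bool" where
  "branch p f \<longleftrightarrow> (\<exists>d. path d \<and> path_image d \<subseteq> - D \<and> pathstart d = x \<and> pathfinish d = p \<and>
     continuation_along d Z f)"

lemma branch_notin_D: "branch p f \<Longrightarrow> p \<notin> D"
  using pathfinish_in_path_image by (fastforce simp: branch_def)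

lemma branch_exists:
  assumes "p \<notin> D"
  shows "\<exists>f. branch p f"
proof -
  obtain d where d: "path d" "path_image d \<subseteq> - D" "pathstart d = x" "pathfinish d = p"
    using path_connected_complement_finite_cp1[OF finite_D] x_notin_D assms
    unfolding path_connected_def by blast
  obtain f where "continuation_along d Z f" using continuation_exists[OF d(1-3)] .
  then show ?thesis unfolding branch_def using d by blast
qed

lemma branch_solution:
  assumes "branch p f"
  shows "solution_near b1 b2 p (\<lambda>q. f q $ j)" "independent_near p f"
proof -
  obtain d where d: "path d" "path_image d \<subseteq> - D" "pathstart d = x" "pathfinish d = p"
    and cont: "continuation_along d Z f"
    using assms unfolding branch_def by blast
  have Z_solutions: "solution_near b1 b2 x (\<lambda>q. Z q $ j)" "independent_near x Z"
    using Z_basis by (auto simp: solution_basis_iff)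
  have "analytic_at_cp1 (\<lambda>q. f q $ j) p"
    using continuation_along_imp_analytic[OF cont] d(4) by simp
  moreover have "ode_near b1 b2 p (\<lambda>q. f q $ j)"
    using continuation_along_preserves[OF cont d(1,2) locally_constant_property_ode_near, of j] Z_solutions(1) d(3,4)
    by (simp add: solution_near_iff)
  ultimately show "solution_near b1 b2 p (\<lambda>q. f q $ j)" by (simp add: solution_near_iff)
  show "independent_near p f"
    using continuation_along_preserves[OF cont d(1,2) locally_constant_property_independent_near] Z_solutions(2) d(3,4)
    by simp
qed

lemma branch_unique:
  assumes "branch p f" "branch p g"
  obtains a b where "a \<noteq> 0" "b \<noteq> 0" "\<forall>\<^sub>F q in nhds p. g q = f q v* diag2 a b"
proof -
  obtain d where d: "path d" "path_image d \<subseteq> - D" "pathstart d = x" "continuation_along d Z f" "pathfinish d = p"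
    using assms(1) unfolding branch_def by blast
  obtain d' where d': "path d'" "path_image d' \<subseteq> - D" "pathstart d' = x" "continuation_along d' Z g" "pathfinish d' = p"
    using assms(2) unfolding branch_def by blast
  have meet: "pathfinish d = pathfinish d'" using d(5) d'(5) by simp
  note differ = continuations_differ_by_monodromy[OF d(1-4) d'(1-4) meet]
  show ?thesis using diagonal[OF differ(1)] differ(2) that d(5) by auto
qed

lemma eventually_branch:
  assumes "branch p f"
  shows "\<forall>\<^sub>F q in nhds p. branch q f"
proof -
  obtain d where d: "path d" "path_image d \<subseteq> - D" "pathstart d = x" "pathfinish d = p"
    and cont: "continuation_along d Z f"
    using assms unfolding branch_def by blast
  obtain e1 where e1: "e1 > 0" "\<And>j. ((\<lambda>q. f q $ j) \<circ> chart p) holomorphic_on ball 0 e1"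
    using analytic_at_cp1_ball[of "\<lambda>j q. f q $ j" p] branch_solution(1)[OF assms]
    by (auto simp: solution_near_iff)
  obtain e2 where e2: "e2 > 0" "\<And>t. t \<in> ball 0 e2 \<Longrightarrow> chart p t \<notin> D"
    using chart_ball[OF finite_D branch_notin_D[OF assms]] by blast
  show ?thesis
  proof (rule eventually_nhds_chart_ball[of "min e1 e2"])
    fix t :: complex assume t: "t \<in> ball 0 (min e1 e2)"
    let ?c = "chart p \<circ> linepath 0 t"
    have segment: "closed_segment 0 t \<subseteq> ball 0 (min e1 e2)"
      using t e1(1) e2(1) by (intro closed_segment_subset) auto
    have chart_segment: "path ?c" "path_image ?c \<subseteq> - D" "pathstart ?c = p" "pathfinish ?c = chart p t"
      using segment e2(2) by (auto simp: path_chart_compose path_image_compose pathstart_compose pathfinish_compose subset_iff)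
    have extended: "path (d +++ ?c)" "path_image (d +++ ?c) \<subseteq> - D" "pathstart (d +++ ?c) = x"
      using d chart_segment by (auto simp: path_image_join)
    obtain h where h: "continuation_along (d +++ ?c) Z h" using continuation_exists[OF extended] .
    obtain g where g: "continuation_along d Z g" "continuation_along ?c g h"
      using continuation_along_join_split[OF h] d(4) chart_segment(3) by auto
    have "path_image ?c \<subseteq> chart p ` ball 0 e1"
      using segment by (auto simp: path_image_compose)
    then have "continuation_along ?c f f"
      by (rule continuation_along_const_in_chart[OF e1(2) open_ball])
    moreover have "\<forall>\<^sub>F q in nhds (pathstart ?c). f q = g q"
      using continuation_along_unique[OF cont g(1) d(1)] d(4) chart_segment(3) by simp
    ultimately have "continuation_along ?c g f" by (rule continuation_along_cong) simp
    from continuation_along_unique[OF g(2) this chart_segment(1)]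
    have "\<forall>\<^sub>F q in nhds (pathfinish (d +++ ?c)). h q = f q" by simp
    from continuation_along_cong[OF h _ this] have "continuation_along (d +++ ?c) Z f" by simp
    then show "branch (chart p t) f" unfolding branch_def using extended chart_segment(4) by (intro exI[of _ "d +++ ?c"]) simp
  qed (use e1(1) e2(1) in simp)
qed

lemma branch_fundamental_system:
  assumes "branch (Fin z) f"
  obtains d where "d > 0" "ball z d \<subseteq> {w. Fin w \<notin> D}" "\<And>w. w \<in> ball z d \<Longrightarrow> branch (Fin w) f"
    "fundamental_system_on b1 b2 (ball z d) (affine_comp f 1) (affine_comp f 2)"
proof -
  obtain d1 where d1: "d1 > 0" "ball z d1 \<subseteq> {w. Fin w \<notin> D}"
      "fundamental_system_on b1 b2 (ball z d1) (affine_comp f 1) (affine_comp f 2)"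
    using fundamental_system_on_ball[OF branch_notin_D[OF assms] branch_solution[OF assms]] by blast
  have "\<forall>\<^sub>F w in nhds z. branch (Fin w) f"
    using eventually_branch[OF assms] by (simp add: nhds_Fin eventually_filtermap)
  then obtain d2 where d2: "d2 > 0" "\<And>w. w \<in> ball z d2 \<Longrightarrow> branch (Fin w) f"
    unfolding eventually_nhds_metric by (auto simp: dist_commute)
  have "ball z (min d1 d2) \<subseteq> ball z d1" "ball z (min d1 d2) \<subseteq> ball z d2" by auto
  with d1 d2 show ?thesis
    by (intro that[of "min d1 d2"]) (blast intro: fundamental_system_on_subset | simp)+
qed

definition branch_at :: "complex \<Rightarrow> cp1 \<Rightarrow> complex^2" where
  "branch_at z = (SOME f. branch (Fin z) f)"

abbreviation "A z \<equiv> sym_A (affine_comp (branch_at z) 1) (affine_comp (branch_at z) 2) z"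
abbreviation "B z \<equiv> sym_B (affine_comp (branch_at z) 1) (affine_comp (branch_at z) 2) z"
abbreviation "C z \<equiv> sym_C (affine_comp (branch_at z) 1) (affine_comp (branch_at z) 2) z"

lemma sym_eq_of_branch:
  assumes "branch (Fin z) f"
  shows "A z = sym_A (affine_comp f 1) (affine_comp f 2) z"
    and "B z = sym_B (affine_comp f 1) (affine_comp f 2) z"
    and "C z = sym_C (affine_comp f 1) (affine_comp f 2) z"
proof -
  have "branch (Fin z) (branch_at z)" unfolding branch_at_def using assms by (rule someI[of "branch (Fin z)"])
  then obtain a b where ab: "a \<noteq> 0" "b \<noteq> 0" "\<forall>\<^sub>F q in nhds (Fin z). branch_at z q = f q v* diag2 a b"
    using branch_unique[OF assms] by blast
  have diff: "affine_comp f j field_differentiable at z" for j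
    using branch_solution(1)[OF assms, of j]
    by (auto simp: solution_near_iff analytic_at_Fin intro: analytic_on_imp_differentiable_at)
  have "\<forall>\<^sub>F w in nhds z. affine_comp (branch_at z) 1 w = a * affine_comp f 1 w"
    "\<forall>\<^sub>F w in nhds z. affine_comp (branch_at z) 2 w = b * affine_comp f 2 w"
    using ab(3) unfolding nhds_Fin eventually_filtermap by (auto elim: eventually_mono)
  from sym_scale[OF diff this(1) ab(1) diff this(2) ab(2)]
  show "A z = sym_A (affine_comp f 1) (affine_comp f 2) z"
    "B z = sym_B (affine_comp f 1) (affine_comp f 2) z"
    "C z = sym_C (affine_comp f 1) (affine_comp f 2) z" by blast+
qed

lemma symmetric_square_global: "symmetric_square_system {z. Fin z \<notin> D} b1 b2 A B C"
  unfolding symmetric_square_system_def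
proof (intro ballI)
  fix z assume "z \<in> {z. Fin z \<notin> D}"
  then obtain f where f: "branch (Fin z) f" using branch_exists by blast
  obtain d where d: "d > 0" "\<And>w. w \<in> ball z d \<Longrightarrow> branch (Fin w) f"
    "fundamental_system_on b1 b2 (ball z d) (affine_comp f 1) (affine_comp f 2)"
    using branch_fundamental_system[OF f] by metis
  have in_ball: "\<forall>\<^sub>F w in nhds z. w \<in> ball z d" using d(1) by (intro eventually_nhds_in_open) auto
  have "\<forall>\<^sub>F w in nhds z. sym_A (affine_comp f 1) (affine_comp f 2) w = A w"
    "\<forall>\<^sub>F w in nhds z. sym_B (affine_comp f 1) (affine_comp f 2) w = B w"
    "\<forall>\<^sub>F w in nhds z. sym_C (affine_comp f 1) (affine_comp f 2) w = C w"
    using in_ball by (eventually_elim, simp add: sym_eq_of_branch[OF d(2)])+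
  note cong = this[THEN DERIV_cong_ev[OF refl, OF _ refl]]
  show "(A has_field_derivative B z + b1 z * A z) (at z) \<and>
      (B has_field_derivative 2 * C z - 2 * b2 z * A z) (at z) \<and>
      (C has_field_derivative - b1 z * C z - b2 z * B z) (at z)"
    using symmetric_square_of_fundamental_system[OF d(3)] d(1)
    unfolding symmetric_square_system_def sym_eq_of_branch[OF f] cong[symmetric] by simp
qed

lemma discriminant_global:
  assumes "Fin z \<notin> D"
  shows "(B z)\<^sup>2 - 4 * A z * C z = 1"
proof -
  obtain f where f: "branch (Fin z) f" using branch_exists[OF assms] by blast
  obtain d where "d > 0" "fundamental_system_on b1 b2 (ball z d) (affine_comp f 1) (affine_comp f 2)"
    using branch_fundamental_system[OF f] by metis
  then have "wronskian (affine_comp f 1) (affine_comp f 2) z \<noteq> 0" by (simp add: fundamental_system_on_def)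
  then show ?thesis unfolding sym_eq_of_branch[OF f] by (rule sym_discriminant)
qed

lemma field_nonzero_somewhere: "\<exists>z. Fin z \<notin> D \<and> A z \<noteq> 0"
proof (rule ccontr)
  assume "\<nexists>z. Fin z \<notin> D \<and> A z \<noteq> 0"
  then have A_zero: "A z = 0" if "Fin z \<notin> D" for z using that by blast
  have "infinite (UNIV :: complex set)" by (rule infinite_UNIV_char_0)
  then obtain z where z: "Fin z \<notin> D" using finite_vimage_Fin[OF finite_D] by (metis UNIV_eq_I vimageI)
  have "\<forall>\<^sub>F w in nhds z. A w = 0"
    by (rule eventually_mono[OF eventually_nhds_in_open[OF open_affine_part[OF finite_D]]]) (use z A_zero in auto)
  then have "(A has_field_derivative 0) (at z)"
    using DERIV_cong_ev[OF refl, of A "\<lambda>_. 0"] by simp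
  moreover have "(A has_field_derivative B z + b1 z * A z) (at z)"
    using symmetric_square_global z by (simp add: symmetric_square_system_def)
  ultimately have "B z = 0" using DERIV_unique A_zero[OF z] by fastforce
  then show False using discriminant_global[OF z] A_zero[OF z] by simp
qed

lemma exists_primitive:
  assumes "card D = 3"
  obtains p e K where "p \<in> D" "e > 0"
    "\<And>t. t \<in> ball 0 e - {0} \<Longrightarrow> field_in_chart A p t \<noteq> 0"
    "\<And>t. t \<in> ball 0 e - {0} \<Longrightarrow> (K has_field_derivative 1 / field_in_chart A p t) (at t)"
proof -
  obtain p where p: "p \<in> D" and nonzero: "\<not> (field_in_chart A p \<longlongrightarrow> 0) (at 0)"
    using field_eq_0_if_zero_at_three_points[OF finite_D assms riemann symmetric_square_global]
      field_nonzero_somewhere by blast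
  show ?thesis
  proof (rule field_zero_or_primitive[OF finite_D riemann p symmetric_square_global])
    assume "(field_in_chart A p \<longlongrightarrow> 0) (at 0)"
    then show ?thesis using nonzero by contradiction
  qed (rule that[OF p])
qed

lemma branch_field_on_neighbourhood:
  assumes "branch (Fin z) f" "open N" "z \<in> N"
  obtains U where "convex U" "open U" "z \<in> U" "U \<subseteq> N"
    and "\<And>j w. w \<in> U \<Longrightarrow> (affine_comp f j has_field_derivative deriv (affine_comp f j) w) (at w)"
    and "\<And>w. w \<in> U \<Longrightarrow> A w = affine_comp f 1 w * affine_comp f 2 w / wronskian (affine_comp f 1) (affine_comp f 2) w"
proof -
  obtain d1 where d1: "d1 > 0" "\<And>w. w \<in> ball z d1 \<Longrightarrow> branch (Fin w) f"
    "fundamental_system_on b1 b2 (ball z d1) (affine_comp f 1) (affine_comp f 2)"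
    using branch_fundamental_system[OF assms(1)] by metis
  obtain d2 where d2: "d2 > 0" "ball z d2 \<subseteq> N" using assms(2,3) open_contains_ball by blast
  let ?U = "ball z (min d1 d2)"
  have U: "z \<in> ?U" "?U \<subseteq> ball z d1" "?U \<subseteq> N" using d1(1) d2 by auto
  show ?thesis
  proof (rule that[OF convex_ball open_ball U(1,3)])
    show "(affine_comp f j has_field_derivative deriv (affine_comp f j) w) (at w)" if "w \<in> ?U" for j w
      using d1(3) U(2) that exhaust_2[of j] unfolding fundamental_system_on_def
      by (blast dest: solves_ode_onD(1))
    show "A w = affine_comp f 1 w * affine_comp f 2 w / wronskian (affine_comp f 1) (affine_comp f 2) w"
      if "w \<in> ?U" for w
      using sym_eq_of_branch(1)[OF d1(2)] that U(2) by (auto simp: sym_A_def)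
  qed
qed

lemma branch_quotient:
  assumes t: "t \<in> ball 0 e - {0}" and branch: "branch (chart p t) f"
    and A_nz: "\<And>t. t \<in> ball 0 e - {0} \<Longrightarrow> field_in_chart A p t \<noteq> 0"
    and K_deriv: "\<And>t. t \<in> ball 0 e - {0} \<Longrightarrow> (K has_field_derivative 1 / field_in_chart A p t) (at t)"
  obtains k where "\<forall>\<^sub>F q in nhds (chart p t). f q $ 2 - k * f q $ 1 * exp (K (the_inv (chart p) q)) = 0"
    and "f (chart p t) $ 2 \<noteq> 0"
proof -
  define z where "z = affine_coord p t"
  have z: "chart p t = Fin z" using t by (simp add: z_def chart_eq_Fin)
  define N where "N = Fin -` (chart p ` (ball 0 e - {0}))"
  have N_nbhd: "open N" "z \<in> N"
    using t unfolding N_def vimage_eq z[symmetric] by (auto intro!: open_vimage_Fin open_chart_image)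
  obtain U where U: "convex U" "open U" "z \<in> U" "U \<subseteq> N"
    and f_deriv: "\<And>j w. w \<in> U \<Longrightarrow> (affine_comp f j has_field_derivative deriv (affine_comp f j) w) (at w)"
    and A_eq: "\<And>w. w \<in> U \<Longrightarrow>
      A w = affine_comp f 1 w * affine_comp f 2 w / wronskian (affine_comp f 1) (affine_comp f 2) w"
    by (rule branch_field_on_neighbourhood[OF branch[unfolded z] N_nbhd]) (rule that, assumption+)
  have primitive: "A w \<noteq> 0" "((\<lambda>w. K (the_inv (chart p) (Fin w))) has_field_derivative 1 / A w) (at w)"
    if "w \<in> N" for w
    by (rule primitive_in_affine_part[where A = A], fact A_nz, fact K_deriv, fact that[unfolded N_def])+
  have f_nz: "affine_comp f j w \<noteq> 0" if "w \<in> U" for j w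
    using primitive(1)[OF subsetD[OF U(4) that]] exhaust_2[of j] by (auto simp: A_eq[OF that])
  have "((\<lambda>w. K (the_inv (chart p) (Fin w))) has_field_derivative
      wronskian (affine_comp f 1) (affine_comp f 2) w / (affine_comp f 1 w * affine_comp f 2 w)) (at w)"
    if "w \<in> U" for w
    using primitive(2)[OF subsetD[OF U(4) that]] by (simp add: A_eq[OF that])
  then obtain k where k: "\<And>w. w \<in> U \<Longrightarrow>
      affine_comp f 2 w = k * affine_comp f 1 w * exp (K (the_inv (chart p) (Fin w)))"
    using quotient_eq_exp_primitive[OF U(1) f_deriv f_nz f_deriv f_nz] by blast
  show ?thesis
  proof (rule that[of k])
    show "\<forall>\<^sub>F q in nhds (chart p t). f q $ 2 - k * f q $ 1 * exp (K (the_inv (chart p) q)) = 0"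
      unfolding z nhds_Fin eventually_filtermap
      by (rule eventually_mono[OF eventually_nhds_in_open[OF U(2,3)]]) (simp add: k)
    show "f (chart p t) $ 2 \<noteq> 0" using f_nz[OF U(3)] by (simp add: z)
  qed
qed

lemma local_monodromy_on_small_circle:
  assumes "e > 0" and g: "loop_around D x p g"
  obtains r f h where "0 < r" "r < e" "path_image (chart p \<circ> circlepath 0 r) \<subseteq> - D"
    and "branch (chart p (of_real r)) f" "continuation_along (chart p \<circ> circlepath 0 r) f h"
    and "f (chart p (of_real r)) = h (chart p (of_real r)) v* \<rho> (path_class (- D) g)"
proof -
  obtain d r where r: "0 < r" "r < e" "chart p ` (cball 0 r - {0}) \<inter> D = {}"
    and d: "path d" "path_image d \<subseteq> - D" "pathstart d = x" "pathfinish d = chart p (of_real r)"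
    and hom: "homotopic_paths (- D) g (d +++ (chart p \<circ> circlepath 0 r) +++ reversepath d)"
    using loop_around_small[OF g \<open>e > 0\<close>] .
  let ?P = "chart p (of_real r)" and ?c = "chart p \<circ> circlepath 0 r"
  have "path_image (circlepath 0 r) \<subseteq> cball 0 r - {0}" using r(1) by auto
  then have circle: "path ?c" "path_image ?c \<subseteq> - D" "pathstart ?c = ?P" "pathfinish ?c = ?P"
    unfolding path_image_compose using r(3)
    by (auto simp: path_chart_compose pathstart_compose pathfinish_compose)
  have extended: "path (d +++ ?c)" "path_image (d +++ ?c) \<subseteq> - D" "pathstart (d +++ ?c) = x" "pathfinish (d +++ ?c) = ?P"
    using d circle by (auto simp: path_image_join)
  obtain h where h: "continuation_along (d +++ ?c) Z h" using continuation_exists[OF extended(1-3)] .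
  obtain f where f: "continuation_along d Z f" "continuation_along ?c f h"
    using continuation_along_join_split[OF h] d(4) circle(3) by auto
  have "homotopic_paths (- D) (d +++ ?c +++ reversepath d) ((d +++ ?c) +++ reversepath d)"
    by (rule homotopic_paths_assoc) (use d circle in auto)
  then have "path_class (- D) g = path_class (- D) ((d +++ ?c) +++ reversepath d)"
    by (intro path_class_eqI homotopic_paths_trans[OF hom])
  then have "\<forall>\<^sub>F q in nhds ?P. f q = h q v* \<rho> (path_class (- D) g)"
    using continuations_differ_by_monodromy(2)[OF extended(1-3) h d(1-3) f(1)] extended(4) d(4) by simp
  then have "f ?P = h ?P v* \<rho> (path_class (- D) g)" by (rule eventually_nhds_x_imp_x)
  moreover have "branch ?P f" unfolding branch_def using d f(1) by blast
  ultimately show ?thesis using that r(1,2) circle(2) f(2) by blast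
qed

lemma local_monodromy_scalar:
  assumes "e > 0"
    and A_nz: "\<And>t. t \<in> ball 0 e - {0} \<Longrightarrow> field_in_chart A p t \<noteq> 0"
    and K_deriv: "\<And>t. t \<in> ball 0 e - {0} \<Longrightarrow> (K has_field_derivative 1 / field_in_chart A p t) (at t)"
    and g: "loop_around D x p g"
  shows "scalar_matrix (\<rho> (path_class (- D) g))"
proof -
  let ?R = "\<lambda>k q (h :: cp1 \<Rightarrow> complex^2).
    \<forall>\<^sub>F r in nhds q. h r $ 2 - k * h r $ 1 * exp (K (the_inv (chart p) r)) = 0"
  obtain r f h where r: "0 < r" "r < e" and branch: "branch (chart p (of_real r)) f"
    and continuation: "continuation_along (chart p \<circ> circlepath 0 r) f h"
      "f (chart p (of_real r)) = h (chart p (of_real r)) v* \<rho> (path_class (- D) g)"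
    using local_monodromy_on_small_circle[OF \<open>e > 0\<close> g] by metis
  let ?P = "chart p (of_real r)" and ?c = "chart p \<circ> circlepath 0 r"
  have base: "complex_of_real r \<in> ball 0 e - {0}" using r by simp
  obtain k where k: "?R k ?P f" "f ?P $ 2 \<noteq> 0" using branch_quotient[OF base branch A_nz K_deriv] by blast
  have "open (ball (0::complex) e - {0})" by auto
  then have "K analytic_on ball 0 e - {0}"
    using K_deriv by (subst analytic_on_open, simp, subst holomorphic_on_open) blast+
  then have local: "locally_constant_property (chart p ` (ball 0 e - {0})) (?R k)"
    by (rule locally_constant_property_exp_quotient)
  have "path ?c" "path_image ?c \<subseteq> chart p ` (ball 0 e - {0})"
    unfolding path_image_compose using r by (auto simp: path_chart_compose)
  from continuation_along_preserves[OF continuation(1) this local] have "?R k ?P h"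
    using k(1) by (simp add: pathstart_compose pathfinish_compose)
  then have "h ?P $ 2 = k * h ?P $ 1 * exp (K (the_inv (chart p) ?P))"
    using eventually_nhds_x_imp_x by fastforce
  moreover have "f ?P $ 2 = k * f ?P $ 1 * exp (K (the_inv (chart p) ?P))"
    using eventually_nhds_x_imp_x[OF k(1)] by simp
  moreover obtain a b where diag: "\<rho> (path_class (- D) g) = diag2 a b"
    using diagonal[OF loop_around_is_loop[OF g]] by blast
  ultimately have "b * h ?P $ 2 = a * h ?P $ 2" by (simp add: continuation(2))
  moreover have "h ?P $ 2 \<noteq> 0" using k(2) by (auto simp: continuation(2) diag)
  ultimately show ?thesis unfolding diag scalar_matrix_def by (auto simp: diag2_scalar)
qed

lemma exists_scalar_local_monodromy:
  assumes "card D = 3"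
  obtains p where "p \<in> D" "\<And>g. loop_around D x p g \<Longrightarrow> scalar_matrix (\<rho> (path_class (- D) g))"
proof (rule exists_primitive[OF assms])
  fix p e K assume "p \<in> D" "e > 0" "\<And>t. t \<in> ball 0 e - {0} \<Longrightarrow> field_in_chart A p t \<noteq> 0"
    "\<And>t. t \<in> ball 0 e - {0} \<Longrightarrow> (K has_field_derivative 1 / field_in_chart A p t) (at t)"
  then show ?thesis by (intro that[of p] local_monodromy_scalar[of e p K])
qed

end

section \<open>Ratios of linear forms on the sphere\<close>

text \<open>The linear form vanishing at \<open>a\<close>, evaluated at \<open>chart p t\<close> with homogeneous coordinates
  \<open>(c + t, 1)\<close> for \<open>p = Fin c\<close> and \<open>(1, t)\<close> for \<open>p = Infty\<close>.\<close>

fun linear_form :: "cp1 \<Rightarrow> cp1 \<Rightarrow> complex \<Rightarrow> complex" where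
  "linear_form (Fin c) (Fin a) t = c + t - a"
| "linear_form (Fin c) Infty t = 1"
| "linear_form Infty (Fin a) t = 1 - a * t"
| "linear_form Infty Infty t = t"

fun slope :: "cp1 \<Rightarrow> cp1 \<Rightarrow> complex" where
  "slope (Fin c) (Fin a) = 1"
| "slope (Fin c) Infty = 0"
| "slope Infty (Fin a) = - a"
| "slope Infty Infty = 1"

definition dlog :: "cp1 \<Rightarrow> cp1 \<Rightarrow> complex \<Rightarrow> complex" where
  "dlog p a t = slope p a / linear_form p a t"

definition ratio :: "cp1 \<Rightarrow> cp1 \<Rightarrow> cp1 \<Rightarrow> complex" where
  "ratio a b q = linear_form q a 0 / linear_form q b 0"

lemma linear_form_eq_slope: "linear_form p a = (\<lambda>t. linear_form p a 0 + slope p a * t)"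
  by (cases p; cases a) auto

lemma linear_form_eq_0_iff: "linear_form p a t = 0 \<longleftrightarrow> chart p t = a"
  by (cases p; cases a) (auto simp: field_simps split: if_splits)

lemma linear_form_self: "linear_form p p t = t" and slope_self: "slope p p = 1"
  by (cases p; simp)+

lemma DERIV_linear_form: "(linear_form p a has_field_derivative slope p a) (at t)"
  by (subst linear_form_eq_slope) (auto intro!: derivative_eq_intros)

lemma analytic_linear_form: "linear_form p a analytic_on S"
  by (subst linear_form_eq_slope) (intro analytic_intros)

lemma DERIV_dlog:
  assumes "chart p t \<noteq> a"
  shows "(dlog p a has_field_derivative - (dlog p a t)\<^sup>2) (at t)"
  unfolding dlog_def using assms
  by (auto intro!: derivative_eq_intros DERIV_linear_form simp: linear_form_eq_0_iff power2_eq_square)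

lemma analytic_dlog: "chart p t \<noteq> a \<Longrightarrow> dlog p a analytic_on {t}"
  unfolding dlog_def by (intro analytic_intros analytic_linear_form) (simp add: linear_form_eq_0_iff)

lemma dlog_Fin: "dlog (Fin 0) a (c + t) = dlog (Fin c) a t"
  by (cases a) (simp_all add: dlog_def)

lemma dlog_reciprocal:
  assumes "t \<noteq> 0" "Fin (1 / t) \<noteq> a"
  shows "dlog (Fin 0) a (1 / t) = t - t\<^sup>2 * dlog Infty a t"
proof (cases a)
  case (Fin b)
  then have "1 - b * t \<noteq> 0" using assms by (auto simp: field_simps)
  moreover have "1 / t - b = (1 - b * t) / t" using assms by (simp add: field_simps)
  ultimately show ?thesis using Fin assms by (simp add: dlog_def field_simps power2_eq_square)
qed (use assms in \<open>auto simp: dlog_def power2_eq_square\<close>)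

lemma dlog_neq:
  assumes "a \<noteq> b" "Fin w \<noteq> a" "Fin w \<noteq> b"
  shows "dlog (Fin 0) a w \<noteq> dlog (Fin 0) b w"
  using assms by (cases a; cases b) (auto simp: dlog_def field_simps)

lemma ratio_chart: "ratio a b (chart p t) = linear_form p a t / linear_form p b t"
proof (cases "t = 0 \<or> p \<noteq> Infty")
  case True
  then show ?thesis by (cases p; cases a; cases b) (auto simp: ratio_def)
next
  case False
  then show ?thesis by (cases a; cases b) (auto simp: ratio_def divide_simps)
qed

lemma ratio_nonzero: "q \<noteq> a \<Longrightarrow> q \<noteq> b \<Longrightarrow> ratio a b q \<noteq> 0"
  using linear_form_eq_0_iff[of q _ 0] by (auto simp: ratio_def)

lemma analytic_ratio:
  assumes "q \<noteq> b"
  shows "analytic_at_cp1 (ratio a b) q"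
proof -
  have "ratio a b \<circ> chart q = (\<lambda>t. linear_form q a t / linear_form q b t)"
    by (simp add: fun_eq_iff ratio_chart)
  then show ?thesis
    unfolding analytic_at_cp1_def
    using assms by (auto intro!: analytic_on_divide analytic_linear_form simp: linear_form_eq_0_iff)
qed

lemma eventually_ratio_positive:
  assumes "p \<noteq> a" "p \<noteq> b"
  shows "\<forall>\<^sub>F q in nhds p. 0 < Re (ratio a b q / ratio a b p)"
proof -
  have "((\<lambda>q. Re (ratio a b q / ratio a b p)) \<longlongrightarrow> Re (ratio a b p / ratio a b p)) (nhds p)"
    using assms by (intro tendsto_intros analytic_at_cp1_tendsto analytic_ratio ratio_nonzero)
  then show ?thesis
    using ratio_nonzero[OF assms] by (intro order_tendstoD(1)[where y = "Re (ratio a b p / ratio a b p)"]) auto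
qed

lemma continuous_on_ratio: "b \<notin> S \<Longrightarrow> continuous_on S (ratio a b)"
  unfolding continuous_on_def at_within_def
  by (blast intro: tendsto_mono[OF inf_le1] analytic_at_cp1_tendsto analytic_ratio)

definition log_germ :: "cp1 \<Rightarrow> cp1 \<Rightarrow> complex \<Rightarrow> cp1 \<Rightarrow> cp1 \<Rightarrow> complex" where
  "log_germ a b c p q = c + Ln (ratio a b q / ratio a b p)"

lemma analytic_log_germ:
  assumes "p \<noteq> a" "p \<noteq> b"
  shows "analytic_at_cp1 (log_germ a b c p) p"
proof -
  have "(ratio a b \<circ> chart p) analytic_on {0}"
    using analytic_ratio[OF assms(2)] by (simp add: analytic_at_cp1_def)
  then show ?thesis
    unfolding analytic_at_cp1_def log_germ_def o_def
    using ratio_nonzero[OF assms] by (intro analytic_intros) (auto simp: o_def)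
qed

lemma DERIV_log_germ:
  assumes "0 < Re (ratio a b (Fin w) / ratio a b p)" "Fin w \<noteq> a" "Fin w \<noteq> b"
  shows "((\<lambda>w. log_germ a b c p (Fin w)) has_field_derivative dlog (Fin 0) a w - dlog (Fin 0) b w) (at w)"
proof -
  let ?fa = "linear_form (Fin 0) a" and ?fb = "linear_form (Fin 0) b" and ?r = "ratio a b p"
  have ratio_eq: "ratio a b (Fin w) = ?fa w / ?fb w" for w using ratio_chart[of a b "Fin 0" w] by simp
  have nonzero: "?fa w \<noteq> 0" "?fb w \<noteq> 0" "?r \<noteq> 0" using assms by (auto simp: linear_form_eq_0_iff)
  let ?d = "(slope (Fin 0) a * ?fb w - ?fa w * slope (Fin 0) b) / (?fb w * ?fb w) / ?r"
  have ratio: "((\<lambda>w. ?fa w / ?fb w / ?r) has_field_derivative ?d) (at w)"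
    by (intro DERIV_cdivide DERIV_divide DERIV_linear_form nonzero)
  have "?fa w / ?fb w / ?r \<notin> \<real>\<^sub>\<le>\<^sub>0"
    using assms(1) unfolding ratio_eq by (auto simp: complex_nonpos_Reals_iff)
  from DERIV_chain2[OF has_field_derivative_Ln[OF this] ratio]
  have "((\<lambda>w. c + Ln (?fa w / ?fb w / ?r)) has_field_derivative 0 + inverse (?fa w / ?fb w / ?r) * ?d) (at w)"
    by (intro DERIV_add DERIV_const)
  then show ?thesis
    unfolding log_germ_def ratio_eq by (rule DERIV_cong) (use nonzero in \<open>simp add: dlog_def field_simps\<close>)
qed

lemma log_germ_coherent:
  assumes \<gamma>: "path \<gamma>" and l: "continuous_on {0..1} l" "\<And>s. s \<in> {0..1} \<Longrightarrow> ratio a b (\<gamma> s) = exp (l s)"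
    and avoids: "\<And>s. s \<in> {0..1} \<Longrightarrow> \<gamma> s \<noteq> a \<and> \<gamma> s \<noteq> b" and s: "s \<in> {0..1}"
  shows "\<forall>\<^sub>F u in at s within {0..1}. \<forall>\<^sub>F q in nhds (\<gamma> u).
           log_germ a b (l u) (\<gamma> u) q = log_germ a b (l s) (\<gamma> s) q"
proof -
  have "\<forall>\<^sub>F q in nhds (\<gamma> s). \<forall>\<^sub>F r in nhds q. 0 < Re (ratio a b r / ratio a b (\<gamma> s))"
    using eventually_ratio_positive[of "\<gamma> s" a b] avoids[OF s] by (simp add: eventually_eventually)
  then have positive: "\<forall>\<^sub>F u in at s within {0..1}. \<forall>\<^sub>F r in nhds (\<gamma> u). 0 < Re (ratio a b r / ratio a b (\<gamma> s))"
    by (rule eventually_path_at[OF \<gamma> s])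
  have "(l \<longlongrightarrow> l s) (at s within {0..1})" using l(1) s by (simp add: continuous_on_def)
  then have close: "\<forall>\<^sub>F u in at s within {0..1}. dist (l u) (l s) < pi / 2"
    by (rule tendstoD) simp
  have "\<forall>\<^sub>F u in at s within {0..1}. u \<in> {0..1}" by (simp add: eventually_at_filter)
  with positive close show ?thesis
  proof eventually_elim
    case (elim u)
    have "\<forall>\<^sub>F q in nhds (\<gamma> u). 0 < Re (ratio a b q / ratio a b (\<gamma> u))"
      using eventually_ratio_positive avoids[OF elim(3)] by blast
    with elim(1) show ?case
    proof eventually_elim
      case (elim q)
      let ?u = "ratio a b q / ratio a b (\<gamma> u)" and ?s = "ratio a b q / ratio a b (\<gamma> s)"
      have nonzero: "?u \<noteq> 0" "?s \<noteq> 0" using elim by auto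
      have Im_small: "\<bar>Im (Ln ?u)\<bar> < pi / 2" "\<bar>Im (Ln ?s)\<bar> < pi / 2"
        using elim by (simp_all only: Re_Ln_pos_lt[OF nonzero(1)] Re_Ln_pos_lt[OF nonzero(2)])
      have "\<bar>Im (l u - l s)\<bar> < pi / 2"
        using \<open>dist (l u) (l s) < pi / 2\<close> abs_Im_le_cmod[of "l u - l s"] by (simp add: dist_norm)
      then have "\<bar>Im (l u + Ln ?u) - Im (l s + Ln ?s)\<bar> < 2 * pi"
        using Im_small pi_gt_zero unfolding plus_complex.simps minus_complex.simps by linarith
      moreover have "exp (l u + Ln ?u) = exp (l s + Ln ?s)"
        using nonzero l(2)[OF s] l(2)[OF \<open>u \<in> {0..1}\<close>] by (simp add: exp_add)
      ultimately show ?case unfolding log_germ_def by (rule exp_complex_eqI)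
    qed
  qed
qed

section \<open>Winding numbers of ratios\<close>

lemma winding_number_divide:
  assumes "path f" "0 \<notin> path_image f" "path g" "0 \<notin> path_image g"
  shows "winding_number (\<lambda>t. f t / g t) 0 = winding_number f 0 - winding_number g 0"
proof -
  obtain k where k: "path k" "pathfinish k - pathstart k = 2 * of_real pi * \<i> * winding_number f 0"
    "\<And>t. t \<in> {0..1} \<Longrightarrow> f t = 0 + exp (k t)"
    using winding_number_as_continuous_log[OF assms(1,2)] by blast
  obtain l where l: "path l" "pathfinish l - pathstart l = 2 * of_real pi * \<i> * winding_number g 0"
    "\<And>t. t \<in> {0..1} \<Longrightarrow> g t = 0 + exp (l t)"
    using winding_number_as_continuous_log[OF assms(3,4)] by blast
  let ?m = "\<lambda>t. k t - l t"
  have "winding_number (\<lambda>t. f t / g t) 0 = winding_number (exp \<circ> ?m) 0"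
    by (rule winding_number_cong) (use k(3) l(3) in \<open>auto simp: exp_diff\<close>)
  also have "path ?m" using k(1) l(1) unfolding path_def by (intro continuous_intros)
  then have "winding_number (exp \<circ> ?m) 0 = (pathfinish ?m - pathstart ?m) / (2 * of_real pi * \<i>)"
    by (rule winding_number_compose_exp)
  also have "pathfinish ?m - pathstart ?m = (pathfinish k - pathstart k) - (pathfinish l - pathstart l)"
    by (simp add: pathfinish_def pathstart_def)
  also have "\<dots> / (2 * of_real pi * \<i>) = winding_number f 0 - winding_number g 0"
    unfolding k(2) l(2) by (simp add: diff_divide_distrib)
  finally show ?thesis .
qed

lemma path_linear_form_circlepath: "path (linear_form p a \<circ> circlepath 0 r)"
  by (intro path_continuous_image path_circlepath continuous_at_imp_continuous_on ballI DERIV_isCont[OF DERIV_linear_form])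

lemma winding_number_linear_form_circlepath:
  assumes "r > 0" and nz: "\<And>t. t \<noteq> 0 \<Longrightarrow> norm t \<le> r \<Longrightarrow> chart p t \<noteq> a"
  shows "winding_number (linear_form p a \<circ> circlepath 0 r) 0 = of_bool (p = a)"
proof (cases "p = a")
  case True
  then show ?thesis using \<open>r > 0\<close> by (simp add: o_def linear_form_self winding_number_circlepath_centre)
next
  case False
  let ?S = "linear_form p a ` cball 0 r"
  have "?S = (+) (linear_form p a 0) ` ((*) (slope p a) ` cball 0 r)"
    by (subst linear_form_eq_slope) (simp add: image_image)
  then have "convex ?S"
    by (auto intro!: convex_translation convex_linear_image bounded_linear.linear bounded_linear_mult_right)
  moreover have "0 \<notin> ?S"
  proof
    assume "0 \<in> ?S"
    then obtain t where "norm t \<le> r" "chart p t = a" by (auto simp: linear_form_eq_0_iff)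
    then show False using nz[of t] False by (cases "t = 0") auto
  qed
  moreover have "path_image (linear_form p a \<circ> circlepath 0 r) \<subseteq> ?S"
    unfolding path_image_compose using \<open>r > 0\<close> by auto
  ultimately show ?thesis
    using False path_linear_form_circlepath
    by (simp add: winding_number_zero_outside[of _ ?S] pathstart_compose pathfinish_compose)
qed

definition turns :: "cp1 \<Rightarrow> cp1 \<Rightarrow> (real \<Rightarrow> cp1) \<Rightarrow> complex" where
  "turns a b g = winding_number (ratio a b \<circ> g) 0"

lemma turns_circle:
  assumes "r > 0" and nz: "\<And>t. t \<noteq> 0 \<Longrightarrow> norm t \<le> r \<Longrightarrow> chart p t \<noteq> a \<and> chart p t \<noteq> b"
  shows "turns a b (chart p \<circ> circlepath 0 r) = of_bool (p = a) - of_bool (p = b)"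
proof -
  have "0 \<notin> path_image (linear_form p c \<circ> circlepath 0 r)" if "c \<in> {a, b}" for c
    using assms that by (fastforce simp: path_image_compose linear_form_eq_0_iff)
  moreover have "ratio a b \<circ> (chart p \<circ> circlepath 0 r)
      = (\<lambda>s. (linear_form p a \<circ> circlepath 0 r) s / (linear_form p b \<circ> circlepath 0 r) s)"
    by (simp add: fun_eq_iff ratio_chart)
  ultimately show ?thesis
    unfolding turns_def using assms
    by (simp only: winding_number_divide path_linear_form_circlepath insert_iff simp_thms
        winding_number_linear_form_circlepath)
qed

lemma ratio_path:
  assumes "path g" "path_image g \<subseteq> - D" "a \<in> D" "b \<in> D"
  shows "path (ratio a b \<circ> g)" "0 \<notin> path_image (ratio a b \<circ> g)"
proof -
  show "path (ratio a b \<circ> g)"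
    using assms by (intro path_continuous_image continuous_on_ratio) auto
  show "0 \<notin> path_image (ratio a b \<circ> g)"
  proof
    assume "0 \<in> path_image (ratio a b \<circ> g)"
    then obtain q where "q \<in> path_image g" "ratio a b q = 0" unfolding path_image_compose by force
    then show False using assms(2-4) ratio_nonzero[of q a b] by blast
  qed
qed

lemma turns_homotopic:
  assumes "homotopic_paths (- D) g h" "a \<in> D" "b \<in> D"
  shows "turns a b g = turns a b h"
proof -
  have "ratio a b q \<noteq> 0" if "q \<notin> D" for q using that assms(2,3) by (intro ratio_nonzero) auto
  then have "ratio a b \<in> - D \<rightarrow> - {0}" by auto
  then show ?thesis
    unfolding turns_def using assms(1,3)
    by (intro winding_number_homotopic_paths homotopic_paths_continuous_image[OF assms(1)] continuous_on_ratio)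
      auto
qed

lemma turns_join:
  assumes "path g" "path_image g \<subseteq> - D" "path h" "path_image h \<subseteq> - D" "pathfinish g = pathstart h" "a \<in> D" "b \<in> D"
  shows "turns a b (g +++ h) = turns a b g + turns a b h"
  unfolding turns_def path_compose_join
  using ratio_path assms by (intro winding_number_join) (auto simp: pathstart_compose pathfinish_compose)

lemma turns_reversepath:
  assumes "path g" "path_image g \<subseteq> - D" "a \<in> D" "b \<in> D"
  shows "turns a b (reversepath g) = - turns a b g"
  unfolding turns_def path_compose_reversepath
  using ratio_path assms by (intro winding_number_reversepath) auto

lemma turns_loop_around:
  assumes "loop_around D x p g" "a \<in> D" "b \<in> D"
  shows "turns a b g = of_bool (p = a) - of_bool (p = b)"
proof -
  obtain d r where r: "0 < r" "chart p ` (cball 0 r - {0}) \<inter> D = {}"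
    and d: "path d" "path_image d \<subseteq> - D" "pathfinish d = chart p (of_real r)"
    and hom: "homotopic_paths (- D) g (d +++ (chart p \<circ> circlepath 0 r) +++ reversepath d)"
    using assms(1) unfolding loop_around_def by blast
  let ?c = "chart p \<circ> circlepath 0 r"
  have "path_image (circlepath 0 r) \<subseteq> cball 0 r - {0}" using r(1) by auto
  then have "path_image ?c \<subseteq> - D" unfolding path_image_compose using r(2) by blast
  then have circle: "path ?c" "path_image ?c \<subseteq> - D" "pathstart ?c = pathfinish d" "pathfinish ?c = pathfinish d"
    by (simp_all add: d(3) path_chart_compose pathstart_compose pathfinish_compose)
  have "turns a b g = turns a b (d +++ ?c +++ reversepath d)"
    by (rule turns_homotopic[OF hom assms(2,3)])
  also have "\<dots> = turns a b d + turns a b (?c +++ reversepath d)"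
    by (rule turns_join[OF d(1,2) _ _ _ assms(2,3)]) (use circle d in \<open>auto simp: path_image_join\<close>)
  also have "turns a b (?c +++ reversepath d) = turns a b ?c + turns a b (reversepath d)"
    by (rule turns_join[OF circle(1,2) _ _ _ assms(2,3)]) (use circle d in auto)
  also have "turns a b (reversepath d) = - turns a b d" by (rule turns_reversepath[OF d(1,2) assms(2,3)])
  also have "turns a b ?c = of_bool (p = a) - of_bool (p = b)"
    using r(2) assms(2,3) by (intro turns_circle r(1)) (auto simp: disjoint_iff)
  finally show ?thesis by simp
qed

lemma continuous_log_of_ratio:
  assumes "path g" "path_image g \<subseteq> - D" "a \<in> D" "b \<in> D" and c: "exp c = ratio a b (pathstart g)"
  obtains k where "continuous_on {0..1} k" "\<And>s. s \<in> {0..1} \<Longrightarrow> ratio a b (g s) = exp (k s)"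
    "k 0 = c" "k 1 = c + 2 * of_real pi * \<i> * turns a b g"
proof -
  obtain k where k: "path k" "pathfinish k - pathstart k = 2 * of_real pi * \<i> * turns a b g"
    "\<And>s. s \<in> {0..1} \<Longrightarrow> (ratio a b \<circ> g) s = 0 + exp (k s)"
    using winding_number_as_continuous_log[OF ratio_path[OF assms(1-4)]] unfolding turns_def by blast
  have "exp c = exp (k 0)" using k(3)[of 0] c by (simp add: pathstart_def)
  show ?thesis
  proof (rule that[of "\<lambda>s. c + (k s - k 0)"])
    show "continuous_on {0..1} (\<lambda>s. c + (k s - k 0))"
      using k(1) unfolding path_def by (intro continuous_intros)
    show "ratio a b (g s) = exp (c + (k s - k 0))" if "s \<in> {0..1}" for s
      using k(3)[OF that] \<open>exp c = exp (k 0)\<close> by (simp add: exp_add exp_diff)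
  qed (use k(2) in \<open>simp_all add: pathstart_def pathfinish_def\<close>)
qed

section \<open>Poles of bounded order\<close>

lemma analytic_imp_pole_order_at_most_0: "f analytic_on {0} \<Longrightarrow> pole_order_at_most 0 f"
  unfolding pole_order_at_most_def by (intro exI[of _ f]) simp

lemma pole_order_at_most_mono:
  assumes "pole_order_at_most k f" "k \<le> n"
  shows "pole_order_at_most n f"
proof -
  obtain g where g: "g analytic_on {0}" "\<forall>\<^sub>F t in at 0. f t = g t / t ^ k"
    using assms(1) unfolding pole_order_at_most_def by blast
  have "t ^ n = t ^ k * t ^ (n - k)" for t :: complex using assms(2) by (simp add: power_add[symmetric])
  then have "\<forall>\<^sub>F t in at 0. f t = (g t * t ^ (n - k)) / t ^ n"
    using g(2) unfolding eventually_at_filter by (auto elim: eventually_mono)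
  moreover have "(\<lambda>t. g t * t ^ (n - k)) analytic_on {0}" using g(1) by (intro analytic_intros)
  ultimately show ?thesis unfolding pole_order_at_most_def by blast
qed

lemma pole_order_at_most_add:
  assumes "pole_order_at_most k f" "pole_order_at_most k g"
  shows "pole_order_at_most k (\<lambda>t. f t + g t)"
proof -
  obtain F G where F: "F analytic_on {0}" "\<forall>\<^sub>F t in at 0. f t = F t / t ^ k"
    and G: "G analytic_on {0}" "\<forall>\<^sub>F t in at 0. g t = G t / t ^ k"
    using assms unfolding pole_order_at_most_def by blast
  have "\<forall>\<^sub>F t in at 0. f t + g t = (F t + G t) / t ^ k"
    using F(2) G(2) by eventually_elim (simp add: add_divide_distrib)
  moreover have "(\<lambda>t. F t + G t) analytic_on {0}" using F(1) G(1) by (intro analytic_intros)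
  ultimately show ?thesis unfolding pole_order_at_most_def by blast
qed

lemma pole_order_at_most_mult:
  assumes "pole_order_at_most k f" "pole_order_at_most n g"
  shows "pole_order_at_most (k + n) (\<lambda>t. f t * g t)"
proof -
  obtain F G where F: "F analytic_on {0}" "\<forall>\<^sub>F t in at 0. f t = F t / t ^ k"
    and G: "G analytic_on {0}" "\<forall>\<^sub>F t in at 0. g t = G t / t ^ n"
    using assms unfolding pole_order_at_most_def by blast
  have "\<forall>\<^sub>F t in at 0. f t * g t = (F t * G t) / t ^ (k + n)"
    using F(2) G(2) by eventually_elim (simp add: power_add)
  moreover have "(\<lambda>t. F t * G t) analytic_on {0}" using F(1) G(1) by (intro analytic_intros)
  ultimately show ?thesis unfolding pole_order_at_most_def by blast
qed

lemma pole_order_at_most_cmult: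
  assumes "pole_order_at_most k f"
  shows "pole_order_at_most k (\<lambda>t. c * f t)"
  using pole_order_at_most_mult[OF analytic_imp_pole_order_at_most_0 assms, of "\<lambda>_. c"] by simp

lemma pole_order_at_most_diff:
  "pole_order_at_most k f \<Longrightarrow> pole_order_at_most k g \<Longrightarrow> pole_order_at_most k (\<lambda>t. f t - g t)"
  using pole_order_at_most_add[of k f "\<lambda>t. - 1 * g t"] pole_order_at_most_cmult[of k g "- 1"] by simp

lemmas pole_order_at_most_intros =
  pole_order_at_most_add pole_order_at_most_diff pole_order_at_most_cmult pole_order_at_most_mult

lemma pole_order_at_most_cong:
  assumes "\<forall>\<^sub>F t in at 0. f t = g t"
  shows "pole_order_at_most k f \<longleftrightarrow> pole_order_at_most k g"
proof -
  have "(\<forall>\<^sub>F t in at 0. f t = h t / t ^ k) \<longleftrightarrow> (\<forall>\<^sub>F t in at 0. g t = h t / t ^ k)" for h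
    using assms by (rule eventually_cong) simp
  then show ?thesis by (simp add: pole_order_at_most_def)
qed

lemma pole_order_dlog: "pole_order_at_most (of_bool (p = a)) (dlog p a)"
proof (cases "p = a")
  case True
  then have "dlog p a = (\<lambda>t. 1 / t)" by (simp add: dlog_def fun_eq_iff linear_form_self slope_self)
  then show ?thesis
    using True unfolding pole_order_at_most_def by (intro exI[of _ "\<lambda>t. 1"]) auto
qed (simp add: analytic_imp_pole_order_at_most_0 analytic_dlog)

section \<open>Equations with power solutions\<close>

lemma ode_lhs_log_derivative:
  assumes f_log_deriv: "\<forall>\<^sub>F w in nhds z. (f has_field_derivative r w * f w) (at w)" and r_deriv: "(r has_field_derivative r') (at z)"
  shows "ode_lhs b1 b2 f z = (r' + (r z)\<^sup>2 + b1 z * r z + b2 z) * f z"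
proof -
  have f_deriv: "(f has_field_derivative r z * f z) (at z)" by (rule eventually_nhds_x_imp_x[OF f_log_deriv])
  have "\<forall>\<^sub>F w in nhds z. deriv f w = r w * f w" using f_log_deriv by eventually_elim (rule DERIV_imp_deriv)
  from deriv_cong_ev[OF this refl] have "deriv (deriv f) z = deriv (\<lambda>w. r w * f w) z" .
  also have "\<dots> = r' * f z + r z * f z * r z" by (rule DERIV_imp_deriv[OF DERIV_mult[OF r_deriv f_deriv]])
  finally show ?thesis
    using DERIV_imp_deriv[OF f_deriv] by (simp add: ode_lhs_def algebra_simps power2_eq_square)
qed

text \<open>The factor by which the inverse of \<open>exp (c log h)\<close> is multiplied when \<open>h\<close> turns once around the
  origin.\<close>

definition turn_factor :: "complex \<Rightarrow> complex" where
  "turn_factor c = exp (- (2 * of_real pi * \<i> * c))"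

lemma turn_factor_nonzero: "turn_factor c \<noteq> 0"
  by (simp add: turn_factor_def)

lemma turn_factor_0: "turn_factor 0 = 1"
  by (simp add: turn_factor_def)

lemma turn_factor_1: "turn_factor 1 = 1"
  by (simp add: turn_factor_def exp_minus)

lemma turn_factor_add: "turn_factor (c + d) = turn_factor c * turn_factor d"
  by (simp add: turn_factor_def exp_add[symmetric] algebra_simps)

lemma turn_factor_minus: "turn_factor (- c) = 1 / turn_factor c"
  by (simp add: turn_factor_def exp_minus divide_inverse)

lemma turn_factor_surj:
  assumes "z \<noteq> 0"
  obtains c where "turn_factor c = z"
  using assms by (intro that[of "- Ln z / (2 * of_real pi * \<i>)"]) (simp add: turn_factor_def)

lemma turn_factor_surj_nonzero:
  assumes "z \<noteq> 0"
  obtains c where "c \<noteq> 0" "turn_factor c = z"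
proof -
  obtain c where "turn_factor c = z" using turn_factor_surj[OF assms] .
  then show ?thesis using that[of c] that[of 1] turn_factor_0 turn_factor_1 by (cases "c = 0") auto
qed

locale three_points =
  fixes p1 p2 p3 :: cp1
  assumes distinct: "p1 \<noteq> p2" "p1 \<noteq> p3" "p2 \<noteq> p3"
begin

abbreviation D :: "cp1 set" where "D \<equiv> {p1, p2, p3}"

lemma finite_D: "finite D"
  by simp

text \<open>A branch near \<open>p\<close> of \<open>(e1 / e3)\<^sup>s (e2 / e3)\<^sup>t\<close>, where \<open>ei\<close> is the linear form vanishing at \<open>pi\<close>, and
  \<open>a\<close> and \<open>b\<close> are logarithms of the two ratios at \<open>p\<close>; and its logarithmic derivative in the coordinate at
  \<open>p\<close>.\<close>

definition power_germ :: "complex \<Rightarrow> complex \<Rightarrow> complex \<Rightarrow> complex \<Rightarrow> cp1 \<Rightarrow> cp1 \<Rightarrow> complex" where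
  "power_germ s t a b p q = exp (s * log_germ p1 p3 a p q + t * log_germ p2 p3 b p q)"

definition log_deriv :: "complex \<Rightarrow> complex \<Rightarrow> cp1 \<Rightarrow> complex \<Rightarrow> complex" where
  "log_deriv s t p z = s * dlog p p1 z + t * dlog p p2 z - (s + t) * dlog p p3 z"

definition multiplier :: "complex \<Rightarrow> complex \<Rightarrow> (real \<Rightarrow> cp1) \<Rightarrow> complex" where
  "multiplier s t g = turn_factor (s * turns p1 p3 g + t * turns p2 p3 g)"

definition positive_near :: "cp1 \<Rightarrow> cp1 set" where
  "positive_near p =
     {q. q \<notin> D \<and> 0 < Re (ratio p1 p3 q / ratio p1 p3 p) \<and> 0 < Re (ratio p2 p3 q / ratio p2 p3 p)}"

lemma eventually_positive_near:
  assumes "p \<notin> D"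
  shows "\<forall>\<^sub>F q in nhds p. q \<in> positive_near p"
proof -
  have "\<forall>\<^sub>F q in nhds p. 0 < Re (ratio p1 p3 q / ratio p1 p3 p)"
    "\<forall>\<^sub>F q in nhds p. 0 < Re (ratio p2 p3 q / ratio p2 p3 p)"
    using assms by (intro eventually_ratio_positive; simp)+
  moreover have "\<forall>\<^sub>F q in nhds p. q \<in> - D"
    using assms by (intro eventually_nhds_in_open open_Compl finite_imp_closed finite_D) auto
  ultimately show ?thesis unfolding positive_near_def by eventually_elim auto
qed

lemma analytic_power_germ:
  assumes "p \<notin> D"
  shows "analytic_at_cp1 (power_germ s t a b p) p"
proof -
  have "analytic_at_cp1 (log_germ p1 p3 a p) p" "analytic_at_cp1 (log_germ p2 p3 b p) p"
    using assms by (auto intro: analytic_log_germ)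
  then show ?thesis
    unfolding analytic_at_cp1_def power_germ_def o_def by (intro analytic_intros)
qed

lemma power_germ_nonzero: "power_germ s t a b p q \<noteq> 0"
  by (simp add: power_germ_def)

lemma DERIV_power_germ:
  assumes "Fin w \<in> positive_near p"
  shows "((\<lambda>w. power_germ s t a b p (Fin w)) has_field_derivative
    log_deriv s t (Fin 0) w * power_germ s t a b p (Fin w)) (at w)"
proof -
  have "((\<lambda>w. log_germ p1 p3 a p (Fin w)) has_field_derivative dlog (Fin 0) p1 w - dlog (Fin 0) p3 w) (at w)"
    and "((\<lambda>w. log_germ p2 p3 b p (Fin w)) has_field_derivative dlog (Fin 0) p2 w - dlog (Fin 0) p3 w) (at w)"
    using assms by (auto simp: positive_near_def intro!: DERIV_log_germ)
  from DERIV_fun_exp[OF DERIV_add[OF DERIV_cmult[OF this(1)] DERIV_cmult[OF this(2)]]]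
  show ?thesis unfolding power_germ_def by (rule DERIV_cong) (simp add: log_deriv_def algebra_simps)
qed

lemma DERIV_log_deriv:
  assumes "Fin w \<notin> D"
  shows "(log_deriv s t (Fin 0) has_field_derivative
    - (s * (dlog (Fin 0) p1 w)\<^sup>2 + t * (dlog (Fin 0) p2 w)\<^sup>2 - (s + t) * (dlog (Fin 0) p3 w)\<^sup>2)) (at w)"
proof -
  have "(dlog (Fin 0) p has_field_derivative - (dlog (Fin 0) p w)\<^sup>2) (at w)" if "p \<in> D" for p
    using assms that by (intro DERIV_dlog) auto
  note dlogs = this[of p1, simplified] this[of p2, simplified] this[of p3, simplified]
  show ?thesis unfolding log_deriv_def by (rule derivative_eq_intros refl dlogs)+ (simp add: algebra_simps)
qed

lemma log_deriv_Fin: "log_deriv s t (Fin 0) (c + z) = log_deriv s t (Fin c) z"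
  by (simp add: log_deriv_def dlog_Fin)

lemma log_deriv_reciprocal:
  assumes "z \<noteq> 0" "Fin (1 / z) \<notin> D"
  shows "log_deriv s t (Fin 0) (1 / z) = - z\<^sup>2 * log_deriv s t Infty z"
  using assms by (simp add: log_deriv_def dlog_reciprocal algebra_simps)

lemma power_germ_turns:
  "power_germ s t a b p q = power_germ s t (a + 2 * of_real pi * \<i> * n1) (b + 2 * of_real pi * \<i> * n2) p q
    * turn_factor (s * n1 + t * n2)"
  by (simp add: power_germ_def log_germ_def turn_factor_def exp_add[symmetric] algebra_simps)

lemma multiplier_homotopic: "homotopic_paths (- D) g h \<Longrightarrow> multiplier s t g = multiplier s t h"
  by (simp add: multiplier_def turns_homotopic[of D])

lemma multiplier_join:
  assumes "is_loop (- D) x g" "is_loop (- D) x h"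
  shows "multiplier s t (g +++ h) = multiplier s t g * multiplier s t h"
proof -
  have "turns a b (g +++ h) = turns a b g + turns a b h" if "a \<in> D" "b \<in> D" for a b
    using assms that by (intro turns_join[of _ D]) (auto simp: is_loop_def)
  then show ?thesis by (simp add: multiplier_def turn_factor_add[symmetric] algebra_simps)
qed

lemma multiplier_loop_around:
  assumes "loop_around D x p g"
  shows "multiplier s t g =
    turn_factor (s * (of_bool (p = p1) - of_bool (p = p3)) + t * (of_bool (p = p2) - of_bool (p = p3)))"
  using turns_loop_around[OF assms] by (simp add: multiplier_def)

end

text \<open>The coefficients, in the coordinate at \<open>p\<close>, of the equation solved by the powers with exponents
  \<open>(l, m)\<close> and \<open>(l + \<nu>, m - \<nu>)\<close>.\<close>

locale power_solutions = three_points +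
  fixes l m \<nu> :: complex
  assumes \<nu>_nonzero: "\<nu> \<noteq> 0"
begin

definition power_b1 :: "cp1 \<Rightarrow> complex \<Rightarrow> complex" where
  "power_b1 p z = dlog p p1 z + dlog p p2 z - log_deriv l m p z - log_deriv (l + \<nu>) (m - \<nu>) p z"

definition power_b2 :: "cp1 \<Rightarrow> complex \<Rightarrow> complex" where
  "power_b2 p z = l * (dlog p p1 z * dlog p p1 z) + m * (dlog p p2 z * dlog p p2 z)
     - (l + m) * (dlog p p3 z * dlog p p3 z)
     - log_deriv l m p z * (dlog p p1 z + dlog p p2 z - log_deriv (l + \<nu>) (m - \<nu>) p z)"

lemma pole_order_power_coefficients:
  assumes "\<And>a. a \<in> D \<Longrightarrow> pole_order_at_most k (dlog p a)"
  shows "pole_order_at_most k (power_b1 p)" "pole_order_at_most (k + k) (power_b2 p)"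
proof -
  have dlogs: "pole_order_at_most k (dlog p p1)" "pole_order_at_most k (dlog p p2)" "pole_order_at_most k (dlog p p3)"
    using assms by auto
  have log_derivs: "pole_order_at_most k (log_deriv s t p)" for s t
    unfolding log_deriv_def by (intro pole_order_at_most_intros dlogs)
  show "pole_order_at_most k (power_b1 p)" unfolding power_b1_def by (intro pole_order_at_most_intros dlogs log_derivs)
  show "pole_order_at_most (k + k) (power_b2 p)"
    unfolding power_b2_def by (intro pole_order_at_most_intros dlogs log_derivs)
qed

lemma power_coefficients_reciprocal:
  assumes "t \<noteq> 0" "Fin (1 / t) \<notin> D"
  shows "power_b1 (Fin 0) (1 / t) = 2 * t - t\<^sup>2 * power_b1 Infty t"
    and "power_b2 (Fin 0) (1 / t) = t ^ 4 * power_b2 Infty t"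
proof -
  have dlogs: "dlog (Fin 0) a (1 / t) = t - t\<^sup>2 * dlog Infty a t" if "a \<in> D" for a
    using assms that by (intro dlog_reciprocal) auto
  note dlogs = dlogs[of p1, simplified] dlogs[of p2, simplified] dlogs[of p3, simplified]
  note log_derivs = log_deriv_reciprocal[OF assms]
  show "power_b1 (Fin 0) (1 / t) = 2 * t - t\<^sup>2 * power_b1 Infty t"
    unfolding power_b1_def dlogs log_derivs by (simp add: algebra_simps)
  have squares: "l * (dlog (Fin 0) p1 (1 / t) * dlog (Fin 0) p1 (1 / t))
      + m * (dlog (Fin 0) p2 (1 / t) * dlog (Fin 0) p2 (1 / t))
      - (l + m) * (dlog (Fin 0) p3 (1 / t) * dlog (Fin 0) p3 (1 / t)) =
    t ^ 4 * (l * (dlog Infty p1 t * dlog Infty p1 t) + m * (dlog Infty p2 t * dlog Infty p2 t)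
      - (l + m) * (dlog Infty p3 t * dlog Infty p3 t)) - 2 * t ^ 3 * log_deriv l m Infty t"
    unfolding dlogs log_deriv_def
    by (simp add: algebra_simps power2_eq_square power3_eq_cube power4_eq_xxxx)
  show "power_b2 (Fin 0) (1 / t) = t ^ 4 * power_b2 Infty t"
    unfolding power_b2_def squares log_derivs unfolding dlogs
    by (simp add: algebra_simps power2_eq_square power3_eq_cube power4_eq_xxxx)
qed

lemma power_coefficients_in_chart:
  "\<forall>\<^sub>F t in at 0. coeff1 (power_b1 (Fin 0)) p t = power_b1 p t"
  "\<forall>\<^sub>F t in at 0. coeff2 (power_b2 (Fin 0)) p t = power_b2 p t"
proof -
  obtain e where e: "e > 0" "\<And>t. t \<in> ball 0 e - {0} \<Longrightarrow> chart p t \<notin> D"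
    using punctured_chart_ball[OF finite_D, of p] by blast
  have "coeff1 (power_b1 (Fin 0)) p t = power_b1 p t \<and> coeff2 (power_b2 (Fin 0)) p t = power_b2 p t"
    if t: "t \<in> ball 0 e - {0}" for t
  proof (cases p)
    case (Fin c)
    then show ?thesis by (simp add: power_b1_def power_b2_def log_deriv_Fin dlog_Fin)
  next
    case Infty
    then show ?thesis
      using t e(2)[OF t] power_coefficients_reciprocal[of t] by (simp add: field_simps power2_eq_square)
  qed
  moreover have "\<forall>\<^sub>F t in at 0. t \<in> ball 0 e - {0}"
    using e(1) by (auto simp: eventually_at dist_commute intro!: exI[of _ e])
  ultimately show "\<forall>\<^sub>F t in at 0. coeff1 (power_b1 (Fin 0)) p t = power_b1 p t"
    "\<forall>\<^sub>F t in at 0. coeff2 (power_b2 (Fin 0)) p t = power_b2 p t"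
    by (auto elim!: eventually_mono)
qed

lemma riemann_equation_power: "riemann_equation D (power_b1 (Fin 0)) (power_b2 (Fin 0))"
  unfolding riemann_equation_def pole_order_at_most_cong[OF power_coefficients_in_chart(1)]
    pole_order_at_most_cong[OF power_coefficients_in_chart(2)]
proof (intro conjI impI ballI)
  have "dlog (Fin 0) a holomorphic_on {w. Fin w \<notin> D}" if "a \<in> D" for a
  proof (rule analytic_imp_holomorphic)
    show "dlog (Fin 0) a analytic_on {w. Fin w \<notin> D}"
      using analytic_dlog[of "Fin 0" _ a] that by (subst analytic_on_analytic_at) auto
  qed
  then show "power_b1 (Fin 0) holomorphic_on {z. Fin z \<notin> D}" "power_b2 (Fin 0) holomorphic_on {z. Fin z \<notin> D}"
    unfolding power_b1_def power_b2_def log_deriv_def by (intro holomorphic_intros; simp)+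
next
  assume "Infty \<notin> D"
  then have "pole_order_at_most 0 (dlog Infty a)" if "a \<in> D" for a
    using pole_order_dlog[of Infty a] that by auto
  from pole_order_power_coefficients[OF this]
  show "pole_order_at_most 0 (power_b1 Infty)" "pole_order_at_most 0 (power_b2 Infty)" by auto
next
  fix p
  have "pole_order_at_most 1 (dlog p a)" for a
    by (rule pole_order_at_most_mono[OF pole_order_dlog]) simp
  from pole_order_power_coefficients[OF this]
  show "pole_order_at_most 1 (power_b1 p)" "pole_order_at_most 2 (power_b2 p)"
    by (simp_all add: numeral_2_eq_2)
qed

sublocale riemann_ode D "power_b1 (Fin 0)" "power_b2 (Fin 0)"
  using riemann_equation_power by unfold_locales auto

lemma power_germ_solution:
  assumes "p \<notin> D" and st: "(s, t) \<in> {(l, m), (l + \<nu>, m - \<nu>)}"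
  shows "solution_near (power_b1 (Fin 0)) (power_b2 (Fin 0)) p (power_germ s t a b p)"
proof -
  have "ode_lhs (power_b1 (Fin 0)) (power_b2 (Fin 0)) (\<lambda>w. power_germ s t a b p (Fin w)) w = 0"
    if w: "\<forall>\<^sub>F v in nhds w. Fin v \<in> positive_near p" for w
  proof -
    have "Fin w \<notin> D" using eventually_nhds_x_imp_x[OF w] by (simp add: positive_near_def)
    moreover have "\<forall>\<^sub>F v in nhds w. ((\<lambda>w. power_germ s t a b p (Fin w)) has_field_derivative
        log_deriv s t (Fin 0) v * power_germ s t a b p (Fin v)) (at v)"
      using w by eventually_elim (rule DERIV_power_germ)
    ultimately show ?thesis
      using st by (auto simp: ode_lhs_log_derivative[OF _ DERIV_log_deriv] power_b1_def power_b2_def)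
        (simp_all add: log_deriv_def algebra_simps power2_eq_square)
  qed
  moreover have "\<forall>\<^sub>F q in nhds p. \<forall>\<^sub>F r in nhds q. r \<in> positive_near p"
    using eventually_positive_near[OF assms(1)] by (simp add: eventually_eventually)
  ultimately have "ode_near (power_b1 (Fin 0)) (power_b2 (Fin 0)) p (power_germ s t a b p)"
    unfolding ode_near_def by (auto elim!: eventually_mono simp: nhds_Fin eventually_filtermap)
  then show ?thesis using analytic_power_germ[OF assms(1)] by (simp add: solution_near_iff)
qed

definition power_basis :: "complex \<Rightarrow> complex \<Rightarrow> cp1 \<Rightarrow> cp1 \<Rightarrow> complex^2" where
  "power_basis a b p q = vector [power_germ l m a b p q, power_germ (l + \<nu>) (m - \<nu>) a b p q]"

lemma power_basis_solution:
  assumes "p \<notin> D"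
  shows "solution_near (power_b1 (Fin 0)) (power_b2 (Fin 0)) p (\<lambda>q. power_basis a b p q $ j)"
  using power_germ_solution[OF assms] exhaust_2[of j] by (auto simp: power_basis_def)

lemma power_basis_independent:
  assumes "p \<notin> D"
  shows "independent_near p (power_basis a b p)"
proof -
  let ?Y = "power_basis a b p"
  have analytic: "analytic_at_cp1 (\<lambda>q. ?Y q $ j) p" for j
    using power_basis_solution[OF assms] by (simp add: solution_near_iff)
  have "\<forall>\<^sub>F q in nhds p. independent_near q ?Y = independent_near p ?Y"
    using locally_constant_property_independent_near[of UNIV] analytic
    unfolding locally_constant_property_def by blast
  moreover have "\<forall>\<^sub>F q in nhds p. \<forall>j. analytic_at_cp1 (\<lambda>q. ?Y q $ j) q"
    by (intro eventually_all_finite eventually_analytic_at_cp1 analytic)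
  ultimately have nearby: "\<forall>\<^sub>F q in nhds p. independent_near q ?Y = independent_near p ?Y \<and>
      (\<forall>j. analytic_at_cp1 (\<lambda>q. ?Y q $ j) q) \<and> q \<in> positive_near p"
    using eventually_positive_near[OF assms] by eventually_elim simp
  obtain t where t: "t \<noteq> 0" "independent_near (chart p t) ?Y = independent_near p ?Y"
    "\<And>j. analytic_at_cp1 (\<lambda>q. ?Y q $ j) (chart p t)" "chart p t \<in> positive_near p"
    using eventually_nhds_affine_point[OF nearby zero_less_one] by blast
  define w where "w = affine_coord p t"
  have w: "chart p t = Fin w" using t(1) by (simp add: w_def chart_eq_Fin)
  have "wronskian (affine_comp ?Y 1) (affine_comp ?Y 2) w = power_germ l m a b p (Fin w) *
      power_germ (l + \<nu>) (m - \<nu>) a b p (Fin w) * (\<nu> * (dlog (Fin 0) p1 w - dlog (Fin 0) p2 w))"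
    unfolding power_basis_def vector_2 wronskian_def DERIV_imp_deriv[OF DERIV_power_germ[OF t(4)[unfolded w]]]
    by (simp add: log_deriv_def algebra_simps)
  also have "\<dots> \<noteq> 0"
    using \<nu>_nonzero dlog_neq[OF distinct(1)] t(4) power_germ_nonzero by (simp add: w positive_near_def)
  finally have "independent_near (Fin w) ?Y"
    using t(3) w by (intro wronskian_nonzero_imp_independent_near) auto
  then show ?thesis using t(2) w by simp
qed

lemma solution_basis_power: "p \<notin> D \<Longrightarrow> solution_basis (power_b1 (Fin 0)) (power_b2 (Fin 0)) p (power_basis a b p)"
  by (intro solution_basis_if_independent power_basis_solution power_basis_independent)

definition loop_matrix :: "(real \<Rightarrow> cp1) \<Rightarrow> complex^2^2" where
  "loop_matrix g = diag2 (multiplier l m g) (multiplier (l + \<nu>) (m - \<nu>) g)"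

lemma continuation_power_basis:
  assumes g: "is_loop (- D) x g" and ab: "exp a = ratio p1 p3 x" "exp b = ratio p2 p3 x"
  obtains Z' where "continuation_along g (power_basis a b x) Z'" "\<And>q. power_basis a b x q = Z' q v* loop_matrix g"
proof -
  have g_loop: "path g" "path_image g \<subseteq> - D" "pathstart g = x" "pathfinish g = x" "g 0 = x" "g 1 = x"
    using g by (auto simp: is_loop_def pathstart_def pathfinish_def)
  have g_notin_D: "g s \<notin> D" if "s \<in> {0..1}" for s using g_loop(2) that unfolding path_image_def by blast
  obtain k1 where k1: "continuous_on {0..1} k1" "\<And>s. s \<in> {0..1} \<Longrightarrow> ratio p1 p3 (g s) = exp (k1 s)"
    "k1 0 = a" "k1 1 = a + 2 * of_real pi * \<i> * turns p1 p3 g"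
    using continuous_log_of_ratio[OF g_loop(1,2), of p1 p3 a] ab(1) g_loop(3) by auto
  obtain k2 where k2: "continuous_on {0..1} k2" "\<And>s. s \<in> {0..1} \<Longrightarrow> ratio p2 p3 (g s) = exp (k2 s)"
    "k2 0 = b" "k2 1 = b + 2 * of_real pi * \<i> * turns p2 p3 g"
    using continuous_log_of_ratio[OF g_loop(1,2), of p2 p3 b] ab(2) g_loop(3) by auto
  define F where "F = (\<lambda>s. power_basis (k1 s) (k2 s) (g s))"
  have "germ_family g F"
    unfolding germ_family_def
  proof (intro ballI conjI allI)
    fix s :: real assume s: "s \<in> {0..1}"
    show "analytic_at_cp1 (\<lambda>q. F s q $ j) (g s)" for j
      using power_basis_solution[OF g_notin_D[OF s]] by (simp add: F_def solution_near_iff)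
    have "\<forall>\<^sub>F u in at s within {0..1}. \<forall>\<^sub>F q in nhds (g u). log_germ p1 p3 (k1 u) (g u) q = log_germ p1 p3 (k1 s) (g s) q"
      "\<forall>\<^sub>F u in at s within {0..1}. \<forall>\<^sub>F q in nhds (g u). log_germ p2 p3 (k2 u) (g u) q = log_germ p2 p3 (k2 s) (g s) q"
      by (rule log_germ_coherent[OF g_loop(1) k1(1,2) _ s] log_germ_coherent[OF g_loop(1) k2(1,2) _ s]; use g_notin_D in auto)+
    then show "\<forall>\<^sub>F u in at s within {0..1}. \<forall>\<^sub>F q in nhds (g u). F u q = F s q"
    proof eventually_elim
      case (elim u)
      then show ?case by eventually_elim (simp add: F_def power_basis_def power_germ_def)
    qed
  qed
  then have "continuation_along g (power_basis a b x) (F 1)"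
    unfolding continuation_along_iff by (intro exI[of _ F]) (simp add: F_def k1(3) k2(3) g_loop)
  moreover have "power_basis a b x q = F 1 q v* loop_matrix g" for q
    unfolding vec_eq_iff forall_2 loop_matrix_def vector_diag2 F_def power_basis_def vector_2 g_loop(6) k1(4) k2(4)
      multiplier_def
    using power_germ_turns by (simp add: mult.commute)
  ultimately show ?thesis by (rule that)
qed

end

section \<open>Matrix representations\<close>

lemma matrix_inv_both:
  assumes "invertible (S :: 'a::semiring_1^'n^'m)"
  shows "S ** matrix_inv S = mat 1" "matrix_inv S ** S = mat 1"
proof -
  have "S ** matrix_inv S = mat 1 \<and> matrix_inv S ** S = mat 1"
    using assms unfolding matrix_inv_def invertible_def by (rule someI_ex)
  then show "S ** matrix_inv S = mat 1" "matrix_inv S ** S = mat 1" by auto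
qed

lemma diag2_mult: "diag2 a b ** diag2 c d = diag2 (a * c) (b * d)"
  by (simp add: diag2_def matrix_matrix_mult_def vec_eq_iff forall_2 sum_2)

lemma diag2_eq_iff: "diag2 a b = diag2 c d \<longleftrightarrow> a = c \<and> b = d"
  by (auto simp: diag2_def vec_eq_iff forall_2)

lemma scalar_matrix_diag2_iff: "scalar_matrix (diag2 a b) \<longleftrightarrow> a = b"
  unfolding scalar_matrix_def diag2_scalar[symmetric] diag2_eq_iff by auto

lemma invertible_diag2_iff: "invertible (diag2 a b) \<longleftrightarrow> a \<noteq> 0 \<and> b \<noteq> 0"
  by (simp add: invertible_det_nz det_2 diag2_def)

lemma subgroup_diagonal: "subgroup {diag2 a b | a b. a \<noteq> 0 \<and> b \<noteq> 0} GL2"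
proof (rule group.subgroupI[OF group_GL2])
  fix A assume "A \<in> {diag2 a b | a b. a \<noteq> 0 \<and> b \<noteq> 0}"
  then obtain a b where A: "A = diag2 a b" "a \<noteq> 0" "b \<noteq> 0" by blast
  then have "inv\<^bsub>GL2\<^esub> A = diag2 (1 / a) (1 / b)"
    by (intro group.inv_equality[OF group_GL2]) (simp_all add: GL2_def invertible_diag2_iff diag2_mult diag2_scalar)
  then show "inv\<^bsub>GL2\<^esub> A \<in> {diag2 a b | a b. a \<noteq> 0 \<and> b \<noteq> 0}"
    using A by (intro CollectI exI[of _ "1 / a"] exI[of _ "1 / b"]) simp
next
  fix A B assume "A \<in> {diag2 a b | a b. a \<noteq> 0 \<and> b \<noteq> 0}" "B \<in> {diag2 a b | a b. a \<noteq> 0 \<and> b \<noteq> 0}"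
  then show "A \<otimes>\<^bsub>GL2\<^esub> B \<in> {diag2 a b | a b. a \<noteq> 0 \<and> b \<noteq> 0}"
    by (auto simp: GL2_def diag2_mult) (metis mult_eq_0_iff)
qed (auto simp: GL2_def invertible_diag2_iff intro: zero_neq_one[symmetric])

lemma hom_image_subset_subgroup:
  assumes "group G" "group H" "f \<in> hom G H" "generate G S = carrier G" "subgroup K H" "f ` S \<subseteq> K"
  shows "f ` carrier G \<subseteq> K"
proof -
  interpret group_hom G H f using assms by (simp add: group_hom_def group_hom_axioms_def)
  have "S \<subseteq> carrier G" using generate.incl[of _ S G] assms(4) by auto
  then show ?thesis
    using generate_img[of S] group.generate_subgroup_incl[OF assms(2,6,5)] assms(4) by simp
qed

lemma hom_eqI_generate:
  assumes "group G" "group H" "f \<in> hom G H" "g \<in> hom G H" "generate G S = carrier G"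
    and "\<And>a. a \<in> S \<Longrightarrow> f a = g a" and "a \<in> carrier G"
  shows "f a = g a"
proof -
  interpret f: group_hom G H f using assms by (simp add: group_hom_def group_hom_axioms_def)
  interpret g: group_hom G H g using assms by (simp add: group_hom_def group_hom_axioms_def)
  have S_subset: "S \<subseteq> carrier G" using generate.incl[of _ S G] assms(5) by auto
  have "a \<in> generate G S" using assms(5,7) by simp
  then show ?thesis
    by (induction rule: generate.induct) (use S_subset assms(5,6) in auto)
qed

lemma hom_GL2_conjugate:
  assumes "\<rho> \<in> hom P GL2" "invertible S"
  shows "(\<lambda>A. matrix_inv S ** \<rho> A ** S) \<in> hom P GL2"
proof (rule homI)
  have "invertible (matrix_inv S)" using matrix_inv_both[OF assms(2)] unfolding invertible_def by blast
  then show "matrix_inv S ** \<rho> A ** S \<in> carrier GL2" if "A \<in> carrier P" for A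
    using hom_in_carrier[OF assms(1) that] assms(2) by (simp add: GL2_def invertible_mult)
  show "matrix_inv S ** \<rho> (A \<otimes>\<^bsub>P\<^esub> B) ** S
      = (matrix_inv S ** \<rho> A ** S) \<otimes>\<^bsub>GL2\<^esub> (matrix_inv S ** \<rho> B ** S)"
    if "A \<in> carrier P" "B \<in> carrier P" for A B
  proof -
    have "(matrix_inv S ** \<rho> A ** S) ** (matrix_inv S ** \<rho> B ** S)
        = matrix_inv S ** \<rho> A ** (S ** matrix_inv S) ** \<rho> B ** S"
      by (simp only: matrix_mul_assoc)
    then show ?thesis
      using hom_mult[OF assms(1) that] by (simp add: GL2_def matrix_inv_both[OF assms(2)] matrix_mul_assoc)
  qed
qed

lemma scalar_matrix_conjugate:
  assumes "invertible S"
  shows "scalar_matrix (matrix_inv S ** A ** S) \<longleftrightarrow> scalar_matrix A"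
proof -
  have commute: "(A :: complex^2^2) ** mat c = mat c ** A" for A c
    by (simp add: mat_def matrix_matrix_mult_def vec_eq_iff sum_2 forall_2)
  have "matrix_inv S ** A ** S = mat c \<longleftrightarrow> A = mat c" for c
  proof
    assume "matrix_inv S ** A ** S = mat c"
    then have "(S ** matrix_inv S) ** A ** (S ** matrix_inv S) = S ** mat c ** matrix_inv S"
      by (metis matrix_mul_assoc)
    also have "\<dots> = mat c ** (S ** matrix_inv S)" by (simp add: commute matrix_mul_assoc)
    finally show "A = mat c" by (simp add: matrix_inv_both[OF assms])
  next
    assume "A = mat c"
    then have "matrix_inv S ** A ** S = mat c ** (matrix_inv S ** S)" by (simp add: commute matrix_mul_assoc)
    then show "matrix_inv S ** A ** S = mat c" by (simp add: matrix_inv_both[OF assms])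
  qed
  then show ?thesis by (simp add: scalar_matrix_def)
qed

lemma sum_vector_matrix_mult:
  fixes M :: "complex^2^2"
  shows "(\<Sum>j\<in>UNIV. c $ j * (y v* M) $ j) = (\<Sum>j\<in>UNIV. (M *v c) $ j * y $ j)"
  by (simp add: vector_matrix_mult_2 sum_2 matrix_vector_mult_def algebra_simps)

lemma solution_basis_matrix:
  assumes "solution_basis b1 b2 p Y" "invertible M"
  shows "solution_basis b1 b2 p (\<lambda>q. Y q v* M)"
  unfolding solution_basis_def sum_vector_matrix_mult
proof (intro conjI allI impI)
  show "solution_near b1 b2 p (\<lambda>q. (Y q v* M) $ j)" for j
    using assms(1) by (intro solution_near_matrix) (simp add: solution_basis_def)
next
  fix c :: "complex^2"
  assume "\<forall>\<^sub>F q in nhds p. (\<Sum>j\<in>UNIV. (M *v c) $ j * Y q $ j) = 0"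
  then have "M *v c = 0" using assms(1) unfolding solution_basis_def by blast
  then have "(matrix_inv M ** M) *v c = 0" by (simp add: matrix_vector_mul_assoc[symmetric])
  then show "c = 0" by (simp add: matrix_inv_both[OF assms(2)])
next
  fix y assume "solution_near b1 b2 p y"
  then obtain c :: "complex^2" where c: "\<forall>\<^sub>F q in nhds p. y q = (\<Sum>j\<in>UNIV. c $ j * Y q $ j)"
    using assms(1) unfolding solution_basis_def by blast
  have "M *v (matrix_inv M *v c) = c"
    by (simp add: matrix_vector_mul_assoc matrix_inv_both[OF assms(2)])
  then show "\<exists>c. \<forall>\<^sub>F q in nhds p. y q = (\<Sum>j\<in>UNIV. (M *v c) $ j * Y q $ j)"
    using c by (intro exI[of _ "matrix_inv M *v c"]) simp
qed

lemma realizes_conjugate: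
  assumes "realizes D x b1 b2 \<rho>" "invertible S"
  shows "realizes D x b1 b2 (\<lambda>A. matrix_inv S ** \<rho> A ** S)"
proof -
  obtain Y where Y: "solution_basis b1 b2 x Y"
    and monodromy: "\<And>\<gamma>. is_loop (- D) x \<gamma> \<Longrightarrow> \<exists>Y'. continuation_along \<gamma> Y Y' \<and>
      (\<forall>\<^sub>F q in nhds x. Y q = Y' q v* \<rho> (path_class (- D) \<gamma>))"
    using assms(1) unfolding realizes_def by blast
  have "\<exists>Y'. continuation_along \<gamma> (\<lambda>q. Y q v* S) Y' \<and>
      (\<forall>\<^sub>F q in nhds x. Y q v* S = Y' q v* (matrix_inv S ** \<rho> (path_class (- D) \<gamma>) ** S))"
    if \<gamma>: "is_loop (- D) x \<gamma>" for \<gamma>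
  proof -
    let ?M = "\<rho> (path_class (- D) \<gamma>)"
    obtain Y' where Y': "continuation_along \<gamma> Y Y'" "\<forall>\<^sub>F q in nhds x. Y q = Y' q v* ?M"
      using monodromy[OF \<gamma>] by blast
    have "S ** (matrix_inv S ** ?M ** S) = (S ** matrix_inv S) ** ?M ** S" by (simp only: matrix_mul_assoc)
    also have "\<dots> = ?M ** S" by (simp add: matrix_inv_both[OF assms(2)])
    finally have cancel: "S ** (matrix_inv S ** ?M ** S) = ?M ** S" .
    have "\<forall>\<^sub>F q in nhds x. Y q v* S = (Y' q v* S) v* (matrix_inv S ** ?M ** S)"
      using Y'(2) by eventually_elim (simp add: vector_matrix_mul_assoc cancel)
    then show ?thesis using continuation_along_matrix[OF Y'(1), of S] by blast
  qed
  then show ?thesis unfolding realizes_def using solution_basis_matrix[OF Y assms(2)] by blast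
qed

lemma realizes_conjugate_iff:
  assumes "invertible S"
  shows "realizes D x b1 b2 (\<lambda>A. matrix_inv S ** \<rho> A ** S) \<longleftrightarrow> realizes D x b1 b2 \<rho>"
proof
  let ?T = "matrix_inv S"
  have inverse: "invertible ?T" "matrix_inv ?T = S"
  proof -
    show "invertible ?T" using matrix_inv_both[OF assms] unfolding invertible_def by blast
    from matrix_inv_both[OF this] have "matrix_inv ?T = matrix_inv ?T ** (?T ** S)"
      by (simp add: matrix_inv_both[OF assms])
    then show "matrix_inv ?T = S"
      by (simp add: matrix_mul_assoc matrix_inv_both[OF \<open>invertible ?T\<close>])
  qed
  assume "realizes D x b1 b2 (\<lambda>A. ?T ** \<rho> A ** S)"
  then have "realizes D x b1 b2 (\<lambda>A. S ** (?T ** \<rho> A ** S) ** ?T)"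
    using realizes_conjugate[OF _ inverse(1)] inverse(2) by fastforce
  moreover have "S ** (?T ** M ** S) ** ?T = (S ** ?T) ** M ** (S ** ?T)" for M
    by (simp only: matrix_mul_assoc)
  ultimately show "realizes D x b1 b2 \<rho>" by (simp add: matrix_inv_both[OF assms])
qed (rule realizes_conjugate[OF _ assms])

context power_solutions
begin

definition class_matrix :: "(real \<Rightarrow> cp1) set \<Rightarrow> complex^2^2" where
  "class_matrix A = loop_matrix (SOME g. g \<in> A)"

lemma class_matrix_path_class:
  assumes "is_loop (- D) x g"
  shows "class_matrix (path_class (- D) g) = loop_matrix g"
proof -
  have "g \<in> path_class (- D) g" using assms by (simp add: path_class_def is_loop_def)
  then have "(SOME h. h \<in> path_class (- D) g) \<in> path_class (- D) g"
    unfolding some_in_eq by blast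
  then show ?thesis
    unfolding class_matrix_def loop_matrix_def by (simp add: path_class_def multiplier_homotopic)
qed

lemma class_matrix_hom: "class_matrix \<in> hom (fundamental_group (- D) x) GL2"
proof (rule homI)
  show "class_matrix A \<in> carrier GL2" if "A \<in> carrier (fundamental_group (- D) x)" for A
    using that by (auto simp: carrier_fundamental_group class_matrix_path_class loop_matrix_def GL2_def
        invertible_diag2_iff multiplier_def turn_factor_nonzero)
  show "class_matrix (A \<otimes>\<^bsub>fundamental_group (- D) x\<^esub> B) = class_matrix A \<otimes>\<^bsub>GL2\<^esub> class_matrix B"
    if AB: "A \<in> carrier (fundamental_group (- D) x)" "B \<in> carrier (fundamental_group (- D) x)" for A B
  proof -
    obtain g h where "A = path_class (- D) g" "B = path_class (- D) h"
      and loops: "is_loop (- D) x g" "is_loop (- D) x h"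
      using AB by (auto simp: carrier_fundamental_group)
    then show ?thesis
      using class_matrix_path_class[OF is_loop_join[OF loops]]
      by (simp add: mult_path_class class_matrix_path_class loop_matrix_def multiplier_join diag2_mult GL2_def)
  qed
qed

lemma realizes_if_eq_class_matrix:
  assumes "x \<notin> D" and \<rho>: "\<And>A. A \<in> carrier (fundamental_group (- D) x) \<Longrightarrow> \<rho> A = class_matrix A"
  shows "realizes D x (power_b1 (Fin 0)) (power_b2 (Fin 0)) \<rho>"
proof -
  let ?Y = "power_basis (Ln (ratio p1 p3 x)) (Ln (ratio p2 p3 x)) x"
  have "\<exists>Y'. continuation_along g ?Y Y' \<and> (\<forall>\<^sub>F q in nhds x. ?Y q = Y' q v* \<rho> (path_class (- D) g))"
    if g: "is_loop (- D) x g" for g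
  proof -
    have "exp (Ln (ratio p1 p3 x)) = ratio p1 p3 x" "exp (Ln (ratio p2 p3 x)) = ratio p2 p3 x"
      using assms(1) ratio_nonzero by auto
    then obtain Y' where "continuation_along g ?Y Y'" "\<And>q. ?Y q = Y' q v* loop_matrix g"
      using continuation_power_basis[OF g] by blast
    moreover have "path_class (- D) g \<in> carrier (fundamental_group (- D) x)"
      using g by (auto simp: carrier_fundamental_group)
    then have "\<rho> (path_class (- D) g) = loop_matrix g"
      using class_matrix_path_class[OF g] by (simp add: \<rho>)
    ultimately show ?thesis by (intro exI[of _ Y']) simp
  qed
  then show ?thesis unfolding realizes_def using solution_basis_power[OF assms(1)] by blast
qed

end

section \<open>Realization of diagonal representations\<close>

lemma standard_loopsD:
  assumes "standard_loops a x \<gamma>"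
  shows "loop_around (range a) x (a i) (\<gamma> i)"
    and "generate (fundamental_group (- range a) x) (range (\<lambda>i. path_class (- range a) (\<gamma> i))) =
      carrier (fundamental_group (- range a) x)"
    and "path_class (- range a) (\<gamma> i) \<in> carrier (fundamental_group (- range a) x)"
proof -
  show around: "loop_around (range a) x (a i) (\<gamma> i)"
    and "generate (fundamental_group (- range a) x) (range (\<lambda>i. path_class (- range a) (\<gamma> i))) =
      carrier (fundamental_group (- range a) x)"
    using assms by (simp_all add: standard_loops_def Let_def)
  show "path_class (- range a) (\<gamma> i) \<in> carrier (fundamental_group (- range a) x)"
    using loop_around_is_loop[OF around] by (auto simp: carrier_fundamental_group)
qed

lemma standard_loops_prod_eq_1:
  assumes "x \<notin> range a" "standard_loops a x \<gamma>" "\<rho> \<in> hom (fundamental_group (- range a) x) GL2"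
    and diag: "\<And>i. \<rho> (path_class (- range a) (\<gamma> i)) = diag2 (\<alpha> i) (\<beta> i)"
  shows "(\<Prod>i\<in>UNIV. \<alpha> i) = 1" "(\<Prod>i\<in>UNIV. \<beta> i) = 1"
proof -
  let ?P = "fundamental_group (- range a) x" and ?c = "\<lambda>i. path_class (- range a) (\<gamma> i)"
  interpret group_hom ?P GL2 \<rho>
    using assms(1,3) group_GL2 by (simp add: group_hom_def group_hom_axioms_def group_fundamental_group)
  have "\<rho> (?c 1) \<otimes>\<^bsub>GL2\<^esub> \<rho> (?c 2) \<otimes>\<^bsub>GL2\<^esub> \<rho> (?c 3) = \<rho> (?c 1 \<otimes>\<^bsub>?P\<^esub> ?c 2 \<otimes>\<^bsub>?P\<^esub> ?c 3)"
    using standard_loopsD(3)[OF assms(2)] by simp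
  also have "?c 1 \<otimes>\<^bsub>?P\<^esub> ?c 2 \<otimes>\<^bsub>?P\<^esub> ?c 3 = \<one>\<^bsub>?P\<^esub>"
    using assms(2) by (simp add: standard_loops_def Let_def)
  finally have "\<rho> (?c 1) ** \<rho> (?c 2) ** \<rho> (?c 3) = mat 1"
    using hom_one by (simp add: GL2_def)
  then have "\<alpha> 1 * \<alpha> 2 * \<alpha> 3 = 1 \<and> \<beta> 1 * \<beta> 2 * \<beta> 3 = 1"
    unfolding diag diag2_mult diag2_scalar[of 1, symmetric] diag2_eq_iff .
  then show "(\<Prod>i\<in>UNIV. \<alpha> i) = 1" "(\<Prod>i\<in>UNIV. \<beta> i) = 1"
    unfolding UNIV_3 by (simp_all add: mult.assoc)
qed

lemma realized_diagonal_imp_scalar: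
  fixes a :: "3 \<Rightarrow> cp1"
  assumes a: "inj a" "x \<notin> range a" and loops: "standard_loops a x \<gamma>"
    and \<rho>: "\<rho> \<in> hom (fundamental_group (- range a) x) GL2"
    and diag: "\<And>i. \<rho> (path_class (- range a) (\<gamma> i)) = diag2 (\<alpha> i) (\<beta> i)"
    and riemann: "riemann_equation (range a) b1 b2" and realizes: "realizes (range a) x b1 b2 \<rho>"
  shows "\<exists>i. scalar_matrix (\<rho> (path_class (- range a) (\<gamma> i)))"
proof -
  let ?P = "fundamental_group (- range a) x" and ?c = "\<lambda>i. path_class (- range a) (\<gamma> i)"
  have "\<alpha> i \<noteq> 0 \<and> \<beta> i \<noteq> 0" for i
    using hom_in_carrier[OF \<rho> standard_loopsD(3)[OF loops, of i]] by (simp add: diag GL2_def invertible_diag2_iff)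
  then have "\<rho> ` range ?c \<subseteq> {diag2 u v | u v. u \<noteq> 0 \<and> v \<noteq> 0}"
    using diag by blast
  then have "\<rho> ` carrier ?P \<subseteq> {diag2 u v | u v. u \<noteq> 0 \<and> v \<noteq> 0}"
    by (rule hom_image_subset_subgroup[OF group_fundamental_group group_GL2 \<rho> standard_loopsD(2)[OF loops]
          subgroup_diagonal, rotated]) (use a(2) in simp)
  moreover have "path_class (- range a) g \<in> carrier ?P" if "is_loop (- range a) x g" for g
    using that by (auto simp: carrier_fundamental_group)
  ultimately have diagonal: "\<exists>u v. u \<noteq> 0 \<and> v \<noteq> 0 \<and> \<rho> (path_class (- range a) g) = diag2 u v"
    if "is_loop (- range a) x g" for g
    using that by blast
  obtain Z where "solution_basis b1 b2 x Z"
    "\<And>g. is_loop (- range a) x g \<Longrightarrow> \<exists>Z'. continuation_along g Z Z' \<and>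
      (\<forall>\<^sub>F q in nhds x. Z q = Z' q v* \<rho> (path_class (- range a) g))"
    using realizes unfolding realizes_def by blast
  then interpret diagonal_monodromy "range a" b1 b2 x Z \<rho>
    using a(2) riemann diagonal by unfold_locales auto
  have "card (range a) = 3" using a(1) by (simp add: card_image)
  then show ?thesis
    using exists_scalar_local_monodromy standard_loopsD(1)[OF loops] by (metis rangeE)
qed

lemma exponents_exist:
  assumes "a1 \<noteq> 0" "a2 \<noteq> 0" "b1 \<noteq> 0" "a1 * a2 = b1 * b2"
  obtains l m \<nu> where "\<nu> \<noteq> 0" "turn_factor l = a1" "turn_factor m = a2"
    "turn_factor (l + \<nu>) = b1" "turn_factor (m - \<nu>) = b2"
proof -
  obtain l where l: "turn_factor l = a1" using turn_factor_surj assms(1) by blast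
  obtain m where m: "turn_factor m = a2" using turn_factor_surj assms(2) by blast
  obtain \<nu> where \<nu>: "\<nu> \<noteq> 0" "turn_factor \<nu> = b1 / a1"
    using turn_factor_surj_nonzero[of "b1 / a1"] assms(1,3) by auto
  have "turn_factor (m - \<nu>) = a2 * a1 / b1"
    using turn_factor_add[of m "- \<nu>"] by (simp add: m \<nu>(2) turn_factor_minus)
  also have "\<dots> = b2" using assms(3,4) by (simp add: field_simps)
  finally show ?thesis using that[of \<nu> l m] l m \<nu> assms(1) by (simp add: turn_factor_add)
qed

lemma UNIV_3_cases:
  obtains i j where "i \<noteq> j" "i \<noteq> k" "j \<noteq> k" "(UNIV :: 3 set) = {i, j, k}"
proof -
  have "card (UNIV - {k} :: 3 set) = 2" by (simp add: card_Diff_singleton)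
  then obtain i j where ij: "UNIV - {k} = {i, j}" "i \<noteq> j" unfolding card_2_iff by blast
  have "(UNIV :: 3 set) = insert k (UNIV - {k})" by auto
  then show ?thesis using that[of i j] ij by auto
qed

lemma scalar_imp_realized:
  fixes a :: "3 \<Rightarrow> cp1"
  assumes a: "inj a" "x \<notin> range a" and loops: "standard_loops a x \<gamma>"
    and \<rho>: "\<rho> \<in> hom (fundamental_group (- range a) x) GL2"
    and diag: "\<And>i. \<rho> (path_class (- range a) (\<gamma> i)) = diag2 (\<alpha> i) (\<beta> i)"
    and scalar: "\<alpha> k = \<beta> k"
  shows "\<exists>b1 b2. riemann_equation (range a) b1 b2 \<and> realizes (range a) x b1 b2 \<rho>"
proof -
  let ?P = "fundamental_group (- range a) x" and ?c = "\<lambda>i. path_class (- range a) (\<gamma> i)"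
  have nonzero: "\<alpha> i \<noteq> 0" "\<beta> i \<noteq> 0" for i
    using hom_in_carrier[OF \<rho> standard_loopsD(3)[OF loops, of i]]
    by (simp_all add: diag GL2_def invertible_diag2_iff)
  obtain i j where ij: "i \<noteq> j" "i \<noteq> k" "j \<noteq> k" and univ: "UNIV = {i, j, k}"
    by (rule UNIV_3_cases[of k])
  have prods: "\<alpha> i * \<alpha> j * \<alpha> k = 1" "\<beta> i * \<beta> j * \<beta> k = 1"
    using standard_loops_prod_eq_1[OF a(2) loops \<rho> diag] ij unfolding univ by (simp_all add: mult.assoc)
  then have "\<alpha> i * \<alpha> j = \<beta> i * \<beta> j" using scalar nonzero(2)[of k] by (metis mult_right_cancel)
  then obtain l m \<nu> where "\<nu> \<noteq> 0" and exponents: "turn_factor l = \<alpha> i" "turn_factor m = \<alpha> j"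
    "turn_factor (l + \<nu>) = \<beta> i" "turn_factor (m - \<nu>) = \<beta> j"
    by (rule exponents_exist[OF nonzero(1)[of i] nonzero(1)[of j] nonzero(2)[of i]])
  interpret power_solutions "a i" "a j" "a k" l m \<nu>
    by standard (use a(1) ij \<open>\<nu> \<noteq> 0\<close> in \<open>auto dest: injD\<close>)
  have range_a: "range a = {a i, a j, a k}" unfolding univ by simp
  have "turn_factor (- (l + m)) = \<alpha> k"
    using prods(1) nonzero exponents by (simp only: turn_factor_minus turn_factor_add) (simp add: field_simps)
  then have "diag2 (\<alpha> n) (\<beta> n) = loop_matrix (\<gamma> n)" for n
    using univ ij scalar exponents multiplier_loop_around[OF standard_loopsD(1)[OF loops, of n, unfolded range_a]]
      inj_eq[OF a(1)]
    by (cases "n = i"; cases "n = j"; cases "n = k") (auto simp: loop_matrix_def diag2_eq_iff)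
  then have "\<rho> (?c n) = class_matrix (?c n)" for n
    using class_matrix_path_class[of x "\<gamma> n"] loop_around_is_loop[OF standard_loopsD(1)[OF loops]]
    by (simp add: diag[unfolded range_a] range_a)
  then have agree: "\<rho> A = class_matrix A" if "A \<in> range ?c" for A using that by auto
  have group: "group ?P" using a(2) by (intro group_fundamental_group) simp
  have "\<rho> A = class_matrix A" if "A \<in> carrier ?P" for A
    by (rule hom_eqI_generate[OF group group_GL2 \<rho> class_matrix_hom[folded range_a] standard_loopsD(2)[OF loops] agree that])
  then have "realizes (range a) x (power_b1 (Fin 0)) (power_b2 (Fin 0)) \<rho>"
    unfolding range_a using a(2) by (intro realizes_if_eq_class_matrix) (auto simp: range_a)
  then show ?thesis using riemann_equation_power unfolding range_a by blast
qed

theorem theorem1p2: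
  fixes a :: "3 \<Rightarrow> cp1" and x :: cp1
    and \<gamma> :: "3 \<Rightarrow> real \<Rightarrow> cp1"
    and \<rho> :: "(real \<Rightarrow> cp1) set \<Rightarrow> complex^2^2"
    and G :: "3 \<Rightarrow> complex^2^2"
  assumes "inj a"
    and "x \<notin> range a"
    and "standard_loops a x \<gamma>"
    and "\<rho> \<in> hom (fundamental_group (- range a) x) GL2"
    and "\<And>i. G i = \<rho> (path_class (- range a) (\<gamma> i))"
    and "\<exists>S \<alpha> \<beta>. invertible S \<and> (\<forall>i. matrix_inv S ** G i ** S = diag2 (\<alpha> i) (\<beta> i))"
  shows "(\<exists>b1 b2. riemann_equation (range a) b1 b2 \<and> realizes (range a) x b1 b2 \<rho>) \<longleftrightarrow>
         (\<exists>i. scalar_matrix (G i))"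
proof -
  obtain S \<alpha> \<beta> where S: "invertible S" and "\<And>i. matrix_inv S ** G i ** S = diag2 (\<alpha> i) (\<beta> i)"
    using assms(6) by blast
  define \<sigma> where "\<sigma> = (\<lambda>A. matrix_inv S ** \<rho> A ** S)"
  have hom: "\<sigma> \<in> hom (fundamental_group (- range a) x) GL2"
    unfolding \<sigma>_def by (rule hom_GL2_conjugate[OF assms(4) S])
  have diag: "\<sigma> (path_class (- range a) (\<gamma> i)) = diag2 (\<alpha> i) (\<beta> i)" for i
    using \<open>matrix_inv S ** G i ** S = diag2 (\<alpha> i) (\<beta> i)\<close> assms(5) by (simp add: \<sigma>_def)
  have "realizes (range a) x b1 b2 \<rho> \<longleftrightarrow> realizes (range a) x b1 b2 \<sigma>" for b1 b2
    unfolding \<sigma>_def by (rule realizes_conjugate_iff[OF S, symmetric])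
  moreover have "scalar_matrix (G i) \<longleftrightarrow> scalar_matrix (\<sigma> (path_class (- range a) (\<gamma> i)))" for i
    by (simp add: \<sigma>_def assms(5) scalar_matrix_conjugate[OF S])
  moreover have "scalar_matrix (\<sigma> (path_class (- range a) (\<gamma> i))) \<longleftrightarrow> \<alpha> i = \<beta> i" for i
    by (simp add: diag scalar_matrix_diag2_iff)
  ultimately show ?thesis
    using realized_diagonal_imp_scalar[OF assms(1-3) hom diag] scalar_imp_realized[OF assms(1-3) hom diag]
    by metis
qed

end
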